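(* Let $k$ be a field and $\Pi$ a finite poset. Given a (bounded) injective complex $(I^\bullet,\eta^\bullet)$ on $\Pi$ represented by labeled matrices $\eta^0,\dots,\eta^n$, the peeling algorithm described in the context outputs a labeled matrix representation of a minimal injective complex quasi-isomorphic to $(I^\bullet,\eta^\bullet)$.
   Context: A sheaf on a finite poset $\Pi$ is a functor from $\Pi$ to finite-dimensional $k$-vector spaces. $\mathrm{St}\,\pi=\{\tau\in\Pi:\pi\le\tau\}$. $[\pi]$ is the sheaf with $[\pi](\sigma)=k$ for $\sigma\le\pi$ and $0$ otherwise (identity maps between copies of $k$); injective sheaves are exactly the sheaves isomorphic to finite direct sums of these. A complex of injective sheaves is minimal if in each degree its number of indecomposable summands is least among all bounded complexes of injective sheaves quasi-isomorphic to it. A $\Pi$-labeled matrix is a matrix over $k$ with each row and column labeled by an element of $\Pi$ (repetitions allowed), such that the entry in a row labeled $\sigma$ and column labeled $\pi$ is nonzero only if $\sigma\le\pi$. $M[S,P]$ denotes the submatrix of rows with labels in $S$ and columns with labels in $P$, and $M[\sigma,\pi]:=M[\{\sigma\},\{\pi\}]$. With column labels $\pi_1,\dots,\pi_m$ and row labels $\sigma_1,\dots,\sigma_n$ it represents the natural transformation $\bigoplus_i[\pi_i]\to\bigoplus_j[\sigma_j]$ whose component at $\tau$ is the matrix $M[\mathrm{St}\,\tau,\mathrm{St}\,\tau]$. A complex of labeled matrices is a sequence with the columns of $\eta^{d+1}$ labeled as the rows of $\eta^d$ and $\eta^{d+1}\eta^d=0$; it represents the corresponding injective complex. Matrices outside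 degrees $0,\dots,n$ are zero/empty. Peeling algorithm. While there are $d$ and $\pi\in\Pi$ with $\eta^d[\pi,\pi]$ a nonzero matrix: (i) find invertible labeled (change of basis) matrices $L,R$ such that, for $M=L\eta^dR$: $M[\pi,\pi]$ is a diagonal matrix with entries in $\{0,1\}$; every $\pi$-labeled column of $M$ is zero either on the rows labeled $\pi$ or on the rows with labels in $\Pi\setminus\{\pi\}$; every $\pi$-labeled row of $M$ is zero either on the columns labeled $\pi$ or on the columns with labels in $\Pi\setminus\{\pi\}$; (ii) replace $\eta^d$ by $L\eta^dR$, $\eta^{d-1}$ by $R^{-1}\eta^{d-1}$, and $\eta^{d+1}$ by $\eta^{d+1}L^{-1}$; (iii) while there are an $i$-th row and a $j$-th column of $\eta^d$, both labeled $\pi$, with $(i,j)$ entry $1$: delete the $i$-th row and $j$-th column of $\eta^d$, the $j$-th row of $\eta^{d-1}$, and the $i$-th column of $\eta^{d+1}$. Return $\eta^0,\dots,\eta^n$. *)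

theory Defs
  imports
    "Jordan_Normal_Form.DL_Submatrix"
    "Jordan_Normal_Form.Matrix_Kernel"
begin

section \<open>Sheaves on a poset\<close>

text \<open>
  Finite-dimensional vector spaces are modelled by the skeleton of that category: an object is a
  natural number \<open>n\<close>, standing for \<open>carrier_vec n\<close>, and a linear map is a matrix.
  The values of \<open>res F \<sigma> \<tau>\<close> matter only when \<open>\<sigma> \<le> \<tau>\<close>.
\<close>

record ('p, 'k) sheaf_data =
  stalk_dim :: "'p \<Rightarrow> nat"
  res :: "'p \<Rightarrow> 'p \<Rightarrow> 'k mat"

definition sheaf :: "('p::order, 'k::field) sheaf_data \<Rightarrow> bool" where
  "sheaf F \<longleftrightarrow>
     (\<forall>\<sigma> \<tau>. \<sigma> \<le> \<tau> \<longrightarrow> res F \<sigma> \<tau> \<in> carrier_mat (stalk_dim F \<tau>) (stalk_dim F \<sigma>)) \<and>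
     (\<forall>\<sigma>. res F \<sigma> \<sigma> = 1\<^sub>m (stalk_dim F \<sigma>)) \<and>
     (\<forall>\<rho> \<sigma> \<tau>. \<rho> \<le> \<sigma> \<and> \<sigma> \<le> \<tau> \<longrightarrow> res F \<sigma> \<tau> * res F \<rho> \<sigma> = res F \<rho> \<tau>)"

definition natural ::
  "('p::order, 'k::field) sheaf_data \<Rightarrow> ('p, 'k) sheaf_data \<Rightarrow> ('p \<Rightarrow> 'k mat) \<Rightarrow> bool" where
  "natural F G \<phi> \<longleftrightarrow>
     (\<forall>\<sigma>. \<phi> \<sigma> \<in> carrier_mat (stalk_dim G \<sigma>) (stalk_dim F \<sigma>)) \<and>
     (\<forall>\<sigma> \<tau>. \<sigma> \<le> \<tau> \<longrightarrow> \<phi> \<tau> * res F \<sigma> \<tau> = res G \<sigma> \<tau> * \<phi> \<sigma>)"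

definition sheaf_iso ::
  "('p::order, 'k::field) sheaf_data \<Rightarrow> ('p, 'k) sheaf_data \<Rightarrow> bool" where
  "sheaf_iso F G \<longleftrightarrow>
     (\<exists>\<phi> \<psi>. natural F G \<phi> \<and> natural G F \<psi> \<and>
       (\<forall>\<sigma>. \<psi> \<sigma> * \<phi> \<sigma> = 1\<^sub>m (stalk_dim F \<sigma>) \<and> \<phi> \<sigma> * \<psi> \<sigma> = 1\<^sub>m (stalk_dim G \<sigma>)))"

definition zero_sheaf :: "('p, 'k) sheaf_data \<Rightarrow> bool" where
  "zero_sheaf F \<longleftrightarrow> (\<forall>\<sigma>. stalk_dim F \<sigma> = 0)"

definition direct_sum ::
  "('p, 'k::field) sheaf_data list \<Rightarrow> ('p, 'k) sheaf_data" where
  "direct_sum Fs =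
     \<lparr> stalk_dim = \<lambda>\<sigma>. \<Sum>F\<leftarrow>Fs. stalk_dim F \<sigma>,
       res = \<lambda>\<sigma> \<tau>. diag_block_mat (map (\<lambda>F. res F \<sigma> \<tau>) Fs) \<rparr>"

text \<open>The sheaf \<open>[\<pi>]\<close>.\<close>

definition elem_sheaf :: "'p::order \<Rightarrow> ('p, 'k::field) sheaf_data" where
  "elem_sheaf \<pi> =
     \<lparr> stalk_dim = \<lambda>\<sigma>. if \<sigma> \<le> \<pi> then 1 else 0,
       res = \<lambda>\<sigma> \<tau>. if \<tau> \<le> \<pi> then 1\<^sub>m 1 else 0\<^sub>m 0 (if \<sigma> \<le> \<pi> then 1 else 0) \<rparr>"

definition injective_sheaf :: "('p::order, 'k::field) sheaf_data \<Rightarrow> bool" where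
  "injective_sheaf F \<longleftrightarrow> sheaf F \<and> (\<exists>\<pi>s. sheaf_iso F (direct_sum (map elem_sheaf \<pi>s)))"

definition indecomposable :: "('p::order, 'k::field) sheaf_data \<Rightarrow> bool" where
  "indecomposable F \<longleftrightarrow>
     sheaf F \<and> \<not> zero_sheaf F \<and>
     (\<forall>A B. sheaf A \<and> sheaf B \<and> sheaf_iso F (direct_sum [A, B]) \<longrightarrow> zero_sheaf A \<or> zero_sheaf B)"

text \<open>
  The description determines a number for every sheaf: indecomposable decompositions exist because
  stalks over a finite poset are finite-dimensional, and their length is unique by Krull-Schmidt.
\<close>

definition num_indecomposable_summands :: "('p::order, 'k::field) sheaf_data \<Rightarrow> nat" where
  "num_indecomposable_summands F =
     (THE m. \<exists>Fs. (\<forall>G\<in>set Fs. indecomposable G) \<and> sheaf_iso F (direct_sum Fs) \<and> length Fs = m)"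


section \<open>Complexes of sheaves\<close>

text \<open>Complexes are cohomological and indexed by all integers.\<close>

record ('p, 'k) complex_data =
  obj :: "int \<Rightarrow> ('p, 'k) sheaf_data"
  dif :: "int \<Rightarrow> 'p \<Rightarrow> 'k mat"

definition sheaf_complex :: "('p::order, 'k::field) complex_data \<Rightarrow> bool" where
  "sheaf_complex K \<longleftrightarrow>
     (\<forall>d. sheaf (obj K d)) \<and>
     (\<forall>d. natural (obj K d) (obj K (d + 1)) (dif K d)) \<and>
     (\<forall>d \<sigma>. dif K (d + 1) \<sigma> * dif K d \<sigma> =
        0\<^sub>m (stalk_dim (obj K (d + 2)) \<sigma>) (stalk_dim (obj K d) \<sigma>))"

definition bounded_complex :: "('p, 'k) complex_data \<Rightarrow> bool" where
  "bounded_complex K \<longleftrightarrow> (\<exists>a b. \<forall>d. d < a \<or> b < d \<longrightarrow> zero_sheaf (obj K d))"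

definition injective_complex :: "('p::order, 'k::field) complex_data \<Rightarrow> bool" where
  "injective_complex K \<longleftrightarrow>
     sheaf_complex K \<and> bounded_complex K \<and> (\<forall>d. injective_sheaf (obj K d))"

definition chain_map ::
  "('p::order, 'k::field) complex_data \<Rightarrow> ('p, 'k) complex_data \<Rightarrow> (int \<Rightarrow> 'p \<Rightarrow> 'k mat) \<Rightarrow> bool"
  where
  "chain_map K L f \<longleftrightarrow>
     (\<forall>d. natural (obj K d) (obj L d) (f d)) \<and>
     (\<forall>d \<sigma>. f (d + 1) \<sigma> * dif K d \<sigma> = dif L d \<sigma> * f d \<sigma>)"

definition complex_iso ::
  "('p::order, 'k::field) complex_data \<Rightarrow> ('p, 'k) complex_data \<Rightarrow> bool" where
  "complex_iso K L \<longleftrightarrow>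
     (\<exists>f g. chain_map K L f \<and> chain_map L K g \<and>
       (\<forall>d \<sigma>. g d \<sigma> * f d \<sigma> = 1\<^sub>m (stalk_dim (obj K d) \<sigma>) \<and>
               f d \<sigma> * g d \<sigma> = 1\<^sub>m (stalk_dim (obj L d) \<sigma>)))"

definition cocycles :: "('p, 'k::field) complex_data \<Rightarrow> int \<Rightarrow> 'p \<Rightarrow> 'k vec set" where
  "cocycles K d \<sigma> = mat_kernel (dif K d \<sigma>)"

definition coboundaries :: "('p, 'k::field) complex_data \<Rightarrow> int \<Rightarrow> 'p \<Rightarrow> 'k vec set" where
  "coboundaries K d \<sigma> =
     (\<lambda>w. dif K (d - 1) \<sigma> *\<^sub>v w) ` carrier_vec (stalk_dim (obj K (d - 1)) \<sigma>)"

definition cohomologous :: "('p, 'k::field) complex_data \<Rightarrow> int \<Rightarrow> 'p \<Rightarrow> 'k vec rel" where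
  "cohomologous K d \<sigma> =
     {(u, v). u \<in> cocycles K d \<sigma> \<and> v \<in> cocycles K d \<sigma> \<and> u - v \<in> coboundaries K d \<sigma>}"

definition cohomology :: "('p, 'k::field) complex_data \<Rightarrow> int \<Rightarrow> 'p \<Rightarrow> 'k vec set set" where
  "cohomology K d \<sigma> = cocycles K d \<sigma> // cohomologous K d \<sigma>"

text \<open>The map induced on cohomology sends the class of \<open>u\<close> to the class of \<open>f d \<sigma> *\<^sub>v u\<close>.\<close>

definition cohomology_map ::
  "('p, 'k::field) complex_data \<Rightarrow> (int \<Rightarrow> 'p \<Rightarrow> 'k mat) \<Rightarrow> int \<Rightarrow> 'p \<Rightarrow> 'k vec set \<Rightarrow> 'k vec set"
  where
  "cohomology_map L f d \<sigma> X = cohomologous L d \<sigma> `` ((\<lambda>u. f d \<sigma> *\<^sub>v u) ` X)"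

text \<open>
  A morphism of sheaves is an isomorphism iff each of its (linear) components is bijective, so
  isomorphism of the cohomology sheaves is tested stalk by stalk.
\<close>

definition quasi_iso ::
  "('p::order, 'k::field) complex_data \<Rightarrow> ('p, 'k) complex_data \<Rightarrow> (int \<Rightarrow> 'p \<Rightarrow> 'k mat) \<Rightarrow> bool"
  where
  "quasi_iso K L f \<longleftrightarrow>
     chain_map K L f \<and>
     (\<forall>d \<sigma>. bij_betw (cohomology_map L f d \<sigma>) (cohomology K d \<sigma>) (cohomology L d \<sigma>))"

text \<open>Connected by a finite zigzag of quasi-isomorphisms between complexes of sheaves.\<close>

definition quasi_isomorphic ::
  "('p::order, 'k::field) complex_data \<Rightarrow> ('p, 'k) complex_data \<Rightarrow> bool" where
  "quasi_isomorphic =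
     equivclp (\<lambda>K L. sheaf_complex K \<and> sheaf_complex L \<and> (\<exists>f. quasi_iso K L f))"

definition minimal_injective_complex :: "('p::order, 'k::field) complex_data \<Rightarrow> bool" where
  "minimal_injective_complex K \<longleftrightarrow>
     injective_complex K \<and>
     (\<forall>J. injective_complex J \<and> quasi_isomorphic J K \<longrightarrow>
        (\<forall>d. num_indecomposable_summands (obj K d) \<le> num_indecomposable_summands (obj J d)))"


section \<open>Labeled matrices\<close>

abbreviation St :: "'p::order \<Rightarrow> 'p set" where
  "St \<pi> \<equiv> {\<pi>..}"

definition labeled_matrix :: "'p::order list \<Rightarrow> 'p list \<Rightarrow> 'k::field mat \<Rightarrow> bool" where
  "labeled_matrix rs cs M \<longleftrightarrow>
     M \<in> carrier_mat (length rs) (length cs) \<and>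
     (\<forall>i<length rs. \<forall>j<length cs. M $$ (i, j) \<noteq> 0 \<longrightarrow> rs ! i \<le> cs ! j)"

definition labeled_submatrix ::
  "'p list \<Rightarrow> 'p list \<Rightarrow> 'k mat \<Rightarrow> 'p set \<Rightarrow> 'p set \<Rightarrow> 'k mat" where
  "labeled_submatrix rs cs M S P =
     submatrix M {i. i < length rs \<and> rs ! i \<in> S} {j. j < length cs \<and> cs ! j \<in> P}"

text \<open>
  \<open>labels C d\<close> labels the columns of \<open>mats C d\<close> and the rows of \<open>mats C (d - 1)\<close>.
\<close>

record ('p, 'k) labeled_data =
  labels :: "int \<Rightarrow> 'p list"
  mats :: "int \<Rightarrow> 'k mat"

text \<open>
  The complex consists of the matrices in degrees \<open>0, \<dots>, n\<close>. The rows of the last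
  one are the labels in degree \<open>n + 1\<close>; in all other degrees the matrices are empty.
\<close>

definition labeled_complex :: "nat \<Rightarrow> ('p::order, 'k::field) labeled_data \<Rightarrow> bool" where
  "labeled_complex n C \<longleftrightarrow>
     (\<forall>d. d < 0 \<or> int n + 1 < d \<longrightarrow> labels C d = []) \<and>
     (\<forall>d. labeled_matrix (labels C (d + 1)) (labels C d) (mats C d)) \<and>
     (\<forall>d. mats C (d + 1) * mats C d = 0\<^sub>m (length (labels C (d + 2))) (length (labels C d)))"

text \<open>
  The complex of sheaves given by a complex of labeled matrices. The stalk of
  \<open>direct_sum (map elem_sheaf \<pi>s)\<close> at \<open>\<tau>\<close> has one coordinate for each label in
  \<open>St \<tau>\<close>, in the order of the list, which is also the indexing of the submatrix.
\<close>

definition complex_of :: "('p::order, 'k::field) labeled_data \<Rightarrow> ('p, 'k) complex_data" where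
  "complex_of C =
     \<lparr> obj = \<lambda>d. direct_sum (map elem_sheaf (labels C d)),
       dif = \<lambda>d \<tau>. labeled_submatrix (labels C (d + 1)) (labels C d) (mats C d) (St \<tau>) (St \<tau>) \<rparr>"

definition represents :: "('p::order, 'k::field) labeled_data \<Rightarrow> ('p, 'k) complex_data \<Rightarrow> bool" where
  "represents C K \<longleftrightarrow> complex_iso (complex_of C) K"


section \<open>The peeling algorithm\<close>

definition diagonal_block :: "('p, 'k) labeled_data \<Rightarrow> int \<Rightarrow> 'p \<Rightarrow> 'k mat" where
  "diagonal_block C d \<pi> = labeled_submatrix (labels C (d + 1)) (labels C d) (mats C d) {\<pi>} {\<pi>}"

definition loop_guard :: "('p, 'k::field) labeled_data \<Rightarrow> int \<Rightarrow> 'p \<Rightarrow> bool" where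
  "loop_guard C d \<pi> \<longleftrightarrow>
     diagonal_block C d \<pi> \<noteq> 0\<^sub>m (dim_row (diagonal_block C d \<pi>)) (dim_col (diagonal_block C d \<pi>))"

definition change_of_basis :: "'p::order list \<Rightarrow> 'k::field mat \<Rightarrow> 'k mat \<Rightarrow> bool" where
  "change_of_basis ls A A_inv \<longleftrightarrow>
     labeled_matrix ls ls A \<and> A_inv \<in> carrier_mat (length ls) (length ls) \<and>
     inverts_mat A A_inv \<and> inverts_mat A_inv A"

definition normalized_at :: "'p list \<Rightarrow> 'p list \<Rightarrow> 'p \<Rightarrow> 'k::field mat \<Rightarrow> bool" where
  "normalized_at rs cs \<pi> M \<longleftrightarrow>
     diagonal_mat (labeled_submatrix rs cs M {\<pi>} {\<pi>}) \<and>
     elements_mat (labeled_submatrix rs cs M {\<pi>} {\<pi>}) \<subseteq> {0, 1} \<and>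
     (\<forall>j<length cs. cs ! j = \<pi> \<longrightarrow>
        (\<forall>i<length rs. rs ! i = \<pi> \<longrightarrow> M $$ (i, j) = 0) \<or>
        (\<forall>i<length rs. rs ! i \<noteq> \<pi> \<longrightarrow> M $$ (i, j) = 0)) \<and>
     (\<forall>i<length rs. rs ! i = \<pi> \<longrightarrow>
        (\<forall>j<length cs. cs ! j = \<pi> \<longrightarrow> M $$ (i, j) = 0) \<or>
        (\<forall>j<length cs. cs ! j \<noteq> \<pi> \<longrightarrow> M $$ (i, j) = 0))"

text \<open>Steps (i) and (ii): a normalizing change of basis, with any admissible choice of matrices.\<close>

definition basis_step ::
  "int \<Rightarrow> 'p::order \<Rightarrow> ('p, 'k::field) labeled_data \<Rightarrow> ('p, 'k) labeled_data \<Rightarrow> bool" where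
  "basis_step d \<pi> C D \<longleftrightarrow>
     (\<exists>L L_inv R R_inv.
        change_of_basis (labels C (d + 1)) L L_inv \<and>
        change_of_basis (labels C d) R R_inv \<and>
        normalized_at (labels C (d + 1)) (labels C d) \<pi> (L * mats C d * R) \<and>
        D = C\<lparr> mats := (mats C)
                (d := L * mats C d * R,
                 d - 1 := R_inv * mats C (d - 1),
                 d + 1 := mats C (d + 1) * L_inv) \<rparr>)"

text \<open>Step (iii), one deletion.\<close>

definition delete_step ::
  "int \<Rightarrow> 'p::order \<Rightarrow> ('p, 'k::field) labeled_data \<Rightarrow> ('p, 'k) labeled_data \<Rightarrow> bool" where
  "delete_step d \<pi> C D \<longleftrightarrow>
     (\<exists>i<length (labels C (d + 1)). \<exists>j<length (labels C d).
        labels C (d + 1) ! i = \<pi> \<and> labels C d ! j = \<pi> \<and> mats C d $$ (i, j) = 1 \<and>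
        D = \<lparr> labels = (labels C)
                (d + 1 := nths (labels C (d + 1)) (- {i}),
                 d := nths (labels C d) (- {j})),
              mats = (mats C)
                (d := submatrix (mats C d) (- {i}) (- {j}),
                 d - 1 := submatrix (mats C (d - 1)) (- {j}) UNIV,
                 d + 1 := submatrix (mats C (d + 1)) UNIV (- {i})) \<rparr>)"

text \<open>
  The algorithm as a nondeterministic small-step transition system: \<open>Outer\<close> is the head of the
  outer loop, \<open>Inner d \<pi>\<close> the head of the inner loop for the chosen \<open>d\<close> and \<open>\<pi>\<close>.
\<close>

datatype ('p, 'k) peel_state =
    Outer "('p, 'k) labeled_data"
  | Inner int 'p "('p, 'k) labeled_data"

inductive peel_step ::
  "('p::order, 'k::field) peel_state \<Rightarrow> ('p, 'k) peel_state \<Rightarrow> bool" where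
  enter: "loop_guard C d \<pi> \<Longrightarrow> basis_step d \<pi> C D \<Longrightarrow> peel_step (Outer C) (Inner d \<pi> D)"
| delete: "delete_step d \<pi> C D \<Longrightarrow> peel_step (Inner d \<pi> C) (Inner d \<pi> D)"
| leave: "(\<nexists>D. delete_step d \<pi> C D) \<Longrightarrow> peel_step (Inner d \<pi> C) (Outer C)"

text \<open>
  A run returns \<open>D\<close> when it is at the head of the outer loop and the loop condition fails.
  Being unable to move for any other reason (no change of basis as required in step (i)) is not a
  return.
\<close>

definition peel_returns :: "('p::order, 'k::field) peel_state \<Rightarrow> ('p, 'k) labeled_data \<Rightarrow> bool" where
  "peel_returns s D \<longleftrightarrow> s = Outer D \<and> (\<nexists>d \<pi>. loop_guard D d \<pi>)"

end

theory Submission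
  imports Defs "HOL-Library.Function_Algebras"
begin

text \<open>
  A deletion splits off a contractible complex \<open>[\<pi>] \<rightarrow> [\<pi>]\<close>, so every step preserves the
  quasi-isomorphism type, and the number of labels decreases. Step (i) can be carried out because a
  nonzero entry with both labels \<open>\<pi>\<close> can serve as a pivot whose row and column are cleared
  by labeled operations.

  Let \<open>K\<close> be the output and \<open>J\<close> an injective complex connected to \<open>K\<close> by a zigzag.
  Maps into bounded below injective complexes extend along quasi-isomorphisms up to homotopy, because
  chain maps from the acyclic mapping cone are null-homotopic. Hence the zigzag can be replaced by one
  quasi-isomorphism \<open>h: K \<rightarrow> J\<close>, and there is \<open>g: J \<rightarrow> K\<close> with \<open>g h\<close> homotopic to
  the identity. On maps out of the skyscraper at \<open>\<pi>\<close>, which see exactly the summands \<open>[\<pi>]\<close>,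
  the differential of \<open>K\<close> is the diagonal block at \<open>\<pi>\<close>, which is zero. So there \<open>g h\<close> is
  equal to the identity, and \<open>J\<close> has in each degree at least as many summands \<open>[\<pi>]\<close> as \<open>K\<close>.
\<close>

section \<open>Linear maps of function spaces\<close>

text \<open>Stalks are subspaces of \<open>'i \<Rightarrow> 'k\<close> and morphisms are total
  linear functions, because kernels, cones and extensions of maps then need no bookkeeping of
  dimensions; the cone simply has a sum type as index type. Injective sheaves get one coordinate per
  position of the label list, the same at every stalk: restriction sets coordinates to zero, and one
  matrix serves all stalks. The matrix model renumbers the coordinates at each stalk, so the two
  have to be related by explicit isomorphisms.

  The complexes inside a zigzag are in general neither injective nor bounded, so its arrows cannot
  be inverted one by one. What is carried along is a quasi-isomorphism into one fixed injective
  model of \<open>J\<close>.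

  \<open>num_indecomposable_summands\<close> is a definite description and can be evaluated only
  through a Krull-Schmidt statement: an indecomposable retract of a sum of sheaves
  \<open>[\<pi>]\<close> is itself of this form, and the multiplicity of \<open>[\<pi>]\<close> is
  the dimension of the space of maps from the skyscraper at \<pi>.\<close>

definition fun_scale :: "'k::field \<Rightarrow> ('i \<Rightarrow> 'k) \<Rightarrow> 'i \<Rightarrow> 'k" where
  "fun_scale c v = (\<lambda>i. c * v i)"

lemma fun_scale_apply [simp]: "fun_scale c v i = c * v i"
  by (simp add: fun_scale_def)

interpretation fun_space: vector_space fun_scale
  by unfold_locales (simp_all add: fun_eq_iff algebra_simps)

interpretation fun_space_pair: vector_space_pair
  "fun_scale :: 'k::field \<Rightarrow> ('i \<Rightarrow> 'k) \<Rightarrow> 'i \<Rightarrow> 'k"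
  "fun_scale :: 'k \<Rightarrow> ('j \<Rightarrow> 'k) \<Rightarrow> 'j \<Rightarrow> 'k"
  by unfold_locales

definition lin_map :: "(('i \<Rightarrow> 'k::field) \<Rightarrow> ('j \<Rightarrow> 'k)) \<Rightarrow> bool" where
  "lin_map f \<longleftrightarrow> Vector_Spaces.linear fun_scale fun_scale f"

lemma lin_map_iff:
  "lin_map f \<longleftrightarrow> (\<forall>x y. f (x + y) = f x + f y) \<and> (\<forall>c x. f (fun_scale c x) = fun_scale c (f x))"
  unfolding lin_map_def Vector_Spaces.linear_iff by (auto intro: fun_space.vector_space_axioms)

lemma lin_mapI:
  assumes "\<And>x y. f (x + y) = f x + f y" "\<And>c x. f (fun_scale c x) = fun_scale c (f x)"
  shows "lin_map f"
  using assms by (simp add: lin_map_iff)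

lemma lin_map_add: "lin_map f \<Longrightarrow> f (x + y) = f x + f y"
  and lin_map_scale: "lin_map f \<Longrightarrow> f (fun_scale c x) = fun_scale c (f x)"
  by (simp_all add: lin_map_iff)

lemma lin_map_zero: "lin_map f \<Longrightarrow> f 0 = 0"
  using lin_map_add[of f 0 0] by simp

lemma lin_map_diff: "lin_map f \<Longrightarrow> f (x - y) = f x - f y"
  using lin_map_add[of f "x - y" y] by simp

lemma lin_map_neg: "lin_map f \<Longrightarrow> f (- x) = - f x"
  using lin_map_diff[of f 0 x] lin_map_zero[of f] by simp

lemmas lin_map_simps = lin_map_add lin_map_diff lin_map_scale lin_map_zero lin_map_neg

lemma lin_map_compose: "lin_map f \<Longrightarrow> lin_map g \<Longrightarrow> lin_map (\<lambda>x. f (g x))"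
  by (simp only: lin_map_iff) simp

lemma lin_map_plus:
  assumes "lin_map f" "lin_map g"
  shows "lin_map (\<lambda>x. f x + g x)"
  by (rule lin_mapI)
     (simp_all add: lin_map_simps[OF assms(1)] lin_map_simps[OF assms(2)] fun_space.scale_right_distrib)

lemma lin_map_minus:
  assumes "lin_map f" "lin_map g"
  shows "lin_map (\<lambda>x. f x - g x)"
  by (rule lin_mapI)
     (simp_all add: lin_map_simps[OF assms(1)] lin_map_simps[OF assms(2)] fun_space.scale_right_diff_distrib)

lemma lin_map_0 [simp]: "lin_map (\<lambda>x. 0)"
  by (rule lin_mapI) simp_all

lemma lin_map_ident [simp]: "lin_map (\<lambda>x. x)"
  by (rule lin_mapI) simp_all

text \<open>Injectivity of vector spaces in the form used stalk by stalk. \<open>\<phi>\<close> is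
  composed with a linear section \<open>g\<close> of \<open>u\<close> over the image of
  \<open>A\<close>; two preimages in \<open>A\<close> of one vector differ by an element of the
  kernel of \<open>u\<close>, which \<open>\<phi>\<close> kills.\<close>

lemma lin_map_factor:
  fixes u :: "('i \<Rightarrow> 'k::field) \<Rightarrow> ('j \<Rightarrow> 'k)" and \<phi> :: "('i \<Rightarrow> 'k) \<Rightarrow> ('l \<Rightarrow> 'k)"
  assumes "lin_map u" "lin_map \<phi>" "fun_space.subspace A"
    and ker: "\<And>v. v \<in> A \<Longrightarrow> u v = 0 \<Longrightarrow> \<phi> v = 0"
  obtains \<psi> where "lin_map \<psi>" "\<And>v. v \<in> A \<Longrightarrow> \<psi> (u v) = \<phi> v" "\<And>w. \<psi> w \<in> \<phi> ` A"
proof -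
  obtain g where g: "range g \<subseteq> A" "lin_map g" "\<forall>v\<in>u ` A. u (g v) = v"
    using fun_space_pair.linear_exists_right_inverse_on[OF assms(1)[unfolded lin_map_def] assms(3)]
    unfolding lin_map_def by blast
  show thesis
  proof
    show "lin_map (\<lambda>w. \<phi> (g w))"
      using assms(2) g(2) by (rule lin_map_compose)
    fix v assume v: "v \<in> A"
    then have "g (u v) - v \<in> A"
      using g(1) assms(3) by (intro fun_space.subspace_diff) auto
    moreover have "u (g (u v) - v) = 0"
      using g(3) v by (simp add: lin_map_simps[OF assms(1)])
    ultimately have "\<phi> (g (u v) - v) = 0"
      by (rule ker)
    then show "\<phi> (g (u v)) = \<phi> v"
      by (simp add: lin_map_simps[OF assms(2)])
  next
    show "\<phi> (g w) \<in> \<phi> ` A" for w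
      using g(1) by auto
  qed
qed

section \<open>Sheaves and complexes with stalks in function spaces\<close>

text \<open>The maps are total functions that are linear on the whole space; only their values on the
  stalks matter.\<close>

record ('p, 'v) vsheaf =
  stalk :: "'p \<Rightarrow> 'v set"
  rho :: "'p \<Rightarrow> 'p \<Rightarrow> 'v \<Rightarrow> 'v"

definition is_vsheaf :: "('p::order, 'i \<Rightarrow> 'k::field) vsheaf \<Rightarrow> bool" where
  "is_vsheaf F \<longleftrightarrow>
     (\<forall>\<sigma>. fun_space.subspace (stalk F \<sigma>)) \<and>
     (\<forall>\<sigma> \<tau>. lin_map (rho F \<sigma> \<tau>)) \<and>
     (\<forall>\<sigma> \<tau> v. \<sigma> \<le> \<tau> \<longrightarrow> v \<in> stalk F \<sigma> \<longrightarrow> rho F \<sigma> \<tau> v \<in> stalk F \<tau>) \<and>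
     (\<forall>\<sigma> v. v \<in> stalk F \<sigma> \<longrightarrow> rho F \<sigma> \<sigma> v = v) \<and>
     (\<forall>\<pi> \<sigma> \<tau> v. \<pi> \<le> \<sigma> \<longrightarrow> \<sigma> \<le> \<tau> \<longrightarrow> v \<in> stalk F \<pi> \<longrightarrow> rho F \<sigma> \<tau> (rho F \<pi> \<sigma> v) = rho F \<pi> \<tau> v)"

definition v_natural ::
  "('p::order, 'i \<Rightarrow> 'k::field) vsheaf \<Rightarrow> ('p, 'j \<Rightarrow> 'k) vsheaf \<Rightarrow> ('p \<Rightarrow> ('i \<Rightarrow> 'k) \<Rightarrow> 'j \<Rightarrow> 'k) \<Rightarrow> bool"
  where
  "v_natural F G f \<longleftrightarrow>
     (\<forall>\<sigma>. lin_map (f \<sigma>)) \<and>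
     (\<forall>\<sigma> v. v \<in> stalk F \<sigma> \<longrightarrow> f \<sigma> v \<in> stalk G \<sigma>) \<and>
     (\<forall>\<sigma> \<tau> v. \<sigma> \<le> \<tau> \<longrightarrow> v \<in> stalk F \<sigma> \<longrightarrow> f \<tau> (rho F \<sigma> \<tau> v) = rho G \<sigma> \<tau> (f \<sigma> v))"

record ('p, 'v) vcomplex =
  vobj :: "int \<Rightarrow> ('p, 'v) vsheaf"
  vdif :: "int \<Rightarrow> 'p \<Rightarrow> 'v \<Rightarrow> 'v"

abbreviation cstalk :: "('p, 'v) vcomplex \<Rightarrow> int \<Rightarrow> 'p \<Rightarrow> 'v set" where
  "cstalk K d \<equiv> stalk (vobj K d)"

definition is_vcomplex :: "('p::order, 'i \<Rightarrow> 'k::field) vcomplex \<Rightarrow> bool" where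
  "is_vcomplex K \<longleftrightarrow>
     (\<forall>d. is_vsheaf (vobj K d)) \<and>
     (\<forall>d. v_natural (vobj K d) (vobj K (d + 1)) (vdif K d)) \<and>
     (\<forall>d \<sigma> v. v \<in> cstalk K d \<sigma> \<longrightarrow> vdif K (d + 1) \<sigma> (vdif K d \<sigma> v) = 0)"

definition v_chain ::
  "('p::order, 'i \<Rightarrow> 'k::field) vcomplex \<Rightarrow> ('p, 'j \<Rightarrow> 'k) vcomplex \<Rightarrow>
   (int \<Rightarrow> 'p \<Rightarrow> ('i \<Rightarrow> 'k) \<Rightarrow> 'j \<Rightarrow> 'k) \<Rightarrow> bool" where
  "v_chain K L f \<longleftrightarrow>
     (\<forall>d. v_natural (vobj K d) (vobj L d) (f d)) \<and>
     (\<forall>d \<sigma> v. v \<in> cstalk K d \<sigma> \<longrightarrow> f (d + 1) \<sigma> (vdif K d \<sigma> v) = vdif L d \<sigma> (f d \<sigma> v))"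

text \<open>The two clauses after \<open>v_chain\<close> are injectivity and surjectivity on
  cohomology, phrased on representatives so that no quotient has to be formed.\<close>

definition v_quasi_iso ::
  "('p::order, 'i \<Rightarrow> 'k::field) vcomplex \<Rightarrow> ('p, 'j \<Rightarrow> 'k) vcomplex \<Rightarrow>
   (int \<Rightarrow> 'p \<Rightarrow> ('i \<Rightarrow> 'k) \<Rightarrow> 'j \<Rightarrow> 'k) \<Rightarrow> bool" where
  "v_quasi_iso K L f \<longleftrightarrow> v_chain K L f \<and>
     (\<forall>d \<sigma> u w. u \<in> cstalk K d \<sigma> \<longrightarrow> vdif K d \<sigma> u = 0 \<longrightarrow> w \<in> cstalk L (d - 1) \<sigma> \<longrightarrow>
        f d \<sigma> u = vdif L (d - 1) \<sigma> w \<longrightarrow> (\<exists>x\<in>cstalk K (d - 1) \<sigma>. u = vdif K (d - 1) \<sigma> x)) \<and>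
     (\<forall>d \<sigma> z. z \<in> cstalk L d \<sigma> \<longrightarrow> vdif L d \<sigma> z = 0 \<longrightarrow>
        (\<exists>u\<in>cstalk K d \<sigma>. \<exists>w\<in>cstalk L (d - 1) \<sigma>.
           vdif K d \<sigma> u = 0 \<and> z = f d \<sigma> u + vdif L (d - 1) \<sigma> w))"

lemma is_vsheafD:
  assumes "is_vsheaf F"
  shows "fun_space.subspace (stalk F \<sigma>)" "lin_map (rho F \<sigma> \<tau>)"
    "\<sigma> \<le> \<tau> \<Longrightarrow> v \<in> stalk F \<sigma> \<Longrightarrow> rho F \<sigma> \<tau> v \<in> stalk F \<tau>"
    "v \<in> stalk F \<sigma> \<Longrightarrow> rho F \<sigma> \<sigma> v = v"
    "\<pi> \<le> \<sigma> \<Longrightarrow> \<sigma> \<le> \<tau> \<Longrightarrow> v \<in> stalk F \<pi> \<Longrightarrow> rho F \<sigma> \<tau> (rho F \<pi> \<sigma> v) = rho F \<pi> \<tau> v"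
  using assms unfolding is_vsheaf_def by auto

lemma v_naturalD:
  assumes "v_natural F G f"
  shows "lin_map (f \<sigma>)" "v \<in> stalk F \<sigma> \<Longrightarrow> f \<sigma> v \<in> stalk G \<sigma>"
    "\<sigma> \<le> \<tau> \<Longrightarrow> v \<in> stalk F \<sigma> \<Longrightarrow> f \<tau> (rho F \<sigma> \<tau> v) = rho G \<sigma> \<tau> (f \<sigma> v)"
  using assms unfolding v_natural_def by auto

lemma v_natural_compose:
  "v_natural F G f \<Longrightarrow> v_natural G H g \<Longrightarrow> v_natural F H (\<lambda>\<sigma> v. g \<sigma> (f \<sigma> v))"
  unfolding v_natural_def by (auto intro: lin_map_compose)

lemma v_natural_id: "v_natural F F (\<lambda>\<sigma> v. v)"
  unfolding v_natural_def by auto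

lemma v_natural_0:
  assumes "is_vsheaf G"
  shows "v_natural F G (\<lambda>\<sigma> v. 0)"
  unfolding v_natural_def
  using is_vsheafD(1,2)[OF assms] by (auto simp: fun_space.subspace_0 lin_map_zero[OF is_vsheafD(2)[OF assms]])

lemma v_natural_minus:
  assumes "v_natural F G f" "v_natural F G g" "is_vsheaf G"
  shows "v_natural F G (\<lambda>\<sigma> v. f \<sigma> v - g \<sigma> v)"
  unfolding v_natural_def
  using v_naturalD[OF assms(1)] v_naturalD[OF assms(2)] is_vsheafD(1,2)[OF assms(3)]
  by (auto simp: lin_map_diff[OF v_naturalD(1)[OF assms(1)]] lin_map_diff[OF v_naturalD(1)[OF assms(2)]]
      lin_map_diff[OF is_vsheafD(2)[OF assms(3)]] intro: lin_map_minus fun_space.subspace_diff)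

lemma v_natural_plus:
  assumes "v_natural F G f" "v_natural F G g" "is_vsheaf G"
  shows "v_natural F G (\<lambda>\<sigma> v. f \<sigma> v + g \<sigma> v)"
  unfolding v_natural_def
  using v_naturalD[OF assms(1)] v_naturalD[OF assms(2)] is_vsheafD(1,2)[OF assms(3)]
  by (auto simp: lin_map_add[OF v_naturalD(1)[OF assms(1)]] lin_map_add[OF v_naturalD(1)[OF assms(2)]]
      lin_map_add[OF is_vsheafD(2)[OF assms(3)]] intro: lin_map_plus fun_space.subspace_add)

text \<open>The facts about degree \<open>d - 1\<close> are listed separately because plain
  instantiation would produce \<open>d - 1 + 1\<close> in place of \<open>d\<close>.\<close>

lemma is_vcomplexD:
  assumes "is_vcomplex K"
  shows "is_vsheaf (vobj K d)" "v_natural (vobj K d) (vobj K (d + 1)) (vdif K d)"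
    "v_natural (vobj K (d - 1)) (vobj K d) (vdif K (d - 1))"
    "v \<in> cstalk K d \<sigma> \<Longrightarrow> vdif K (d + 1) \<sigma> (vdif K d \<sigma> v) = 0"
    "v \<in> cstalk K (d - 1) \<sigma> \<Longrightarrow> vdif K d \<sigma> (vdif K (d - 1) \<sigma> v) = 0"
    "lin_map (vdif K d \<sigma>)" "fun_space.subspace (cstalk K d \<sigma>)"
    "v \<in> cstalk K d \<sigma> \<Longrightarrow> vdif K d \<sigma> v \<in> cstalk K (d + 1) \<sigma>"
    "v \<in> cstalk K (d - 1) \<sigma> \<Longrightarrow> vdif K (d - 1) \<sigma> v \<in> cstalk K d \<sigma>"
proof -
  show *: "is_vsheaf (vobj K d)" and n: "v_natural (vobj K d) (vobj K (d + 1)) (vdif K d)"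
    using assms unfolding is_vcomplex_def by blast+
  show "lin_map (vdif K d \<sigma>)" "fun_space.subspace (cstalk K d \<sigma>)"
    "v \<in> cstalk K d \<sigma> \<Longrightarrow> vdif K d \<sigma> v \<in> cstalk K (d + 1) \<sigma>"
    using v_naturalD[OF n] is_vsheafD[OF *] by auto
  have "v_natural (vobj K (d - 1)) (vobj K (d - 1 + 1)) (vdif K (d - 1))"
    using assms unfolding is_vcomplex_def by blast
  then show m: "v_natural (vobj K (d - 1)) (vobj K d) (vdif K (d - 1))"
    by simp
  show "v \<in> cstalk K d \<sigma> \<Longrightarrow> vdif K (d + 1) \<sigma> (vdif K d \<sigma> v) = 0"
    using assms unfolding is_vcomplex_def by blast
  have "v \<in> cstalk K (d - 1) \<sigma> \<Longrightarrow> vdif K (d - 1 + 1) \<sigma> (vdif K (d - 1) \<sigma> v) = 0"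
    using assms unfolding is_vcomplex_def by blast
  then show "v \<in> cstalk K (d - 1) \<sigma> \<Longrightarrow> vdif K d \<sigma> (vdif K (d - 1) \<sigma> v) = 0"
    by simp
  show "v \<in> cstalk K (d - 1) \<sigma> \<Longrightarrow> vdif K (d - 1) \<sigma> v \<in> cstalk K d \<sigma>"
    using v_naturalD(2)[OF m] .
qed

lemma v_chainD:
  assumes "v_chain K L f"
  shows "v_natural (vobj K d) (vobj L d) (f d)"
    "v \<in> cstalk K d \<sigma> \<Longrightarrow> f (d + 1) \<sigma> (vdif K d \<sigma> v) = vdif L d \<sigma> (f d \<sigma> v)"
    "v \<in> cstalk K (d - 1) \<sigma> \<Longrightarrow> f d \<sigma> (vdif K (d - 1) \<sigma> v) = vdif L (d - 1) \<sigma> (f (d - 1) \<sigma> v)"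
    "lin_map (f d \<sigma>)" "v \<in> cstalk K d \<sigma> \<Longrightarrow> f d \<sigma> v \<in> cstalk L d \<sigma>"
proof -
  show n: "v_natural (vobj K d) (vobj L d) (f d)"
    using assms unfolding v_chain_def by blast
  show "lin_map (f d \<sigma>)" "v \<in> cstalk K d \<sigma> \<Longrightarrow> f d \<sigma> v \<in> cstalk L d \<sigma>"
    using v_naturalD[OF n] by auto
  show "v \<in> cstalk K d \<sigma> \<Longrightarrow> f (d + 1) \<sigma> (vdif K d \<sigma> v) = vdif L d \<sigma> (f d \<sigma> v)"
    using assms unfolding v_chain_def by blast
  have "v \<in> cstalk K (d - 1) \<sigma> \<Longrightarrow>
      f (d - 1 + 1) \<sigma> (vdif K (d - 1) \<sigma> v) = vdif L (d - 1) \<sigma> (f (d - 1) \<sigma> v)"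
    using assms unfolding v_chain_def by blast
  then show "v \<in> cstalk K (d - 1) \<sigma> \<Longrightarrow>
      f d \<sigma> (vdif K (d - 1) \<sigma> v) = vdif L (d - 1) \<sigma> (f (d - 1) \<sigma> v)"
    by simp
qed

lemma v_quasi_isoD:
  assumes "v_quasi_iso K L f"
  shows "v_chain K L f"
    "u \<in> cstalk K d \<sigma> \<Longrightarrow> vdif K d \<sigma> u = 0 \<Longrightarrow> w \<in> cstalk L (d - 1) \<sigma> \<Longrightarrow>
       f d \<sigma> u = vdif L (d - 1) \<sigma> w \<Longrightarrow> \<exists>x\<in>cstalk K (d - 1) \<sigma>. u = vdif K (d - 1) \<sigma> x"
    "z \<in> cstalk L d \<sigma> \<Longrightarrow> vdif L d \<sigma> z = 0 \<Longrightarrow>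
       \<exists>u\<in>cstalk K d \<sigma>. \<exists>w\<in>cstalk L (d - 1) \<sigma>. vdif K d \<sigma> u = 0 \<and> z = f d \<sigma> u + vdif L (d - 1) \<sigma> w"
  using assms unfolding v_quasi_iso_def by blast+

lemma v_chain_compose:
  assumes "v_chain K L f" "v_chain L M g"
  shows "v_chain K M (\<lambda>d \<sigma> v. g d \<sigma> (f d \<sigma> v))"
  unfolding v_chain_def
  using v_chainD(2,5)[OF assms(1)] v_chainD(2)[OF assms(2)]
    v_natural_compose[OF v_chainD(1)[OF assms(1)] v_chainD(1)[OF assms(2)]]
  by simp

lemma v_chain_id: "v_chain K K (\<lambda>d \<sigma> v. v)"
  unfolding v_chain_def by (auto intro: v_natural_id)

lemma v_quasi_iso_compose:
  assumes K: "is_vcomplex K" and L: "is_vcomplex L" and M: "is_vcomplex M"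
    and f: "v_quasi_iso K L f" and g: "v_quasi_iso L M g"
  shows "v_quasi_iso K M (\<lambda>d \<sigma> v. g d \<sigma> (f d \<sigma> v))"
  unfolding v_quasi_iso_def
proof (intro conjI allI impI)
  note fc = v_chainD[OF v_quasi_isoD(1)[OF f]] and gc = v_chainD[OF v_quasi_isoD(1)[OF g]]
  show "v_chain K M (\<lambda>d \<sigma> v. g d \<sigma> (f d \<sigma> v))"
    using v_quasi_isoD(1)[OF f] v_quasi_isoD(1)[OF g] by (rule v_chain_compose)
  fix d \<sigma>
  show "\<exists>x\<in>cstalk K (d - 1) \<sigma>. u = vdif K (d - 1) \<sigma> x"
    if u: "u \<in> cstalk K d \<sigma>" "vdif K d \<sigma> u = 0" "w \<in> cstalk M (d - 1) \<sigma>"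
      "g d \<sigma> (f d \<sigma> u) = vdif M (d - 1) \<sigma> w" for u w
  proof -
    have fu: "f d \<sigma> u \<in> cstalk L d \<sigma>" "vdif L d \<sigma> (f d \<sigma> u) = 0"
      using fc(5)[OF u(1)] fc(2)[OF u(1)] u(2) by (auto simp: lin_map_zero[OF fc(4)])
    from v_quasi_isoD(2)[OF g, OF fu u(3,4)]
    obtain x where "x \<in> cstalk L (d - 1) \<sigma>" "f d \<sigma> u = vdif L (d - 1) \<sigma> x" by blast
    then show ?thesis using v_quasi_isoD(2)[OF f, OF u(1,2)] by blast
  qed
  show "\<exists>u\<in>cstalk K d \<sigma>. \<exists>w\<in>cstalk M (d - 1) \<sigma>.
      vdif K d \<sigma> u = 0 \<and> z = g d \<sigma> (f d \<sigma> u) + vdif M (d - 1) \<sigma> w"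
    if z: "z \<in> cstalk M d \<sigma>" "vdif M d \<sigma> z = 0" for z
  proof -
    from v_quasi_isoD(3)[OF g, OF z] obtain y w where y: "y \<in> cstalk L d \<sigma>" "vdif L d \<sigma> y = 0"
      and w: "w \<in> cstalk M (d - 1) \<sigma>" and z': "z = g d \<sigma> y + vdif M (d - 1) \<sigma> w" by blast
    from v_quasi_isoD(3)[OF f, OF y] obtain u x where u: "u \<in> cstalk K d \<sigma>" "vdif K d \<sigma> u = 0"
      and x: "x \<in> cstalk L (d - 1) \<sigma>" and y': "y = f d \<sigma> u + vdif L (d - 1) \<sigma> x" by blast
    have "z = g d \<sigma> (f d \<sigma> u) + vdif M (d - 1) \<sigma> (g (d - 1) \<sigma> x + w)"
      using gc(3)[OF x] by (simp add: z' y' lin_map_add[OF gc(4)] lin_map_add[OF is_vcomplexD(6)[OF M]] add.assoc)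
    moreover have "g (d - 1) \<sigma> x + w \<in> cstalk M (d - 1) \<sigma>"
      using gc(5)[OF x] w is_vcomplexD(7)[OF M] by (intro fun_space.subspace_add)
    ultimately show ?thesis using u by blast
  qed
qed

text \<open>The hypotheses say that \<open>f\<close> is onto with acyclic kernel, so the long exact
  sequence makes it an isomorphism on cohomology. The sequence is unrolled by hand: a lift is
  corrected by an element of the kernel complex.\<close>

lemma v_quasi_iso_surjI:
  assumes K: "is_vcomplex K" and L: "is_vcomplex L" and f: "v_chain K L f"
    and surj: "\<And>d \<sigma> z. z \<in> cstalk L d \<sigma> \<Longrightarrow> \<exists>u\<in>cstalk K d \<sigma>. f d \<sigma> u = z"
    and acyc: "\<And>d \<sigma> u. u \<in> cstalk K d \<sigma> \<Longrightarrow> f d \<sigma> u = 0 \<Longrightarrow> vdif K d \<sigma> u = 0 \<Longrightarrow>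
       \<exists>x\<in>cstalk K (d - 1) \<sigma>. f (d - 1) \<sigma> x = 0 \<and> vdif K (d - 1) \<sigma> x = u"
  shows "v_quasi_iso K L f"
  unfolding v_quasi_iso_def
proof (intro conjI allI impI)
  note fc = v_chainD[OF f]
  show "v_chain K L f" by fact
  fix d \<sigma>
  show "\<exists>x\<in>cstalk K (d - 1) \<sigma>. u = vdif K (d - 1) \<sigma> x"
    if u: "u \<in> cstalk K d \<sigma>" "vdif K d \<sigma> u = 0" "w \<in> cstalk L (d - 1) \<sigma>"
      "f d \<sigma> u = vdif L (d - 1) \<sigma> w" for u w
  proof -
    obtain y where y: "y \<in> cstalk K (d - 1) \<sigma>" "f (d - 1) \<sigma> y = w" using surj[OF u(3)] by blast
    \<comment> \<open>Subtracting the boundary of a lift of \<open>w\<close> moves \<open>u\<close>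
      into the kernel complex without changing its class.\<close>
    let ?u = "u - vdif K (d - 1) \<sigma> y"
    have "?u \<in> cstalk K d \<sigma>"
      using u(1) y(1) is_vcomplexD(7,9)[OF K] by (intro fun_space.subspace_diff) auto
    moreover have "f d \<sigma> ?u = 0"
      using fc(3)[OF y(1)] u(4) y(2) by (simp add: lin_map_diff[OF fc(4)])
    moreover have "vdif K d \<sigma> ?u = 0"
      using u(2) is_vcomplexD(5)[OF K y(1)] by (simp add: lin_map_diff[OF is_vcomplexD(6)[OF K]])
    ultimately obtain x where x: "x \<in> cstalk K (d - 1) \<sigma>" "vdif K (d - 1) \<sigma> x = ?u"
      using acyc by blast
    then have "u = vdif K (d - 1) \<sigma> (x + y)"
      by (simp add: lin_map_add[OF is_vcomplexD(6)[OF K]])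
    moreover have "x + y \<in> cstalk K (d - 1) \<sigma>"
      using x y is_vcomplexD(7)[OF K] by (intro fun_space.subspace_add) auto
    ultimately show ?thesis by blast
  qed
  show "\<exists>u\<in>cstalk K d \<sigma>. \<exists>w\<in>cstalk L (d - 1) \<sigma>. vdif K d \<sigma> u = 0 \<and> z = f d \<sigma> u + vdif L (d - 1) \<sigma> w"
    if z: "z \<in> cstalk L d \<sigma>" "vdif L d \<sigma> z = 0" for z
  proof -
    obtain y where y: "y \<in> cstalk K d \<sigma>" "f d \<sigma> y = z" using surj[OF z(1)] by blast
    \<comment> \<open>A lift \<open>y\<close> of a cocycle need not be a cocycle, but its
      differential lies in the kernel complex, hence is the differential of some \<open>x\<close>
      there; then \<open>y - x\<close> is a lift that is a cocycle.\<close>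
    have "vdif K d \<sigma> y \<in> cstalk K (d + 1) \<sigma>" "f (d + 1) \<sigma> (vdif K d \<sigma> y) = 0"
      "vdif K (d + 1) \<sigma> (vdif K d \<sigma> y) = 0"
      using is_vcomplexD(4,8)[OF K y(1)] fc(2)[OF y(1)] y(2) z(2) by auto
    from acyc[OF this] obtain x where
      x: "x \<in> cstalk K d \<sigma>" "f d \<sigma> x = 0" "vdif K d \<sigma> x = vdif K d \<sigma> y" by auto
    have "y - x \<in> cstalk K d \<sigma>" "vdif K d \<sigma> (y - x) = 0" "z = f d \<sigma> (y - x) + vdif L (d - 1) \<sigma> 0"
      using x y is_vcomplexD(7)[OF K]
      by (auto simp: lin_map_simps[OF is_vcomplexD(6)[OF K]] lin_map_simps[OF is_vcomplexD(6)[OF L]]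
          lin_map_simps[OF fc(4)] intro: fun_space.subspace_diff)
    moreover have "0 \<in> cstalk L (d - 1) \<sigma>"
      using is_vcomplexD(7)[OF L] by (rule fun_space.subspace_0)
    ultimately show ?thesis by blast
  qed
qed

text \<open>A stalkwise bijection is onto and has zero kernel, which is trivially acyclic.\<close>

lemma v_quasi_iso_bijI:
  assumes K: "is_vcomplex K" and L: "is_vcomplex L" and f: "v_chain K L f"
    and g: "\<And>d \<sigma> z. z \<in> cstalk L d \<sigma> \<Longrightarrow> g d \<sigma> z \<in> cstalk K d \<sigma>"
    and fg: "\<And>d \<sigma> z. z \<in> cstalk L d \<sigma> \<Longrightarrow> f d \<sigma> (g d \<sigma> z) = z"
    and gf: "\<And>d \<sigma> z. z \<in> cstalk K d \<sigma> \<Longrightarrow> g d \<sigma> (f d \<sigma> z) = z"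
  shows "v_quasi_iso K L f"
proof (rule v_quasi_iso_surjI[OF K L f])
  fix d \<sigma>
  show "\<exists>u\<in>cstalk K d \<sigma>. f d \<sigma> u = z" if "z \<in> cstalk L d \<sigma>" for z
    using g fg that by blast
  fix u assume u: "u \<in> cstalk K d \<sigma>" "f d \<sigma> u = 0"
  have 0: "0 \<in> cstalk K e \<sigma>" for e
    using is_vcomplexD(7)[OF K] by (rule fun_space.subspace_0)
  have "u = g d \<sigma> (f d \<sigma> 0)"
    using gf[OF u(1)] u(2) by (simp add: lin_map_zero[OF v_chainD(4)[OF f]])
  then have "u = 0" using gf[OF 0] by simp
  then show "\<exists>x\<in>cstalk K (d - 1) \<sigma>. f (d - 1) \<sigma> x = 0 \<and> vdif K (d - 1) \<sigma> x = u"
    using 0 by (intro bexI[of _ 0])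
      (auto simp: lin_map_zero[OF v_chainD(4)[OF f]] lin_map_zero[OF is_vcomplexD(6)[OF K]])
qed

section \<open>Injective sheaves in coordinates\<close>

definition pos_support :: "'p::order list \<Rightarrow> 'p \<Rightarrow> nat set" where
  "pos_support ls \<sigma> = {i. i < length ls \<and> \<sigma> \<le> ls ! i}"

definition mask_fun :: "'i set \<Rightarrow> ('i \<Rightarrow> 'k::field) \<Rightarrow> 'i \<Rightarrow> 'k" where
  "mask_fun S c = (\<lambda>i. if i \<in> S then c i else 0)"

text \<open>The direct sum of the sheaves \<open>[\<pi>]\<close> for \<open>\<pi>\<close> in the list, with one coordinate per list
  position at every stalk.\<close>

definition pos_sheaf :: "'p::order list \<Rightarrow> ('p, nat \<Rightarrow> 'k::field) vsheaf" where
  "pos_sheaf ls =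
     \<lparr> stalk = \<lambda>\<sigma>. {c. \<forall>i. i \<notin> pos_support ls \<sigma> \<longrightarrow> c i = 0},
       rho = \<lambda>\<sigma> \<tau>. mask_fun (pos_support ls \<tau>) \<rparr>"

lemma mask_apply [simp]: "mask_fun S c i = (if i \<in> S then c i else 0)"
  by (simp add: mask_fun_def)

lemma lin_map_mask: "lin_map (mask_fun S)"
  by (rule lin_mapI) (auto simp: fun_eq_iff)

lemma stalk_pos_sheaf: "c \<in> stalk (pos_sheaf ls) \<sigma> \<longleftrightarrow> (\<forall>i. i \<notin> pos_support ls \<sigma> \<longrightarrow> c i = 0)"
  by (simp add: pos_sheaf_def)

lemma rho_pos_sheaf: "rho (pos_sheaf ls) \<sigma> \<tau> = mask_fun (pos_support ls \<tau>)"
  by (simp add: pos_sheaf_def)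

lemma pos_support_mono: "\<sigma> \<le> \<tau> \<Longrightarrow> i \<in> pos_support ls \<tau> \<Longrightarrow> i \<in> pos_support ls \<sigma>"
  by (auto simp: pos_support_def)

lemma mask_stalk: "mask_fun (pos_support ls \<sigma>) c \<in> stalk (pos_sheaf ls) \<sigma>"
  by (simp add: stalk_pos_sheaf)

lemma mask_ident: "c \<in> stalk (pos_sheaf ls) \<sigma> \<Longrightarrow> mask_fun (pos_support ls \<sigma>) c = c"
  by (auto simp: stalk_pos_sheaf fun_eq_iff)

lemma is_vsheaf_pos: "is_vsheaf (pos_sheaf ls)"
  unfolding is_vsheaf_def
proof (intro conjI allI impI)
  fix \<sigma>
  show "fun_space.subspace (stalk (pos_sheaf ls) \<sigma> :: (nat \<Rightarrow> 'b) set)"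
    by (rule fun_space.subspaceI) (auto simp: stalk_pos_sheaf)
next
  show "rho (pos_sheaf ls) \<sigma> \<tau> (rho (pos_sheaf ls) \<pi> \<sigma> v) = rho (pos_sheaf ls) \<pi> \<tau> v"
    if "\<sigma> \<le> \<tau>" for \<pi> \<sigma> \<tau> and v :: "nat \<Rightarrow> 'b"
    using pos_support_mono[OF that] by (auto simp: rho_pos_sheaf fun_eq_iff)
qed (auto simp: rho_pos_sheaf lin_map_mask mask_stalk mask_ident)

text \<open>A map into \<open>[p]\<close> amounts to a linear functional on the stalk at
  \<open>p\<close>, so the extension problem splits into linear ones at the stalks
  \<open>ls ! i\<close>. In place of an injective \<open>u\<close> there is an arbitrary one whose
  kernel \<open>\<phi>\<close> kills, since \<open>u\<close> will be a differential.\<close>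

lemma pos_sheaf_injective:
  fixes A :: "('p::order, 'i \<Rightarrow> 'k::field) vsheaf" and B :: "('p, 'j \<Rightarrow> 'k) vsheaf"
  assumes A: "is_vsheaf A" and B: "is_vsheaf B" and u: "v_natural A B u"
    and \<phi>: "v_natural A (pos_sheaf ls) \<phi>"
    and ker: "\<And>\<sigma> v. v \<in> stalk A \<sigma> \<Longrightarrow> u \<sigma> v = 0 \<Longrightarrow> \<phi> \<sigma> v = 0"
  obtains \<psi> where "v_natural B (pos_sheaf ls) \<psi>" "\<And>\<sigma> v. v \<in> stalk A \<sigma> \<Longrightarrow> \<psi> \<sigma> (u \<sigma> v) = \<phi> \<sigma> v"
proof -
  have "\<exists>\<psi>. lin_map \<psi> \<and> (\<forall>v\<in>stalk A \<pi>. \<psi> (u \<pi> v) = \<phi> \<pi> v)" for \<pi>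
    using lin_map_factor[OF v_naturalD(1)[OF u] v_naturalD(1)[OF \<phi>] is_vsheafD(1)[OF A] ker] by metis
  then obtain \<psi>0 where \<psi>0: "\<And>\<pi>. lin_map (\<psi>0 \<pi>)" "\<And>\<pi> v. v \<in> stalk A \<pi> \<Longrightarrow> \<psi>0 \<pi> (u \<pi> v) = \<phi> \<pi> v"
    by metis
  \<comment> \<open>Restriction to \<open>ls ! i\<close> keeps coordinate \<open>i\<close>, so
    naturality dictates that this coordinate be computed there.\<close>
  define \<psi> where "\<psi> \<sigma> w = (\<lambda>i. if i \<in> pos_support ls \<sigma> then \<psi>0 (ls ! i) (rho B \<sigma> (ls ! i) w) i else 0)"
    for \<sigma> w
  show thesis
  proof
    show "v_natural B (pos_sheaf ls) \<psi>"
      unfolding v_natural_def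
    proof (intro conjI allI impI)
      fix \<sigma>
      show "lin_map (\<psi> \<sigma>)"
        by (rule lin_mapI)
           (auto simp: \<psi>_def fun_eq_iff lin_map_simps[OF \<psi>0(1)] lin_map_simps[OF is_vsheafD(2)[OF B]])
      show "\<psi> \<sigma> v \<in> stalk (pos_sheaf ls) \<sigma>" for v
        by (auto simp: stalk_pos_sheaf \<psi>_def)
      fix \<tau> v assume le: "\<sigma> \<le> \<tau>" and v: "v \<in> stalk B \<sigma>"
      have "\<psi> \<tau> (rho B \<sigma> \<tau> v) i = rho (pos_sheaf ls) \<sigma> \<tau> (\<psi> \<sigma> v) i" for i
        using is_vsheafD(5)[OF B le _ v, of "ls ! i"] pos_support_mono[OF le, of i ls]
        by (auto simp: \<psi>_def rho_pos_sheaf pos_support_def)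
      then show "\<psi> \<tau> (rho B \<sigma> \<tau> v) = rho (pos_sheaf ls) \<sigma> \<tau> (\<psi> \<sigma> v)" by blast
    qed
    fix \<sigma> v assume v: "v \<in> stalk A \<sigma>"
    have "\<psi> \<sigma> (u \<sigma> v) i = \<phi> \<sigma> v i" for i
    proof (cases "i \<in> pos_support ls \<sigma>")
      case True
      then have le: "\<sigma> \<le> ls ! i" by (simp add: pos_support_def)
      have "\<psi> \<sigma> (u \<sigma> v) i = \<psi>0 (ls ! i) (u (ls ! i) (rho A \<sigma> (ls ! i) v)) i"
        using v_naturalD(3)[OF u le v] True by (simp add: \<psi>_def)
      also have "\<dots> = \<phi> (ls ! i) (rho A \<sigma> (ls ! i) v) i"
        using \<psi>0(2) is_vsheafD(3)[OF A le v] by simp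
      also have "\<dots> = \<phi> \<sigma> v i"
        using v_naturalD(3)[OF \<phi> le v] True by (simp add: rho_pos_sheaf pos_support_def)
      finally show ?thesis .
    next
      case False
      then show ?thesis using v_naturalD(2)[OF \<phi> v] by (simp add: \<psi>_def stalk_pos_sheaf)
    qed
    then show "\<psi> \<sigma> (u \<sigma> v) = \<phi> \<sigma> v" by blast
  qed
qed

section \<open>Homotopies\<close>

definition v_homotopy ::
  "('p::order, 'i \<Rightarrow> 'k::field) vcomplex \<Rightarrow> ('p, 'j \<Rightarrow> 'k) vcomplex \<Rightarrow>
   (int \<Rightarrow> 'p \<Rightarrow> ('i \<Rightarrow> 'k) \<Rightarrow> 'j \<Rightarrow> 'k) \<Rightarrow> bool" where
  "v_homotopy K L s \<longleftrightarrow> (\<forall>d. v_natural (vobj K d) (vobj L (d - 1)) (s d))"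

text \<open>The homotopy is built upwards from degree \<open>a\<close>. If \<open>T\<close>
  satisfies the homotopy equation on cocycles, then \<open>\<phi> - d T\<close> vanishes on the
  kernel of the differential of \<open>Z\<close> and factors through that differential by
  injectivity of \<open>J\<close>. The factor is the next component, and acyclicity of
  \<open>Z\<close> makes it satisfy the equation on cocycles again.\<close>

lemma acyclic_null_homotopic:
  fixes Z :: "('p::order, 'i \<Rightarrow> 'k::field) vcomplex" and J :: "('p, nat \<Rightarrow> 'k) vcomplex"
  assumes Z: "is_vcomplex Z" and J: "is_vcomplex J"
    and ls: "\<And>d. vobj J d = pos_sheaf (ls d)" and bound: "\<And>d. d < a \<Longrightarrow> ls d = []"
    and acyc: "\<And>d \<sigma> v. v \<in> cstalk Z d \<sigma> \<Longrightarrow> vdif Z d \<sigma> v = 0 \<Longrightarrow> \<exists>w\<in>cstalk Z (d - 1) \<sigma>. vdif Z (d - 1) \<sigma> w = v"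
    and \<phi>: "v_chain Z J \<phi>"
  obtains S where "v_homotopy Z J S"
    "\<And>d \<sigma> v. v \<in> cstalk Z d \<sigma> \<Longrightarrow>
       \<phi> d \<sigma> v = vdif J (d - 1) \<sigma> (S d \<sigma> v) + S (d + 1) \<sigma> (vdif Z d \<sigma> v)"
proof -
  have zero: "c = 0" if "d < a" "c \<in> cstalk J d \<sigma>" for c d \<sigma>
    using that bound[OF that(1)] by (auto simp: ls stalk_pos_sheaf pos_support_def fun_eq_iff)
  \<comment> \<open>\<open>P n T\<close> makes \<open>T\<close> an admissible component in degree
    \<open>a + n\<close>; its clause for \<open>n = 0\<close> pins the start to zero, so that it
    agrees with the zero components below \<open>a\<close>. \<open>Q\<close> is the homotopy
    equation linking consecutive components.\<close>
  define P where "P n T \<longleftrightarrow> v_natural (vobj Z (a + int n)) (vobj J (a + int n - 1)) T \<and>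
     (n = 0 \<longrightarrow> T = (\<lambda>_ _. 0)) \<and>
     (\<forall>\<sigma>. \<forall>v\<in>cstalk Z (a + int n) \<sigma>. vdif Z (a + int n) \<sigma> v = 0 \<longrightarrow>
        \<phi> (a + int n) \<sigma> v = vdif J (a + int n - 1) \<sigma> (T \<sigma> v))" for n T
  define Q where "Q n T T' \<longleftrightarrow> (\<forall>\<sigma>. \<forall>v\<in>cstalk Z (a + int n) \<sigma>.
     \<phi> (a + int n) \<sigma> v = vdif J (a + int n - 1) \<sigma> (T \<sigma> v) + T' \<sigma> (vdif Z (a + int n) \<sigma> v))" for n T T'
  note \<phi>D = v_chainD[OF \<phi>]
  have P0: "P 0 (\<lambda>_ _. 0)"
    unfolding P_def
  proof (intro conjI allI ballI impI)
    show "v_natural (vobj Z (a + int 0)) (vobj J (a + int 0 - 1)) (\<lambda>_ _. 0)"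
      by (rule v_natural_0[OF is_vcomplexD(1)[OF J]])
    fix \<sigma> v assume v: "v \<in> cstalk Z (a + int 0) \<sigma>" "vdif Z (a + int 0) \<sigma> v = 0"
    then obtain w where w: "w \<in> cstalk Z (a - 1) \<sigma>" "vdif Z (a - 1) \<sigma> w = v"
      using acyc[of v a \<sigma>] by auto
    have "\<phi> (a - 1) \<sigma> w = 0"
      using \<phi>D(5)[OF w(1)] by (intro zero[of "a - 1"]) auto
    then show "\<phi> (a + int 0) \<sigma> v = vdif J (a + int 0 - 1) \<sigma> 0"
      using \<phi>D(3)[OF w(1)] w(2) by simp
  qed simp
  have step: "\<exists>T'. P (Suc n) T' \<and> Q n T T'" if PT: "P n T" for n T
  proof -
    let ?d = "a + int n"
    have T: "v_natural (vobj Z ?d) (vobj J (?d - 1)) T" using PT by (simp add: P_def)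
    have dT: "v_natural (vobj Z ?d) (vobj J ?d) (\<lambda>\<sigma> v. vdif J (?d - 1) \<sigma> (T \<sigma> v))"
      using v_natural_compose[OF T is_vcomplexD(3)[OF J]] .
    have nat: "v_natural (vobj Z ?d) (pos_sheaf (ls ?d)) (\<lambda>\<sigma> v. \<phi> ?d \<sigma> v - vdif J (?d - 1) \<sigma> (T \<sigma> v))"
      using v_natural_minus[OF \<phi>D(1) dT is_vcomplexD(1)[OF J]] by (simp add: ls)
    obtain T' where T': "v_natural (vobj Z (?d + 1)) (pos_sheaf (ls ?d)) T'"
      "\<And>\<sigma> v. v \<in> cstalk Z ?d \<sigma> \<Longrightarrow> T' \<sigma> (vdif Z ?d \<sigma> v) = \<phi> ?d \<sigma> v - vdif J (?d - 1) \<sigma> (T \<sigma> v)"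
    proof (rule pos_sheaf_injective[OF is_vcomplexD(1)[OF Z] is_vcomplexD(1)[OF Z] is_vcomplexD(2)[OF Z] nat])
      show "\<phi> ?d \<sigma> v - vdif J (?d - 1) \<sigma> (T \<sigma> v) = 0"
        if "v \<in> cstalk Z ?d \<sigma>" "vdif Z ?d \<sigma> v = 0" for \<sigma> v
        using PT that by (simp add: P_def)
    qed blast
    have "Q n T T'"
      using T'(2) by (simp add: Q_def)
    moreover have "P (Suc n) T'"
      unfolding P_def
    proof (intro conjI allI ballI impI)
      show "v_natural (vobj Z (a + int (Suc n))) (vobj J (a + int (Suc n) - 1)) T'"
      proof -
        have "a + int (Suc n) = ?d + 1" by simp
        then show ?thesis using T'(1) by (simp only: ls) simp
      qed
      fix \<sigma> v assume v: "v \<in> cstalk Z (a + int (Suc n)) \<sigma>" "vdif Z (a + int (Suc n)) \<sigma> v = 0"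
      have e: "a + int (Suc n) = ?d + 1" by simp
      have "v \<in> cstalk Z (?d + 1) \<sigma>" "vdif Z (?d + 1) \<sigma> v = 0"
        using v unfolding e by auto
      then obtain w where w: "w \<in> cstalk Z ?d \<sigma>" "vdif Z ?d \<sigma> w = v"
        using acyc[of v "?d + 1" \<sigma>] by auto
      have Tw: "T \<sigma> w \<in> cstalk J (?d - 1) \<sigma>"
        using v_naturalD(2)[OF T w(1)] .
      have "vdif J ?d \<sigma> (T' \<sigma> v) = vdif J ?d \<sigma> (\<phi> ?d \<sigma> w) - vdif J ?d \<sigma> (vdif J (?d - 1) \<sigma> (T \<sigma> w))"
        using T'(2)[OF w(1)] w(2) by (simp add: lin_map_diff[OF is_vcomplexD(6)[OF J]])
      also have "\<dots> = \<phi> (?d + 1) \<sigma> v"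
        using is_vcomplexD(5)[OF J Tw] \<phi>D(2)[OF w(1)] w(2) by simp
      finally show "\<phi> (a + int (Suc n)) \<sigma> v = vdif J (a + int (Suc n) - 1) \<sigma> (T' \<sigma> v)"
        unfolding e by simp
    qed simp
    ultimately show ?thesis by blast
  qed
  obtain T where T: "\<And>n. P n (T n)" "\<And>n. Q n (T n) (T (Suc n))"
    using dependent_nat_choice[of P Q] P0 step by metis
  define S where "S d = (if d \<le> a then (\<lambda>_ _. 0) else T (nat (d - a)))" for d
  have S_T: "S (a + int n) = T n" for n
    using T(1)[of n] by (cases "n = 0") (auto simp: S_def P_def)
  show thesis
  proof
    show "v_homotopy Z J S"
      unfolding v_homotopy_def
    proof
      fix d
      show "v_natural (vobj Z d) (vobj J (d - 1)) (S d)"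
      proof (cases "d < a")
        case True
        then show ?thesis using v_natural_0[OF is_vcomplexD(1)[OF J]] by (simp add: S_def)
      next
        case False
        then have "d = a + int (nat (d - a))" by simp
        then show ?thesis using T(1)[of "nat (d - a)"] S_T[of "nat (d - a)"] by (simp add: P_def)
      qed
    qed
    fix d \<sigma> v assume v: "v \<in> cstalk Z d \<sigma>"
    show "\<phi> d \<sigma> v = vdif J (d - 1) \<sigma> (S d \<sigma> v) + S (d + 1) \<sigma> (vdif Z d \<sigma> v)"
    proof (cases "d < a")
      case True
      then show ?thesis
        using zero[OF True \<phi>D(5)[OF v]] by (simp add: S_def lin_map_zero[OF is_vcomplexD(6)[OF J]])
    next
      case False
      then have d: "d = a + int (nat (d - a))" by simp
      have "S (d + 1) = T (Suc (nat (d - a)))"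
        using S_T[of "Suc (nat (d - a))"] d by (simp add: add.assoc add.commute)
      then show ?thesis using T(2)[of "nat (d - a)"] S_T[of "nat (d - a)"] v d by (simp add: Q_def)
    qed
  qed
qed

section \<open>Mapping cones and extension of chain maps along quasi-isomorphisms\<close>

text \<open>The mapping cone of \<open>g\<close>, shifted so that its degree \<open>d\<close> part is the sum of \<open>K d\<close> and \<open>L (d - 1)\<close>.\<close>

definition vcone ::
  "('p::order, 'i \<Rightarrow> 'k::field) vcomplex \<Rightarrow> ('p, 'j \<Rightarrow> 'k) vcomplex \<Rightarrow>
   (int \<Rightarrow> 'p \<Rightarrow> ('i \<Rightarrow> 'k) \<Rightarrow> 'j \<Rightarrow> 'k) \<Rightarrow> ('p, 'i + 'j \<Rightarrow> 'k) vcomplex" where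
  "vcone K L g =
     \<lparr> vobj = \<lambda>d. \<lparr> stalk = \<lambda>\<sigma>. {v. v \<circ> Inl \<in> cstalk K d \<sigma> \<and> v \<circ> Inr \<in> cstalk L (d - 1) \<sigma>},
         rho = \<lambda>\<sigma> \<tau> v. case_sum (rho (vobj K d) \<sigma> \<tau> (v \<circ> Inl)) (rho (vobj L (d - 1)) \<sigma> \<tau> (v \<circ> Inr)) \<rparr>,
       vdif = \<lambda>d \<sigma> v. case_sum (vdif K d \<sigma> (v \<circ> Inl)) (g d \<sigma> (v \<circ> Inl) - vdif L (d - 1) \<sigma> (v \<circ> Inr)) \<rparr>"

lemma case_sum_comp [simp]: "case_sum a b \<circ> Inl = a" "case_sum a b \<circ> Inr = b"
  by (simp_all add: fun_eq_iff)

lemma comp_fun_space: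
  "(v + w) \<circ> h = (v \<circ> h) + (w \<circ> h)" "fun_scale c v \<circ> h = fun_scale c (v \<circ> h)" "(0 :: 'x \<Rightarrow> 'k::field) \<circ> h' = 0"
  by (simp_all add: fun_eq_iff)

lemma case_sum_fun_space:
  "case_sum a b + case_sum c d = case_sum (a + c) (b + d)"
  "fun_scale e (case_sum a b) = case_sum (fun_scale e a) (fun_scale e b)"
  "case_sum 0 0 = 0"
  by (auto simp: fun_eq_iff split: sum.split)

lemma case_sum_eq_iff: "case_sum a b = v \<longleftrightarrow> a = v \<circ> Inl \<and> b = v \<circ> Inr"
  by (auto simp: fun_eq_iff split: sum.split)

lemma lin_map_Inl: "lin_map (\<lambda>v. v \<circ> Inl)" and lin_map_Inr: "lin_map (\<lambda>v. v \<circ> Inr)"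
  by (auto intro!: lin_mapI simp: comp_fun_space)

lemma lin_map_case_sum:
  assumes "lin_map f" "lin_map g"
  shows "lin_map (\<lambda>v. case_sum (f v) (g v))"
  by (rule lin_mapI)
     (simp_all add: lin_map_simps[OF assms(1)] lin_map_simps[OF assms(2)] case_sum_fun_space)

lemma is_vcomplex_vcone:
  assumes K: "is_vcomplex K" and L: "is_vcomplex L" and g: "v_chain K L g"
  shows "is_vcomplex (vcone K L g)"
  unfolding is_vcomplex_def
proof (intro conjI allI impI)
  note Ks = is_vsheafD[OF is_vcomplexD(1)[OF K]] and Ls = is_vsheafD[OF is_vcomplexD(1)[OF L]]
  fix d
  show "is_vsheaf (vobj (vcone K L g) d)"
    unfolding is_vsheaf_def
  proof (intro conjI allI impI)
    fix \<sigma>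
    show "fun_space.subspace (cstalk (vcone K L g) d \<sigma>)"
      using Ks(1)[of d \<sigma>] Ls(1)[of "d - 1" \<sigma>]
      by (intro fun_space.subspaceI)
         (auto simp: vcone_def comp_fun_space fun_space.subspace_0 fun_space.subspace_add
           fun_space.subspace_scale)
    fix \<tau>
    show "lin_map (rho (vobj (vcone K L g) d) \<sigma> \<tau>)"
      by (auto simp: vcone_def intro!: lin_map_case_sum lin_map_compose[OF Ks(2) lin_map_Inl]
          lin_map_compose[OF Ls(2) lin_map_Inr])
  next
    show "rho (vobj (vcone K L g) d) \<sigma> \<sigma> v = v" if "v \<in> cstalk (vcone K L g) d \<sigma>" for v \<sigma>
      using that by (auto simp: vcone_def Ks(4) Ls(4) case_sum_eq_iff)
  qed (auto simp: vcone_def intro: Ks(3) Ls(3) simp: Ks(5) Ls(5))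
  show "v_natural (vobj (vcone K L g) d) (vobj (vcone K L g) (d + 1)) (vdif (vcone K L g) d)"
    unfolding v_natural_def
  proof (intro conjI allI impI)
    fix \<sigma>
    show "lin_map (vdif (vcone K L g) d \<sigma>)"
      by (auto simp: vcone_def intro!: lin_map_case_sum lin_map_compose[OF is_vcomplexD(6)[OF K] lin_map_Inl]
         lin_map_minus lin_map_compose[OF v_chainD(4)[OF g] lin_map_Inl]
         lin_map_compose[OF is_vcomplexD(6)[OF L] lin_map_Inr])
    show "vdif (vcone K L g) d \<sigma> v \<in> cstalk (vcone K L g) (d + 1) \<sigma>"
      if "v \<in> cstalk (vcone K L g) d \<sigma>" for v
      using that is_vcomplexD(8)[OF K] is_vcomplexD(9)[OF L] v_chainD(5)[OF g]
      by (auto simp: vcone_def intro!: fun_space.subspace_diff[OF is_vcomplexD(7)[OF L]])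
    fix \<tau> v
    assume "\<sigma> \<le> \<tau>" and v: "v \<in> cstalk (vcone K L g) d \<sigma>"
    then show "vdif (vcone K L g) d \<tau> (rho (vobj (vcone K L g) d) \<sigma> \<tau> v) =
      rho (vobj (vcone K L g) (d + 1)) \<sigma> \<tau> (vdif (vcone K L g) d \<sigma> v)"
      using v_naturalD(3)[OF is_vcomplexD(2)[OF K], of \<sigma> \<tau> "v \<circ> Inl" d]
        v_naturalD(3)[OF is_vcomplexD(3)[OF L], of \<sigma> \<tau> "v \<circ> Inr" d]
        v_naturalD(3)[OF v_chainD(1)[OF g], of \<sigma> \<tau> "v \<circ> Inl" d]
      by (simp add: vcone_def lin_map_diff[OF Ls(2)])
  qed
  fix \<sigma> v
  assume v: "v \<in> cstalk (vcone K L g) d \<sigma>"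
  then show "vdif (vcone K L g) (d + 1) \<sigma> (vdif (vcone K L g) d \<sigma> v) = 0"
    using is_vcomplexD(4)[OF K, of "v \<circ> Inl" d \<sigma>] is_vcomplexD(5)[OF L, of "v \<circ> Inr" d \<sigma>]
      v_chainD(2)[OF g, of "v \<circ> Inl" d \<sigma>]
    by (simp add: vcone_def case_sum_fun_space lin_map_diff[OF is_vcomplexD(6)[OF L]])
qed

text \<open>A cocycle of the cone is a pair with \<open>d x = 0\<close> and
  \<open>g x = d y\<close>. Injectivity of \<open>g\<close> on cohomology makes \<open>x\<close> the
  boundary of some \<open>x'\<close>, and surjectivity treats the cocycle \<open>y - g x'\<close>
  that is left over.\<close>

lemma vcone_acyclic:
  assumes K: "is_vcomplex K" and L: "is_vcomplex L" and g: "v_quasi_iso K L g"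
    and v: "v \<in> cstalk (vcone K L g) d \<sigma>" "vdif (vcone K L g) d \<sigma> v = 0"
  shows "\<exists>w\<in>cstalk (vcone K L g) (d - 1) \<sigma>. vdif (vcone K L g) (d - 1) \<sigma> w = v"
proof -
  define x y where "x = v \<circ> Inl" and "y = v \<circ> Inr"
  note gc = v_chainD[OF v_quasi_isoD(1)[OF g]]
  have x: "x \<in> cstalk K d \<sigma>" "vdif K d \<sigma> x = 0" and y: "y \<in> cstalk L (d - 1) \<sigma>"
    and gx: "g d \<sigma> x = vdif L (d - 1) \<sigma> y"
    using v by (auto simp: vcone_def case_sum_eq_iff x_def y_def comp_fun_space)
  from v_quasi_isoD(2)[OF g, OF x y gx]
  obtain x' where x': "x' \<in> cstalk K (d - 1) \<sigma>" "x = vdif K (d - 1) \<sigma> x'" by blast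
  let ?y = "y - g (d - 1) \<sigma> x'"
  have "?y \<in> cstalk L (d - 1) \<sigma>" "vdif L (d - 1) \<sigma> ?y = 0"
    using y gc(5)[OF x'(1)] gc(3)[OF x'(1)] gx x'(2)
    by (auto simp: lin_map_diff[OF is_vcomplexD(6)[OF L]] intro: fun_space.subspace_diff[OF is_vcomplexD(7)[OF L]])
  from v_quasi_isoD(3)[OF g, OF this] obtain z w where z: "z \<in> cstalk K (d - 1) \<sigma>" "vdif K (d - 1) \<sigma> z = 0"
    and w: "w \<in> cstalk L (d - 1 - 1) \<sigma>" and eq: "?y = g (d - 1) \<sigma> z + vdif L (d - 1 - 1) \<sigma> w"
    by blast
  \<comment> \<open>The sign of \<open>w\<close> offsets the sign that the differential of
    \<open>L\<close> carries in the cone.\<close>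
  let ?w = "case_sum (x' + z) (- w)"
  have "?w \<in> cstalk (vcone K L g) (d - 1) \<sigma>"
    using x'(1) z(1) w is_vcomplexD(7)[OF K] is_vcomplexD(7)[OF L]
    by (auto simp: vcone_def intro: fun_space.subspace_add fun_space.subspace_neg)
  moreover have "y = g (d - 1) \<sigma> x' + g (d - 1) \<sigma> z + vdif L (d - 1 - 1) \<sigma> w"
    using eq by (simp add: algebra_simps)
  then have "vdif (vcone K L g) (d - 1) \<sigma> ?w = v"
    using x'(2) z(2)
    by (simp add: vcone_def case_sum_eq_iff x_def[symmetric] y_def[symmetric]
        lin_map_simps[OF gc(4)] lin_map_simps[OF is_vcomplexD(6)[OF K]] lin_map_simps[OF is_vcomplexD(6)[OF L]])
  ultimately show ?thesis by blast
qed

text \<open>Projecting the cone of \<open>g\<close> to \<open>K\<close> and applying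
  \<open>f\<close> gives a chain map from an acyclic complex to \<open>J\<close>. The restrictions
  of its null-homotopy to the two summands of the cone are \<open>s\<close> and
  \<open>h\<close>.\<close>

lemma v_chain_extend:
  fixes J :: "('p::order, nat \<Rightarrow> 'k::field) vcomplex"
  assumes K: "is_vcomplex K" and L: "is_vcomplex L" and J: "is_vcomplex J"
    and ls: "\<And>d. vobj J d = pos_sheaf (ls d)" and bound: "\<And>d. d < a \<Longrightarrow> ls d = []"
    and g: "v_quasi_iso K L g" and f: "v_chain K J f"
  obtains h s where "v_chain L J h" "v_homotopy K J s"
    "\<And>d \<sigma> x. x \<in> cstalk K d \<sigma> \<Longrightarrow>
       f d \<sigma> x = vdif J (d - 1) \<sigma> (s d \<sigma> x) + s (d + 1) \<sigma> (vdif K d \<sigma> x) + h d \<sigma> (g d \<sigma> x)"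
proof -
  let ?Z = "vcone K L g"
  note gc = v_quasi_isoD(1)[OF g]
  have Z: "is_vcomplex ?Z" using K L gc by (rule is_vcomplex_vcone)
  have \<phi>: "v_chain ?Z J (\<lambda>d \<sigma> v. f d \<sigma> (v \<circ> Inl))"
    unfolding v_chain_def v_natural_def
    using v_chainD(2,5)[OF f] v_naturalD(3)[OF v_chainD(1)[OF f]]
    by (auto simp: vcone_def intro: lin_map_compose[OF v_chainD(4)[OF f] lin_map_Inl])
  obtain S where S: "v_homotopy ?Z J S"
    "\<And>d \<sigma> v. v \<in> cstalk ?Z d \<sigma> \<Longrightarrow>
       f d \<sigma> (v \<circ> Inl) = vdif J (d - 1) \<sigma> (S d \<sigma> v) + S (d + 1) \<sigma> (vdif ?Z d \<sigma> v)"
    using acyclic_null_homotopic[OF Z J ls bound vcone_acyclic[OF K L g] \<phi>] by blast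
  have Sn: "v_natural (vobj ?Z d) (vobj J (d - 1)) (S d)" for d
    using S(1) by (simp add: v_homotopy_def)
  have Sn': "v_natural (vobj ?Z (d + 1)) (vobj J d) (S (d + 1))" for d
    using Sn[of "d + 1"] by simp
  have zero: "0 \<in> cstalk K d \<sigma>" "0 \<in> cstalk L d \<sigma>" for d \<sigma>
    using is_vcomplexD(7)[OF K] is_vcomplexD(7)[OF L] by (auto intro: fun_space.subspace_0)
  note rz = lin_map_zero[OF is_vsheafD(2)[OF is_vcomplexD(1)[OF K]]]
    lin_map_zero[OF is_vsheafD(2)[OF is_vcomplexD(1)[OF L]]]
    lin_map_zero[OF is_vcomplexD(6)[OF K]] lin_map_zero[OF is_vcomplexD(6)[OF L]]
    lin_map_zero[OF v_chainD(4)[OF gc]]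
  have i2: "v_natural (vobj L d) (vobj ?Z (d + 1)) (\<lambda>\<sigma> y. case_sum 0 y)" for d
    unfolding v_natural_def using lin_map_case_sum[OF lin_map_0 lin_map_ident]
    by (auto simp: vcone_def zero rz)
  have i1: "v_natural (vobj K d) (vobj ?Z d) (\<lambda>\<sigma> x. case_sum x 0)" for d
    unfolding v_natural_def using lin_map_case_sum[OF lin_map_ident lin_map_0]
    by (auto simp: vcone_def zero rz)
  \<comment> \<open>Degree \<open>d\<close> of \<open>L\<close> sits in degree \<open>d + 1\<close>
    of the cone, so on this summand the homotopy lands in degree \<open>d\<close> of
    \<open>J\<close> and can be a chain map.\<close>
  define h where "h d \<sigma> y = S (d + 1) \<sigma> (case_sum 0 y)" for d \<sigma> y
  define s where "s d \<sigma> x = S d \<sigma> (case_sum x 0)" for d \<sigma> x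
  show thesis
  proof
    show "v_homotopy K J s"
      unfolding v_homotopy_def s_def using v_natural_compose[OF i1 Sn] by blast
    show "v_chain L J h"
      unfolding v_chain_def
    proof (intro conjI allI impI)
      fix d
      show "v_natural (vobj L d) (vobj J d) (h d)"
        unfolding h_def using v_natural_compose[OF i2 Sn'] by blast
      fix \<sigma> y assume y: "y \<in> cstalk L d \<sigma>"
      let ?v = "case_sum 0 y"
      have v: "?v \<in> cstalk ?Z (d + 1) \<sigma>" using y zero by (simp add: vcone_def)
      \<comment> \<open>Thanks to the minus sign, the homotopy equation on the summand
        \<open>L\<close> says that \<open>h\<close> commutes with the differentials.\<close>
      have dv: "vdif ?Z (d + 1) \<sigma> ?v = - case_sum 0 (vdif L d \<sigma> y)"
        by (auto simp: vcone_def rz fun_eq_iff split: sum.split)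
      have "0 = vdif J d \<sigma> (S (d + 1) \<sigma> ?v) - S (d + 1 + 1) \<sigma> (case_sum 0 (vdif L d \<sigma> y))"
        using S(2)[OF v] by (simp add: dv lin_map_neg[OF v_naturalD(1)[OF Sn]] lin_map_zero[OF v_chainD(4)[OF f]])
      then show "h (d + 1) \<sigma> (vdif L d \<sigma> y) = vdif J d \<sigma> (h d \<sigma> y)"
        by (simp add: h_def)
    qed
    fix d \<sigma> x assume x: "x \<in> cstalk K d \<sigma>"
    let ?v = "case_sum x 0"
    have v: "?v \<in> cstalk ?Z d \<sigma>" using x zero by (simp add: vcone_def)
    have dv: "vdif ?Z d \<sigma> ?v = case_sum (vdif K d \<sigma> x) 0 + case_sum 0 (g d \<sigma> x)"
      by (auto simp: vcone_def rz fun_eq_iff split: sum.split)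
    show "f d \<sigma> x = vdif J (d - 1) \<sigma> (s d \<sigma> x) + s (d + 1) \<sigma> (vdif K d \<sigma> x) + h d \<sigma> (g d \<sigma> x)"
      using S(2)[OF v] by (simp add: dv s_def h_def lin_map_add[OF v_naturalD(1)[OF Sn]] add.assoc)
  qed
qed

text \<open>Two out of three: \<open>f\<close> is homotopic to the composite of \<open>g\<close> and
  \<open>h\<close>, and homotopic maps agree on cohomology, since the term \<open>s (d x)\<close>
  disappears on cocycles.\<close>

lemma v_quasi_iso_extend:
  fixes J :: "('p::order, nat \<Rightarrow> 'k::field) vcomplex"
  assumes K: "is_vcomplex K" and L: "is_vcomplex L" and J: "is_vcomplex J"
    and ls: "\<And>d. vobj J d = pos_sheaf (ls d)" and bound: "\<And>d. d < a \<Longrightarrow> ls d = []"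
    and g: "v_quasi_iso K L g" and f: "v_quasi_iso K J f"
  obtains h where "v_quasi_iso L J h"
proof -
  obtain h s where h: "v_chain L J h" and s: "v_homotopy K J s"
    and eq: "\<And>d \<sigma> x. x \<in> cstalk K d \<sigma> \<Longrightarrow>
       f d \<sigma> x = vdif J (d - 1) \<sigma> (s d \<sigma> x) + s (d + 1) \<sigma> (vdif K d \<sigma> x) + h d \<sigma> (g d \<sigma> x)"
    using v_chain_extend[OF K L J ls bound g v_quasi_isoD(1)[OF f]] by blast
  have sn: "v_natural (vobj K d) (vobj J (d - 1)) (s d)" for d
    using s by (simp add: v_homotopy_def)
  note gc = v_chainD[OF v_quasi_isoD(1)[OF g]] and hc = v_chainD[OF h]
  note Jl = lin_map_simps[OF is_vcomplexD(6)[OF J]]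
  have Jsub: "fun_space.subspace (cstalk J d \<sigma>)" for d \<sigma> using is_vcomplexD(7)[OF J] .
  have eq0: "f d \<sigma> x = vdif J (d - 1) \<sigma> (s d \<sigma> x) + h d \<sigma> (g d \<sigma> x)"
    if "x \<in> cstalk K d \<sigma>" "vdif K d \<sigma> x = 0" for d \<sigma> x
    using eq[OF that(1)] that(2) by (simp add: lin_map_zero[OF v_naturalD(1)[OF sn]])
  have "v_quasi_iso L J h"
    unfolding v_quasi_iso_def
  proof (intro conjI allI impI)
    show "v_chain L J h" by fact
    fix d \<sigma>
    show "\<exists>x\<in>cstalk L (d - 1) \<sigma>. y = vdif L (d - 1) \<sigma> x"
      if y: "y \<in> cstalk L d \<sigma>" "vdif L d \<sigma> y = 0" "w \<in> cstalk J (d - 1) \<sigma>" "h d \<sigma> y = vdif J (d - 1) \<sigma> w"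
      for y w
    proof -
      from v_quasi_isoD(3)[OF g, OF y(1,2)] obtain x w' where x: "x \<in> cstalk K d \<sigma>" "vdif K d \<sigma> x = 0"
        and w': "w' \<in> cstalk L (d - 1) \<sigma>" and yx: "y = g d \<sigma> x + vdif L (d - 1) \<sigma> w'" by blast
      \<comment> \<open>The three terms come from the homotopy, from the given \<open>w\<close>, and
        from replacing \<open>y\<close> by the cohomologous \<open>g x\<close>.\<close>
      let ?w = "s d \<sigma> x + w - h (d - 1) \<sigma> w'"
      have "f d \<sigma> x = vdif J (d - 1) \<sigma> ?w"
        using eq0[OF x] y(4) hc(3)[OF w'] by (simp add: yx Jl lin_map_simps[OF hc(4)] algebra_simps)
      moreover have "?w \<in> cstalk J (d - 1) \<sigma>"
        using v_naturalD(2)[OF sn x(1)] y(3) hc(5)[OF w']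
        by (intro fun_space.subspace_diff[OF Jsub] fun_space.subspace_add[OF Jsub])
      ultimately obtain x' where x': "x' \<in> cstalk K (d - 1) \<sigma>" "x = vdif K (d - 1) \<sigma> x'"
        using v_quasi_isoD(2)[OF f, OF x] by blast
      have "y = vdif L (d - 1) \<sigma> (g (d - 1) \<sigma> x' + w')"
        using gc(3)[OF x'(1)] by (simp add: yx x'(2) lin_map_add[OF is_vcomplexD(6)[OF L]])
      then show ?thesis
        using gc(5)[OF x'(1)] w' fun_space.subspace_add[OF is_vcomplexD(7)[OF L]] by blast
    qed
    show "\<exists>u\<in>cstalk L d \<sigma>. \<exists>w\<in>cstalk J (d - 1) \<sigma>. vdif L d \<sigma> u = 0 \<and> z = h d \<sigma> u + vdif J (d - 1) \<sigma> w"
      if z: "z \<in> cstalk J d \<sigma>" "vdif J d \<sigma> z = 0" for z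
    proof -
      from v_quasi_isoD(3)[OF f, OF z] obtain x w where x: "x \<in> cstalk K d \<sigma>" "vdif K d \<sigma> x = 0"
        and w: "w \<in> cstalk J (d - 1) \<sigma>" and zx: "z = f d \<sigma> x + vdif J (d - 1) \<sigma> w" by blast
      have "vdif L d \<sigma> (g d \<sigma> x) = 0"
        using gc(2)[OF x(1)] x(2) by (simp add: lin_map_zero[OF gc(4)])
      moreover have "z = h d \<sigma> (g d \<sigma> x) + vdif J (d - 1) \<sigma> (s d \<sigma> x + w)"
        using eq0[OF x] by (simp add: zx Jl algebra_simps)
      moreover have "s d \<sigma> x + w \<in> cstalk J (d - 1) \<sigma>"
        using v_naturalD(2)[OF sn x(1)] w by (rule fun_space.subspace_add[OF Jsub])
      ultimately show ?thesis using gc(5)[OF x(1)] by blast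
    qed
  qed
  then show thesis by (rule that)
qed

section \<open>Matrices as linear maps of function spaces\<close>

definition fin_space :: "nat \<Rightarrow> (nat \<Rightarrow> 'k::field) set" where
  "fin_space n = {v. \<forall>i\<ge>n. v i = 0}"

text \<open>The cutoff at \<open>dim_row\<close> puts all values into \<open>fin_space\<close>, and
  coordinates of the argument from \<open>dim_col\<close> on are ignored, so that the map is total
  and linear.\<close>

definition app :: "'k::field mat \<Rightarrow> (nat \<Rightarrow> 'k) \<Rightarrow> nat \<Rightarrow> 'k" where
  "app A v = (\<lambda>i. if i < dim_row A then \<Sum>j<dim_col A. A $$ (i, j) * v j else 0)"

definition unit_fun :: "nat \<Rightarrow> nat \<Rightarrow> 'k::field" where
  "unit_fun j = (\<lambda>i. if i = j then 1 else 0)"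

definition mat_of :: "nat \<Rightarrow> nat \<Rightarrow> ((nat \<Rightarrow> 'k::field) \<Rightarrow> nat \<Rightarrow> 'k) \<Rightarrow> 'k mat" where
  "mat_of m n f = mat m n (\<lambda>(i, j). f (unit_fun j) i)"

lemma unit_fun_apply: "unit_fun j i = (if i = j then 1 else 0)"
  by (simp add: unit_fun_def)

lemma unit_fun_fin_space [simp]: "unit_fun j \<in> fin_space n \<longleftrightarrow> j < n"
  by (auto simp: fin_space_def unit_fun_apply not_le[symmetric])

lemma subspace_fin_space: "fun_space.subspace (fin_space n)"
  by (rule fun_space.subspaceI) (auto simp: fin_space_def)

lemma lin_map_app: "lin_map (app A)"
  by (rule lin_mapI) (auto simp: app_def fun_eq_iff algebra_simps sum.distrib sum_distrib_left)

lemma app_fin_space: "A \<in> carrier_mat m n \<Longrightarrow> app A v \<in> fin_space m"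
  by (auto simp: app_def fin_space_def)

lemma app_mult:
  assumes "A \<in> carrier_mat l m" "B \<in> carrier_mat m n"
  shows "app (A * B) v = app A (app B v)"
proof
  fix i
  show "app (A * B) v i = app A (app B v) i"
  proof (cases "i < l")
    case True
    have "app (A * B) v i = (\<Sum>j<n. (\<Sum>k<m. A $$ (i, k) * B $$ (k, j)) * v j)"
      using True assms by (auto simp: app_def scalar_prod_def atLeast0LessThan intro!: sum.cong)
    also have "\<dots> = (\<Sum>k<m. A $$ (i, k) * (\<Sum>j<n. B $$ (k, j) * v j))"
      unfolding sum_distrib_left sum_distrib_right by (subst sum.swap) (simp add: mult.assoc)
    also have "\<dots> = app A (app B v) i"
      using True assms by (simp add: app_def)
    finally show ?thesis .
  qed (use assms in \<open>simp add: app_def\<close>)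
qed

lemma app_one: "v \<in> fin_space n \<Longrightarrow> app (1\<^sub>m n) v = v"
proof
  fix i
  assume v: "v \<in> fin_space n"
  have "(\<Sum>j<n. 1\<^sub>m n $$ (i, j) * v j) = (\<Sum>j<n. if j = i then v j else 0)" if "i < n"
    using that by (intro sum.cong) auto
  then show "app (1\<^sub>m n) v i = v i"
    using v by (auto simp: app_def fin_space_def)
qed

lemma app_zero: "app (0\<^sub>m m n) v = 0"
  by (auto simp: app_def fun_eq_iff)

lemma app_unit: "j < dim_col A \<Longrightarrow> app A (unit_fun j) i = (if i < dim_row A then A $$ (i, j) else 0)"
  by (auto simp: app_def unit_fun_apply sum.delta if_distrib cong: if_cong)

lemma app_eqI:
  assumes "A \<in> carrier_mat m n" "B \<in> carrier_mat m n" "\<And>v. v \<in> fin_space n \<Longrightarrow> app A v = app B v"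
  shows "A = B"
proof (rule eq_matI)
  fix i j assume ij: "i < dim_row B" "j < dim_col B"
  have "app A (unit_fun j) i = app B (unit_fun j) i"
    using assms(3)[of "unit_fun j"] ij assms(2) by simp
  then show "A $$ (i, j) = B $$ (i, j)"
    using ij assms(1,2) by (simp add: app_unit)
qed (use assms in auto)

lemma mat_of_carrier [simp]: "mat_of m n f \<in> carrier_mat m n"
  by (simp add: mat_of_def)

text \<open>The unit functions do not span \<open>nat \<Rightarrow> 'k\<close>, so they determine a
  linear map only on functions of finite support; there the last coordinate is split off
  inductively.\<close>

lemma lin_map_expand:
  assumes "lin_map f" "v \<in> fin_space n"
  shows "f v i = (\<Sum>j<n. f (unit_fun j) i * v j)"
  using assms(2)
proof (induction n arbitrary: v)
  case 0
  then have "v = 0" by (auto simp: fin_space_def)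
  then have "f v = 0" using lin_map_zero[OF assms(1)] by blast
  then show ?case by simp
next
  case (Suc n)
  let ?w = "v(n := 0)"
  have w: "?w \<in> fin_space n"
    using Suc.prems by (auto simp: fin_space_def not_less_eq_eq le_Suc_eq)
  have "v = ?w + fun_scale (v n) (unit_fun n)"
    by (auto simp: fun_eq_iff unit_fun_apply)
  then have "f v i = f ?w i + f (unit_fun n) i * v n"
    using lin_map_add[OF assms(1), of ?w "fun_scale (v n) (unit_fun n)"]
    by (simp add: lin_map_scale[OF assms(1)])
  also have "f ?w i = (\<Sum>j<n. f (unit_fun j) i * v j)"
    unfolding Suc.IH[OF w] by (intro sum.cong) auto
  finally show ?case by simp
qed

lemma app_mat_of:
  assumes "lin_map f" "v \<in> fin_space n" "f v \<in> fin_space m"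
  shows "app (mat_of m n f) v = f v"
proof
  show "app (mat_of m n f) v i = f v i" for i
    using assms(3) lin_map_expand[OF assms(1,2), of i]
    by (auto simp: app_def mat_of_def fin_space_def)
qed

section \<open>Dictionary between the matrix model and function spaces\<close>

definition vsheaf_of :: "('p, 'k::field) sheaf_data \<Rightarrow> ('p, nat \<Rightarrow> 'k) vsheaf" where
  "vsheaf_of F = \<lparr> stalk = \<lambda>\<sigma>. fin_space (stalk_dim F \<sigma>), rho = \<lambda>\<sigma> \<tau>. app (res F \<sigma> \<tau>) \<rparr>"

definition v_iso :: "('p::order, 'i \<Rightarrow> 'k::field) vsheaf \<Rightarrow> ('p, 'j \<Rightarrow> 'k) vsheaf \<Rightarrow> bool" where
  "v_iso F G \<longleftrightarrow> (\<exists>f g. v_natural F G f \<and> v_natural G F g \<and>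
     (\<forall>\<sigma>. (\<forall>v\<in>stalk F \<sigma>. g \<sigma> (f \<sigma> v) = v) \<and> (\<forall>v\<in>stalk G \<sigma>. f \<sigma> (g \<sigma> v) = v)))"

lemma vsheaf_of_simps [simp]:
  "stalk (vsheaf_of F) \<sigma> = fin_space (stalk_dim F \<sigma>)" "rho (vsheaf_of F) \<sigma> \<tau> = app (res F \<sigma> \<tau>)"
  by (simp_all add: vsheaf_of_def)

lemma sheafD:
  assumes "sheaf F"
  shows "\<sigma> \<le> \<tau> \<Longrightarrow> res F \<sigma> \<tau> \<in> carrier_mat (stalk_dim F \<tau>) (stalk_dim F \<sigma>)"
    "res F \<sigma> \<sigma> = 1\<^sub>m (stalk_dim F \<sigma>)"
    "\<rho> \<le> \<sigma> \<Longrightarrow> \<sigma> \<le> \<tau> \<Longrightarrow> res F \<sigma> \<tau> * res F \<rho> \<sigma> = res F \<rho> \<tau>"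
  using assms unfolding sheaf_def by auto

lemma is_vsheaf_of:
  assumes "sheaf F"
  shows "is_vsheaf (vsheaf_of F)"
  unfolding is_vsheaf_def
proof (intro conjI allI impI)
  fix \<pi> \<sigma> \<tau> :: 'a and v assume "\<pi> \<le> \<sigma>" "\<sigma> \<le> \<tau>"
  then show "rho (vsheaf_of F) \<sigma> \<tau> (rho (vsheaf_of F) \<pi> \<sigma> v) = rho (vsheaf_of F) \<pi> \<tau> v"
    using sheafD(3)[OF assms, of \<pi> \<sigma> \<tau>]
      app_mult[OF sheafD(1)[OF assms, of \<sigma> \<tau>] sheafD(1)[OF assms, of \<pi> \<sigma>], of v] by simp
qed (auto simp: subspace_fin_space lin_map_app sheafD[OF assms] app_one intro: app_fin_space sheafD(1)[OF assms])

text \<open>\<open>app\<close> forgets the dimensions of a matrix, as all zero matrices act alike.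
  Carrier conditions are therefore stated separately, here and in the equivalences below.\<close>

lemma sheaf_ofI:
  assumes carrier: "\<And>\<sigma> \<tau>. \<sigma> \<le> \<tau> \<Longrightarrow> res F \<sigma> \<tau> \<in> carrier_mat (stalk_dim F \<tau>) (stalk_dim F \<sigma>)"
    and F: "is_vsheaf (vsheaf_of F)"
  shows "sheaf F"
  unfolding sheaf_def
proof (intro conjI allI impI)
  show "res F \<sigma> \<sigma> = 1\<^sub>m (stalk_dim F \<sigma>)" for \<sigma>
    using is_vsheafD(4)[OF F] by (intro app_eqI[OF carrier]) (auto simp: app_one)
  show "res F \<sigma> \<tau> * res F \<rho> \<sigma> = res F \<rho> \<tau>" if "\<rho> \<le> \<sigma> \<and> \<sigma> \<le> \<tau>" for \<rho> \<sigma> \<tau>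
  proof (rule app_eqI)
    have c: "res F \<sigma> \<tau> \<in> carrier_mat (stalk_dim F \<tau>) (stalk_dim F \<sigma>)"
      "res F \<rho> \<sigma> \<in> carrier_mat (stalk_dim F \<sigma>) (stalk_dim F \<rho>)"
      using that carrier by auto
    show "res F \<sigma> \<tau> * res F \<rho> \<sigma> \<in> carrier_mat (stalk_dim F \<tau>) (stalk_dim F \<rho>)"
      using c by simp
    show "res F \<rho> \<tau> \<in> carrier_mat (stalk_dim F \<tau>) (stalk_dim F \<rho>)"
      using that carrier[of \<rho> \<tau>] by auto
    fix v :: "nat \<Rightarrow> 'b" assume "v \<in> fin_space (stalk_dim F \<rho>)"
    then show "app (res F \<sigma> \<tau> * res F \<rho> \<sigma>) v = app (res F \<rho> \<tau>) v"
      using is_vsheafD(5)[OF F, of \<rho> \<sigma> \<tau> v] that by (simp add: app_mult[OF c])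
  qed
qed (rule carrier)

lemma naturalD:
  assumes "natural F G \<phi>"
  shows "\<phi> \<sigma> \<in> carrier_mat (stalk_dim G \<sigma>) (stalk_dim F \<sigma>)"
    "\<sigma> \<le> \<tau> \<Longrightarrow> \<phi> \<tau> * res F \<sigma> \<tau> = res G \<sigma> \<tau> * \<phi> \<sigma>"
  using assms unfolding natural_def by auto

lemma natural_iff_v_natural:
  assumes F: "sheaf F" and G: "sheaf G"
  shows "natural F G \<phi> \<longleftrightarrow> (\<forall>\<sigma>. \<phi> \<sigma> \<in> carrier_mat (stalk_dim G \<sigma>) (stalk_dim F \<sigma>)) \<and>
    v_natural (vsheaf_of F) (vsheaf_of G) (\<lambda>\<sigma>. app (\<phi> \<sigma>))" (is "_ \<longleftrightarrow> ?c \<and> ?n")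
proof (intro iffI conjI)
  assume n: "natural F G \<phi>"
  note c = naturalD(1)[OF n]
  show ?c using c by blast
  show ?n
    unfolding v_natural_def
  proof (intro conjI allI impI)
    fix \<sigma> \<tau> :: 'a and v assume le: "\<sigma> \<le> \<tau>"
    show "app (\<phi> \<tau>) (rho (vsheaf_of F) \<sigma> \<tau> v) = rho (vsheaf_of G) \<sigma> \<tau> (app (\<phi> \<sigma>) v)"
      using naturalD(2)[OF n le] app_mult[OF c sheafD(1)[OF F le], of v] app_mult[OF sheafD(1)[OF G le] c, of v]
      by simp
  qed (auto simp: lin_map_app intro: app_fin_space[OF c])
next
  assume "?c \<and> ?n"
  then have c: "\<And>\<sigma>. \<phi> \<sigma> \<in> carrier_mat (stalk_dim G \<sigma>) (stalk_dim F \<sigma>)" and n: ?n by auto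
  have "\<phi> \<tau> * res F \<sigma> \<tau> = res G \<sigma> \<tau> * \<phi> \<sigma>" if le: "\<sigma> \<le> \<tau>" for \<sigma> \<tau>
  proof (rule app_eqI)
    show "\<phi> \<tau> * res F \<sigma> \<tau> \<in> carrier_mat (stalk_dim G \<tau>) (stalk_dim F \<sigma>)"
      "res G \<sigma> \<tau> * \<phi> \<sigma> \<in> carrier_mat (stalk_dim G \<tau>) (stalk_dim F \<sigma>)"
      using c[of \<tau>] c[of \<sigma>] sheafD(1)[OF F le] sheafD(1)[OF G le] by auto
    show "app (\<phi> \<tau> * res F \<sigma> \<tau>) v = app (res G \<sigma> \<tau> * \<phi> \<sigma>) v" if "v \<in> fin_space (stalk_dim F \<sigma>)" for v
      using v_naturalD(3)[OF n le, of v] that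
      by (simp add: app_mult[OF c sheafD(1)[OF F le]] app_mult[OF sheafD(1)[OF G le] c])
  qed
  then show "natural F G \<phi>" using c by (simp add: natural_def)
qed

text \<open>Allows a natural map to be replaced by the matrices it induces, which agree with it only
  on the stalks.\<close>

lemma v_natural_cong:
  assumes "is_vsheaf F"
  assumes "v_natural F G f" "\<And>\<sigma>. lin_map (g \<sigma>)" "\<And>\<sigma> v. v \<in> stalk F \<sigma> \<Longrightarrow> g \<sigma> v = f \<sigma> v"
  shows "v_natural F G g"
  using assms(3,4) v_naturalD(2,3)[OF assms(2)] is_vsheafD(3)[OF assms(1)]
  by (simp add: v_natural_def)

abbreviation nat_mat ::
  "('p, 'k::field) sheaf_data \<Rightarrow> ('p, 'k) sheaf_data \<Rightarrow> ('p \<Rightarrow> (nat \<Rightarrow> 'k) \<Rightarrow> nat \<Rightarrow> 'k) \<Rightarrow> 'p \<Rightarrow> 'k mat"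
  where "nat_mat F G f \<equiv> (\<lambda>\<sigma>. mat_of (stalk_dim G \<sigma>) (stalk_dim F \<sigma>) (f \<sigma>))"

lemma natural_nat_mat:
  assumes F: "sheaf F" and G: "sheaf G" and f: "v_natural (vsheaf_of F) (vsheaf_of G) f"
  shows "natural F G (nat_mat F G f)"
    and "v \<in> fin_space (stalk_dim F \<sigma>) \<Longrightarrow> app (nat_mat F G f \<sigma>) v = f \<sigma> v"
proof -
  show *: "app (nat_mat F G f \<sigma>) v = f \<sigma> v" if "v \<in> fin_space (stalk_dim F \<sigma>)" for \<sigma> v
    using v_naturalD(1)[OF f, of \<sigma>] v_naturalD(2)[OF f, of _ \<sigma>] that by (intro app_mat_of) auto
  show "natural F G (nat_mat F G f)"
    using v_natural_cong[OF is_vsheaf_of[OF F] f, of "\<lambda>\<sigma>. app (nat_mat F G f \<sigma>)"] *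
    by (simp add: natural_iff_v_natural[OF F G] lin_map_app)
qed

lemma sheaf_iso_iff_v_iso:
  assumes F: "sheaf F" and G: "sheaf G"
  shows "sheaf_iso F G \<longleftrightarrow> v_iso (vsheaf_of F) (vsheaf_of G)"
proof
  assume "sheaf_iso F G"
  then obtain \<phi> \<psi> where \<phi>: "natural F G \<phi>" and \<psi>: "natural G F \<psi>"
    and inv: "\<And>\<sigma>. \<psi> \<sigma> * \<phi> \<sigma> = 1\<^sub>m (stalk_dim F \<sigma>)" "\<And>\<sigma>. \<phi> \<sigma> * \<psi> \<sigma> = 1\<^sub>m (stalk_dim G \<sigma>)"
    unfolding sheaf_iso_def by blast
  have "app (\<psi> \<sigma>) (app (\<phi> \<sigma>) v) = v" if "v \<in> fin_space (stalk_dim F \<sigma>)" for \<sigma> v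
    using app_mult[OF naturalD(1)[OF \<psi>, of \<sigma>] naturalD(1)[OF \<phi>, of \<sigma>], of v] app_one[OF that] by (simp add: inv)
  moreover have "app (\<phi> \<sigma>) (app (\<psi> \<sigma>) v) = v" if "v \<in> fin_space (stalk_dim G \<sigma>)" for \<sigma> v
    using app_mult[OF naturalD(1)[OF \<phi>, of \<sigma>] naturalD(1)[OF \<psi>, of \<sigma>], of v] app_one[OF that] by (simp add: inv)
  ultimately show "v_iso (vsheaf_of F) (vsheaf_of G)"
    using \<phi> \<psi> unfolding v_iso_def natural_iff_v_natural[OF F G] natural_iff_v_natural[OF G F]
    by (intro exI[of _ "\<lambda>\<sigma>. app (\<phi> \<sigma>)"] exI[of _ "\<lambda>\<sigma>. app (\<psi> \<sigma>)"]) auto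
next
  assume "v_iso (vsheaf_of F) (vsheaf_of G)"
  then obtain f g where f: "v_natural (vsheaf_of F) (vsheaf_of G) f"
    and g: "v_natural (vsheaf_of G) (vsheaf_of F) g"
    and inv: "\<And>\<sigma> v. v \<in> fin_space (stalk_dim F \<sigma>) \<Longrightarrow> g \<sigma> (f \<sigma> v) = v"
      "\<And>\<sigma> v. v \<in> fin_space (stalk_dim G \<sigma>) \<Longrightarrow> f \<sigma> (g \<sigma> v) = v"
    unfolding v_iso_def vsheaf_of_simps by blast
  let ?f = "nat_mat F G f" and ?g = "nat_mat G F g"
  have f': "f \<sigma> v \<in> fin_space (stalk_dim G \<sigma>)" if "v \<in> fin_space (stalk_dim F \<sigma>)" for \<sigma> v
    using v_naturalD(2)[OF f] that by simp
  have g': "g \<sigma> v \<in> fin_space (stalk_dim F \<sigma>)" if "v \<in> fin_space (stalk_dim G \<sigma>)" for \<sigma> v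
    using v_naturalD(2)[OF g] that by simp
  have "?g \<sigma> * ?f \<sigma> = 1\<^sub>m (stalk_dim F \<sigma>)" for \<sigma>
    by (rule app_eqI[of _ "stalk_dim F \<sigma>" "stalk_dim F \<sigma>"])
       (auto simp: app_mult[OF mat_of_carrier mat_of_carrier] natural_nat_mat(2)[OF F G f] natural_nat_mat(2)[OF G F g]
         f' inv app_one intro: mult_carrier_mat[OF mat_of_carrier mat_of_carrier])
  moreover have "?f \<sigma> * ?g \<sigma> = 1\<^sub>m (stalk_dim G \<sigma>)" for \<sigma>
    by (rule app_eqI[of _ "stalk_dim G \<sigma>" "stalk_dim G \<sigma>"])
       (auto simp: app_mult[OF mat_of_carrier mat_of_carrier] natural_nat_mat(2)[OF F G f] natural_nat_mat(2)[OF G F g]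
         g' inv app_one intro: mult_carrier_mat[OF mat_of_carrier mat_of_carrier])
  ultimately show "sheaf_iso F G"
    using natural_nat_mat(1)[OF F G f] natural_nat_mat(1)[OF G F g] unfolding sheaf_iso_def by blast
qed

definition vcomplex_of :: "('p, 'k::field) complex_data \<Rightarrow> ('p, nat \<Rightarrow> 'k) vcomplex" where
  "vcomplex_of K = \<lparr> vobj = \<lambda>d. vsheaf_of (obj K d), vdif = \<lambda>d \<sigma>. app (dif K d \<sigma>) \<rparr>"

lemma vcomplex_of_simps [simp]:
  "vobj (vcomplex_of K) d = vsheaf_of (obj K d)" "vdif (vcomplex_of K) d = (\<lambda>\<sigma>. app (dif K d \<sigma>))"
  by (simp_all add: vcomplex_of_def)

lemma sheaf_complexD:
  assumes "sheaf_complex K"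
  shows "sheaf (obj K d)" "natural (obj K d) (obj K (d + 1)) (dif K d)"
    "dif K (d + 1) \<sigma> * dif K d \<sigma> = 0\<^sub>m (stalk_dim (obj K (d + 2)) \<sigma>) (stalk_dim (obj K d) \<sigma>)"
  using assms unfolding sheaf_complex_def by auto

lemma sheaf_complex_iff:
  "sheaf_complex K \<longleftrightarrow> (\<forall>d. sheaf (obj K d)) \<and>
     (\<forall>d \<sigma>. dif K d \<sigma> \<in> carrier_mat (stalk_dim (obj K (d + 1)) \<sigma>) (stalk_dim (obj K d) \<sigma>)) \<and>
     is_vcomplex (vcomplex_of K)"
proof (intro iffI conjI)
  assume K: "sheaf_complex K"
  note s = sheaf_complexD(1)[OF K] and n = sheaf_complexD(2)[OF K]
  note c = naturalD(1)[OF n]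
  show "\<forall>d. sheaf (obj K d)"
    "\<forall>d \<sigma>. dif K d \<sigma> \<in> carrier_mat (stalk_dim (obj K (d + 1)) \<sigma>) (stalk_dim (obj K d) \<sigma>)"
    using s c by auto
  have "app (dif K (d + 1) \<sigma>) (app (dif K d \<sigma>) v) = 0" for d \<sigma> v
    using app_mult[OF c[of "d + 1"] c[of d], of \<sigma> v] by (simp add: sheaf_complexD(3)[OF K] app_zero)
  then show "is_vcomplex (vcomplex_of K)"
    using n s by (simp add: is_vcomplex_def is_vsheaf_of natural_iff_v_natural)
next
  assume *: "(\<forall>d. sheaf (obj K d)) \<and>
     (\<forall>d \<sigma>. dif K d \<sigma> \<in> carrier_mat (stalk_dim (obj K (d + 1)) \<sigma>) (stalk_dim (obj K d) \<sigma>)) \<and>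
     is_vcomplex (vcomplex_of K)"
  then have s: "\<And>d. sheaf (obj K d)" and V: "is_vcomplex (vcomplex_of K)"
    and c: "\<And>d \<sigma>. dif K d \<sigma> \<in> carrier_mat (stalk_dim (obj K (d + 1)) \<sigma>) (stalk_dim (obj K d) \<sigma>)" by auto
  have c2: "dif K (d + 1) \<sigma> \<in> carrier_mat (stalk_dim (obj K (d + 2)) \<sigma>) (stalk_dim (obj K (d + 1)) \<sigma>)" for d \<sigma>
    using c[of "d + 1" \<sigma>] by (simp add: add.assoc)
  have "dif K (d + 1) \<sigma> * dif K d \<sigma> = 0\<^sub>m (stalk_dim (obj K (d + 2)) \<sigma>) (stalk_dim (obj K d) \<sigma>)" for d \<sigma>
    using is_vcomplexD(4)[OF V, of _ d \<sigma>] mult_carrier_mat[OF c2 c]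
    by (intro app_eqI[of _ "stalk_dim (obj K (d + 2)) \<sigma>" "stalk_dim (obj K d) \<sigma>"]) (auto simp: app_mult[OF c2 c] app_zero)
  then show "sheaf_complex K"
    using s c is_vcomplexD(2)[OF V] by (simp add: sheaf_complex_def natural_iff_v_natural[OF s s])
qed

lemma is_vcomplex_of: "sheaf_complex K \<Longrightarrow> is_vcomplex (vcomplex_of K)"
  by (simp add: sheaf_complex_iff)

lemma chain_map_iff_v_chain:
  assumes K: "sheaf_complex K" and L: "sheaf_complex L"
  shows "chain_map K L f \<longleftrightarrow>
    (\<forall>d \<sigma>. f d \<sigma> \<in> carrier_mat (stalk_dim (obj L d) \<sigma>) (stalk_dim (obj K d) \<sigma>)) \<and>
    v_chain (vcomplex_of K) (vcomplex_of L) (\<lambda>d \<sigma>. app (f d \<sigma>))" (is "_ \<longleftrightarrow> ?c \<and> ?v")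
proof -
  note Kc = naturalD(1)[OF sheaf_complexD(2)[OF K]] and Lc = naturalD(1)[OF sheaf_complexD(2)[OF L]]
  have "f (d + 1) \<sigma> * dif K d \<sigma> = dif L d \<sigma> * f d \<sigma> \<longleftrightarrow>
      (\<forall>v\<in>fin_space (stalk_dim (obj K d) \<sigma>). app (f (d + 1) \<sigma>) (app (dif K d \<sigma>) v) = app (dif L d \<sigma>) (app (f d \<sigma>) v))"
    if ?c for d \<sigma>
  proof -
    have c: "f d \<sigma> \<in> carrier_mat (stalk_dim (obj L d) \<sigma>) (stalk_dim (obj K d) \<sigma>)"
      "f (d + 1) \<sigma> \<in> carrier_mat (stalk_dim (obj L (d + 1)) \<sigma>) (stalk_dim (obj K (d + 1)) \<sigma>)"
      using that by auto
    show ?thesis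
      using app_eqI[OF mult_carrier_mat[OF c(2) Kc] mult_carrier_mat[OF Lc c(1)]]
      by (metis app_mult[OF c(2) Kc] app_mult[OF Lc c(1)])
  qed
  then show ?thesis
    unfolding chain_map_def v_chain_def
    by (auto simp: natural_iff_v_natural[OF sheaf_complexD(1)[OF K] sheaf_complexD(1)[OF L]])
qed

text \<open>Since \<open>f\<close> respects the relations, the class of \<open>a\<close> goes to the
  class of \<open>f a\<close> whatever the representative, and bijectivity on classes can be tested
  on elements.\<close>

lemma bij_betw_quotient_map:
  assumes A: "equiv A r" and B: "equiv B s" and f: "\<And>x y. (x, y) \<in> r \<Longrightarrow> (f x, f y) \<in> s"
  shows "bij_betw (\<lambda>X. s `` (f ` X)) (A // r) (B // s) \<longleftrightarrow>
    (\<forall>x\<in>A. \<forall>y\<in>A. (f x, f y) \<in> s \<longrightarrow> (x, y) \<in> r) \<and> (\<forall>b\<in>B. \<exists>a\<in>A. (b, f a) \<in> s)"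
proof -
  let ?m = "\<lambda>X. s `` (f ` X)"
  have fB: "f a \<in> B" if "a \<in> A" for a
    using f[of a a] that A B by (auto simp: equiv_def refl_on_def)
  have m: "?m (r `` {a}) = s `` {f a}" if a: "a \<in> A" for a
  proof -
    have "a \<in> r `` {a}" using A a by (rule equiv_class_self)
    moreover have "s `` {f x} = s `` {f a}" if "x \<in> r `` {a}" for x
      using equiv_class_eq[OF B f] that by auto
    ultimately show ?thesis by blast
  qed
  have "inj_on ?m (A // r) \<longleftrightarrow> (\<forall>x\<in>A. \<forall>y\<in>A. (f x, f y) \<in> s \<longrightarrow> (x, y) \<in> r)"
    unfolding inj_on_def quotient_def
    using m fB by (auto simp: eq_equiv_class_iff[OF A] eq_equiv_class_iff[OF B])
  moreover have "?m ` (A // r) = (\<lambda>a. s `` {f a}) ` A"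
    using m by (auto simp: quotient_def image_iff)
  moreover have "(\<lambda>a. s `` {f a}) ` A = B // s \<longleftrightarrow> (\<forall>b\<in>B. \<exists>a\<in>A. (b, f a) \<in> s)"
  proof -
    have "(\<lambda>a. s `` {f a}) ` A \<subseteq> B // s"
      using fB by (auto simp: quotient_def)
    moreover have "B // s \<subseteq> (\<lambda>a. s `` {f a}) ` A \<longleftrightarrow> (\<forall>b\<in>B. \<exists>a\<in>A. s `` {b} = s `` {f a})"
      by (auto simp: quotient_def)
    moreover have "\<dots> \<longleftrightarrow> (\<forall>b\<in>B. \<exists>a\<in>A. (b, f a) \<in> s)"
      using fB by (auto simp: eq_equiv_class_iff[OF B])
    ultimately show ?thesis by blast
  qed
  ultimately show ?thesis
    unfolding bij_betw_def by simp
qed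

lemma vec_app: "A \<in> carrier_mat m n \<Longrightarrow> A *\<^sub>v vec n v = vec m (app A v)"
  by (auto simp: app_def scalar_prod_def atLeast0LessThan intro!: eq_vecI sum.cong)

lemma vec_fin_space_inject:
  assumes "v \<in> fin_space n" "w \<in> fin_space n" "vec n v = vec n w"
  shows "v = w"
proof
  fix i
  show "v i = w i"
    using arg_cong[OF assms(3), of "\<lambda>x. x $ i"] assms(1,2)
    by (cases "i < n") (auto simp: fin_space_def)
qed

lemma carrier_vec_eq_image: "carrier_vec n = vec n ` fin_space n"
proof (intro equalityI subsetI)
  fix u :: "'a vec" assume u: "u \<in> carrier_vec n"
  then have "u = vec n (\<lambda>i. if i < n then u $ i else 0)" by auto
  moreover have "(\<lambda>i. if i < n then u $ i else 0) \<in> fin_space n" by (simp add: fin_space_def)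
  ultimately show "u \<in> vec n ` fin_space n" by blast
qed auto

lemma vec_eq_zero_iff:
  assumes v: "v \<in> fin_space n"
  shows "vec n v = 0\<^sub>v n \<longleftrightarrow> v = 0"
proof
  assume "vec n v = 0\<^sub>v n"
  then have "vec n v = vec n 0" by (auto intro: eq_vecI)
  from vec_fin_space_inject[OF v _ this] show "v = 0"
    by (simp add: fin_space_def)
qed (auto intro: eq_vecI)

abbreviation cdim :: "('p, 'k) complex_data \<Rightarrow> 'p \<Rightarrow> int \<Rightarrow> nat" where
  "cdim C \<sigma> e \<equiv> stalk_dim (obj C e) \<sigma>"

context
  fixes C :: "('p::order, 'k::field) complex_data" and d :: int and \<sigma> :: 'p
  assumes C: "sheaf_complex C"
begin

lemma dif_carrier:
  shows "dif C d \<sigma> \<in> carrier_mat (cdim C \<sigma> (d + 1)) (cdim C \<sigma> d)"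
    and "dif C (d - 1) \<sigma> \<in> carrier_mat (cdim C \<sigma> d) (cdim C \<sigma> (d - 1))"
  using naturalD(1)[OF sheaf_complexD(2)[OF C], of d \<sigma>]
    naturalD(1)[OF sheaf_complexD(2)[OF C], of "d - 1" \<sigma>] by simp_all

lemma cocycles_eq: "cocycles C d \<sigma> = vec (cdim C \<sigma> d) ` {u \<in> cstalk (vcomplex_of C) d \<sigma>. app (dif C d \<sigma>) u = 0}"
  unfolding cocycles_def mat_kernel[OF dif_carrier(1)] carrier_vec_eq_image
  by (auto simp: vec_app[OF dif_carrier(1)] vec_eq_zero_iff[OF app_fin_space[OF dif_carrier(1)]])

lemma coboundaries_eq: "coboundaries C d \<sigma> = vec (cdim C \<sigma> d) ` app (dif C (d - 1) \<sigma>) ` fin_space (cdim C \<sigma> (d - 1))"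
  unfolding coboundaries_def carrier_vec_eq_image image_image vec_app[OF dif_carrier(2)] ..

lemma cohomologous_iff:
  assumes xy: "x \<in> cstalk (vcomplex_of C) d \<sigma>" "app (dif C d \<sigma>) x = 0"
    "y \<in> cstalk (vcomplex_of C) d \<sigma>" "app (dif C d \<sigma>) y = 0"
  shows "(vec (cdim C \<sigma> d) x, vec (cdim C \<sigma> d) y) \<in> cohomologous C d \<sigma> \<longleftrightarrow>
    (\<exists>w\<in>fin_space (cdim C \<sigma> (d - 1)). x - y = app (dif C (d - 1) \<sigma>) w)"
proof -
  have m: "vec (cdim C \<sigma> d) x - vec (cdim C \<sigma> d) y = vec (cdim C \<sigma> d) (x - y)" by (intro eq_vecI) auto
  have "x - y \<in> fin_space (cdim C \<sigma> d)"
    using xy fun_space.subspace_diff[OF subspace_fin_space] by auto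
  then have "vec (cdim C \<sigma> d) (x - y) \<in> vec (cdim C \<sigma> d) ` app (dif C (d - 1) \<sigma>) ` fin_space (cdim C \<sigma> (d - 1)) \<longleftrightarrow>
      (\<exists>w\<in>fin_space (cdim C \<sigma> (d - 1)). x - y = app (dif C (d - 1) \<sigma>) w)"
    using vec_fin_space_inject[OF _ app_fin_space[OF dif_carrier(2)]] by (auto simp: image_iff)
  moreover have "vec (cdim C \<sigma> d) x \<in> cocycles C d \<sigma>" "vec (cdim C \<sigma> d) y \<in> cocycles C d \<sigma>"
    using xy by (auto simp: cocycles_eq)
  ultimately show ?thesis by (simp add: cohomologous_def m coboundaries_eq)
qed

lemma equiv_cohomologous: "equiv (cocycles C d \<sigma>) (cohomologous C d \<sigma>)"
proof (rule equivI)
  show "cohomologous C d \<sigma> \<subseteq> cocycles C d \<sigma> \<times> cocycles C d \<sigma>"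
    by (auto simp: cohomologous_def)
  note sub = subspace_fin_space and l = lin_map_simps[OF lin_map_app]
  show "refl_on (cocycles C d \<sigma>) (cohomologous C d \<sigma>)"
  proof (rule refl_onI)
    fix x assume "x \<in> cocycles C d \<sigma>"
    then show "(x, x) \<in> cohomologous C d \<sigma>"
      unfolding cocycles_eq using fun_space.subspace_0[OF sub] by (auto simp: cohomologous_iff l intro!: bexI[of _ 0])
  qed
  have sep: "\<exists>u. x = vec (cdim C \<sigma> d) u \<and> u \<in> cstalk (vcomplex_of C) d \<sigma> \<and> app (dif C d \<sigma>) u = 0"
    if "x \<in> cocycles C d \<sigma>" for x
    using that by (auto simp: cocycles_eq)
  have fld: "x \<in> cocycles C d \<sigma> \<and> y \<in> cocycles C d \<sigma>" if "(x, y) \<in> cohomologous C d \<sigma>" for x y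
    using that by (auto simp: cohomologous_def)
  show "sym (cohomologous C d \<sigma>)"
  proof (rule symI)
    fix x y assume xy: "(x, y) \<in> cohomologous C d \<sigma>"
    obtain u where u: "x = vec (cdim C \<sigma> d) u" "u \<in> cstalk (vcomplex_of C) d \<sigma>" "app (dif C d \<sigma>) u = 0"
      using sep[OF conjunct1[OF fld[OF xy]]] by metis
    obtain v where v: "y = vec (cdim C \<sigma> d) v" "v \<in> cstalk (vcomplex_of C) d \<sigma>" "app (dif C d \<sigma>) v = 0"
      using sep[OF conjunct2[OF fld[OF xy]]] by metis
    obtain w where w: "w \<in> fin_space (cdim C \<sigma> (d - 1))" "u - v = app (dif C (d - 1) \<sigma>) w"
      using xy unfolding u(1) v(1) cohomologous_iff[OF u(2,3) v(2,3)] by blast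
    have "v - u = - (u - v)" by (rule minus_diff_eq[symmetric])
    also have "\<dots> = app (dif C (d - 1) \<sigma>) (- w)"
      unfolding w(2) by (rule lin_map_neg[OF lin_map_app, symmetric])
    finally have "\<exists>w\<in>fin_space (cdim C \<sigma> (d - 1)). v - u = app (dif C (d - 1) \<sigma>) w"
      using fun_space.subspace_neg[OF sub w(1)] by blast
    then show "(y, x) \<in> cohomologous C d \<sigma>"
      unfolding u(1) v(1) cohomologous_iff[OF v(2,3) u(2,3)] by blast
  qed
  show "trans (cohomologous C d \<sigma>)"
  proof (rule transI)
    fix x y z assume xy: "(x, y) \<in> cohomologous C d \<sigma>" and yz: "(y, z) \<in> cohomologous C d \<sigma>"
    obtain u where u: "x = vec (cdim C \<sigma> d) u" "u \<in> cstalk (vcomplex_of C) d \<sigma>" "app (dif C d \<sigma>) u = 0"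
      using sep[OF conjunct1[OF fld[OF xy]]] by metis
    obtain v where v: "y = vec (cdim C \<sigma> d) v" "v \<in> cstalk (vcomplex_of C) d \<sigma>" "app (dif C d \<sigma>) v = 0"
      using sep[OF conjunct2[OF fld[OF xy]]] by metis
    obtain t where t: "z = vec (cdim C \<sigma> d) t" "t \<in> cstalk (vcomplex_of C) d \<sigma>" "app (dif C d \<sigma>) t = 0"
      using sep[OF conjunct2[OF fld[OF yz]]] by metis
    obtain w where w: "w \<in> fin_space (cdim C \<sigma> (d - 1))" "u - v = app (dif C (d - 1) \<sigma>) w"
      using xy unfolding u(1) v(1) cohomologous_iff[OF u(2,3) v(2,3)] by blast
    obtain w' where w': "w' \<in> fin_space (cdim C \<sigma> (d - 1))" "v - t = app (dif C (d - 1) \<sigma>) w'"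
      using yz unfolding v(1) t(1) cohomologous_iff[OF v(2,3) t(2,3)] by blast
    have "u - t = (u - v) + (v - t)" by simp
    also have "\<dots> = app (dif C (d - 1) \<sigma>) (w + w')"
      unfolding w(2) w'(2) by (rule lin_map_add[OF lin_map_app, symmetric])
    finally have "\<exists>w\<in>fin_space (cdim C \<sigma> (d - 1)). u - t = app (dif C (d - 1) \<sigma>) w"
      using fun_space.subspace_add[OF sub w(1) w'(1)] by blast
    then show "(x, z) \<in> cohomologous C d \<sigma>"
      unfolding u(1) t(1) cohomologous_iff[OF u(2,3) t(2,3)] by blast
  qed
qed

end

text \<open>\<open>bij_betw_quotient_map\<close> turns bijectivity on cohomology classes into
  statements about cocycles, and linearity brings these into the form of
  \<open>v_quasi_iso\<close>.\<close>

lemma quasi_iso_iff_v_quasi_iso: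
  assumes K: "sheaf_complex K" and L: "sheaf_complex L"
  shows "quasi_iso K L f \<longleftrightarrow> chain_map K L f \<and> v_quasi_iso (vcomplex_of K) (vcomplex_of L) (\<lambda>d \<sigma>. app (f d \<sigma>))"
proof -
  have *: "bij_betw (cohomology_map L f d \<sigma>) (cohomology K d \<sigma>) (cohomology L d \<sigma>) \<longleftrightarrow>
     (\<forall>u w. u \<in> cstalk (vcomplex_of K) d \<sigma> \<longrightarrow> app (dif K d \<sigma>) u = 0 \<longrightarrow> w \<in> cstalk (vcomplex_of L) (d - 1) \<sigma> \<longrightarrow>
        app (f d \<sigma>) u = app (dif L (d - 1) \<sigma>) w \<longrightarrow>
        (\<exists>x\<in>cstalk (vcomplex_of K) (d - 1) \<sigma>. u = app (dif K (d - 1) \<sigma>) x)) \<and>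
     (\<forall>z. z \<in> cstalk (vcomplex_of L) d \<sigma> \<longrightarrow> app (dif L d \<sigma>) z = 0 \<longrightarrow>
        (\<exists>u\<in>cstalk (vcomplex_of K) d \<sigma>. \<exists>w\<in>cstalk (vcomplex_of L) (d - 1) \<sigma>.
           app (dif K d \<sigma>) u = 0 \<and> z = app (f d \<sigma>) u + app (dif L (d - 1) \<sigma>) w))" (is "_ \<longleftrightarrow> ?inj \<and> ?surj")
    if f: "chain_map K L f" for d \<sigma>
  proof -
    define VK VL where "VK = {u \<in> cstalk (vcomplex_of K) d \<sigma>. app (dif K d \<sigma>) u = 0}"
      and "VL = {u \<in> cstalk (vcomplex_of L) d \<sigma>. app (dif L d \<sigma>) u = 0}"
    note fv = f[unfolded chain_map_iff_v_chain[OF K L]]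
    have fc: "f d \<sigma> \<in> carrier_mat (cdim L \<sigma> d) (cdim K \<sigma> d)" using fv by simp
    note fD = v_chainD[OF conjunct2[OF fv]]
    note l = lin_map_simps[OF lin_map_app]
    have fVL: "app (f d \<sigma>) u \<in> cstalk (vcomplex_of L) d \<sigma>" "app (dif L d \<sigma>) (app (f d \<sigma>) u) = 0"
      if "u \<in> cstalk (vcomplex_of K) d \<sigma>" "app (dif K d \<sigma>) u = 0" for u
      using fD(5)[OF that(1)] fD(2)[OF that(1)] that(2) by (auto simp: l)
    have pres: "(f d \<sigma> *\<^sub>v x, f d \<sigma> *\<^sub>v y) \<in> cohomologous L d \<sigma>" if xy: "(x, y) \<in> cohomologous K d \<sigma>" for x y
    proof -
      have "x \<in> cocycles K d \<sigma>" "y \<in> cocycles K d \<sigma>" using xy by (auto simp: cohomologous_def)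
      then obtain u v where u: "x = vec (cdim K \<sigma> d) u" "u \<in> cstalk (vcomplex_of K) d \<sigma>" "app (dif K d \<sigma>) u = 0"
        and v: "y = vec (cdim K \<sigma> d) v" "v \<in> cstalk (vcomplex_of K) d \<sigma>" "app (dif K d \<sigma>) v = 0"
        unfolding cocycles_eq[OF K] by blast
      obtain w where w: "w \<in> fin_space (cdim K \<sigma> (d - 1))" "u - v = app (dif K (d - 1) \<sigma>) w"
        using xy cohomologous_iff[OF K u(2,3) v(2,3)] u(1) v(1) by auto
      have "app (f d \<sigma>) u - app (f d \<sigma>) v = app (dif L (d - 1) \<sigma>) (app (f (d - 1) \<sigma>) w)"
        using fD(3)[of w d \<sigma>] w by (simp flip: l)
      moreover have "app (f (d - 1) \<sigma>) w \<in> fin_space (cdim L \<sigma> (d - 1))"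
        using fD(5)[of w "d - 1" \<sigma>] w by simp
      ultimately show ?thesis
        using cohomologous_iff[OF L fVL[OF u(2,3)] fVL[OF v(2,3)]] by (auto simp: u(1) v(1) vec_app[OF fc])
    qed
    have e: "cohomology_map L f d \<sigma> = (\<lambda>X. cohomologous L d \<sigma> `` ((\<lambda>u. f d \<sigma> *\<^sub>v u) ` X))"
      by (simp add: cohomology_map_def fun_eq_iff)
    have "(\<forall>x\<in>cocycles K d \<sigma>. \<forall>y\<in>cocycles K d \<sigma>. (f d \<sigma> *\<^sub>v x, f d \<sigma> *\<^sub>v y) \<in> cohomologous L d \<sigma> \<longrightarrow>
       (x, y) \<in> cohomologous K d \<sigma>) \<longleftrightarrow> ?inj"
    proof -
      let ?V = "{u \<in> cstalk (vcomplex_of K) d \<sigma>. app (dif K d \<sigma>) u = 0}"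
      have sub: "u - v \<in> ?V" if "u \<in> ?V" "v \<in> ?V" for u v
        using that fun_space.subspace_diff[OF subspace_fin_space] by (auto simp: l)
      have z: "0 \<in> ?V" using fun_space.subspace_0[OF subspace_fin_space] by (simp add: l)
      have "(\<forall>x\<in>cocycles K d \<sigma>. \<forall>y\<in>cocycles K d \<sigma>. (f d \<sigma> *\<^sub>v x, f d \<sigma> *\<^sub>v y) \<in> cohomologous L d \<sigma> \<longrightarrow>
          (x, y) \<in> cohomologous K d \<sigma>) \<longleftrightarrow>
        (\<forall>u\<in>?V. \<forall>v\<in>?V. (\<exists>w\<in>fin_space (cdim L \<sigma> (d - 1)). app (f d \<sigma>) u - app (f d \<sigma>) v = app (dif L (d - 1) \<sigma>) w) \<longrightarrow>
          (\<exists>w\<in>fin_space (cdim K \<sigma> (d - 1)). u - v = app (dif K (d - 1) \<sigma>) w))"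
        unfolding cocycles_eq[OF K] ball_simps by (simp add: vec_app[OF fc] cohomologous_iff[OF K] cohomologous_iff[OF L] fVL[simplified])
      \<comment> \<open>Two classes agree iff their difference is the zero class, so injectivity
        need only be tested against zero.\<close>
      also have "\<dots> \<longleftrightarrow>
        (\<forall>u\<in>?V. (\<exists>w\<in>fin_space (cdim L \<sigma> (d - 1)). app (f d \<sigma>) u = app (dif L (d - 1) \<sigma>) w) \<longrightarrow>
          (\<exists>w\<in>fin_space (cdim K \<sigma> (d - 1)). u = app (dif K (d - 1) \<sigma>) w))" (is "?a \<longleftrightarrow> ?b")
      proof
        show ?b if ?a
        proof
          fix u assume "u \<in> ?V"
          from bspec[OF bspec[OF \<open>?a\<close> this] z]
          show "(\<exists>w\<in>fin_space (cdim L \<sigma> (d - 1)). app (f d \<sigma>) u = app (dif L (d - 1) \<sigma>) w) \<longrightarrow>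
            (\<exists>w\<in>fin_space (cdim K \<sigma> (d - 1)). u = app (dif K (d - 1) \<sigma>) w)" by (simp add: l)
        qed
        show ?a if ?b
        proof (intro ballI)
          fix u v assume "u \<in> ?V" "v \<in> ?V"
          from bspec[OF \<open>?b\<close> sub[OF this]]
          show "(\<exists>w\<in>fin_space (cdim L \<sigma> (d - 1)). app (f d \<sigma>) u - app (f d \<sigma>) v = app (dif L (d - 1) \<sigma>) w) \<longrightarrow>
            (\<exists>w\<in>fin_space (cdim K \<sigma> (d - 1)). u - v = app (dif K (d - 1) \<sigma>) w)" by (simp add: l)
        qed
      qed
      also have "\<dots> \<longleftrightarrow> ?inj" by auto
      finally show ?thesis .
    qed
    moreover have "(\<forall>z\<in>cocycles L d \<sigma>. \<exists>u\<in>cocycles K d \<sigma>. (z, f d \<sigma> *\<^sub>v u) \<in> cohomologous L d \<sigma>) \<longleftrightarrow> ?surj"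
    proof -
      have r: "(vec (cdim L \<sigma> d) z, f d \<sigma> *\<^sub>v vec (cdim K \<sigma> d) u) \<in> cohomologous L d \<sigma> \<longleftrightarrow>
          (\<exists>w\<in>fin_space (cdim L \<sigma> (d - 1)). z - app (f d \<sigma>) u = app (dif L (d - 1) \<sigma>) w)"
        if "z \<in> VL" "u \<in> VK" for z u
        using that fVL[of u] unfolding vec_app[OF fc] VK_def VL_def by (intro cohomologous_iff[OF L]) auto
      have shift: "z - a = b \<longleftrightarrow> z = a + b" for z a b :: "nat \<Rightarrow> 'b"
        by (metis add.commute diff_eq_eq)
      have "(\<forall>z\<in>cocycles L d \<sigma>. \<exists>u\<in>cocycles K d \<sigma>. (z, f d \<sigma> *\<^sub>v u) \<in> cohomologous L d \<sigma>) \<longleftrightarrow>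
        (\<forall>z\<in>VL. \<exists>u\<in>VK. \<exists>w\<in>fin_space (cdim L \<sigma> (d - 1)). z - app (f d \<sigma>) u = app (dif L (d - 1) \<sigma>) w)"
        unfolding cocycles_eq[OF K] cocycles_eq[OF L] VK_def[symmetric] VL_def[symmetric]
        by (simp add: r)
      also have "\<dots> \<longleftrightarrow> ?surj"
        unfolding VK_def VL_def shift by simp blast
      finally show ?thesis .
    qed
    ultimately show ?thesis
      unfolding e cohomology_def using bij_betw_quotient_map[OF equiv_cohomologous[OF K] equiv_cohomologous[OF L] pres] by simp
  qed
  show ?thesis
  proof (cases "chain_map K L f")
    case True
    then have "v_chain (vcomplex_of K) (vcomplex_of L) (\<lambda>d \<sigma>. app (f d \<sigma>))"
      using chain_map_iff_v_chain[OF K L] by blast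
    with True show ?thesis
      unfolding quasi_iso_def v_quasi_iso_def vcomplex_of_simps(2) *[OF True]
      by (simp only: all_conj_distrib simp_thms)
  qed (simp add: quasi_iso_def)
qed

text \<open>The matrices of \<open>f\<close> act like \<open>f\<close> on the stalks, and the
  conditions on cohomology involve only values there.\<close>

lemma quasi_iso_of_v_quasi_iso:
  assumes K: "sheaf_complex K" and L: "sheaf_complex L"
    and f: "v_quasi_iso (vcomplex_of K) (vcomplex_of L) f"
  shows "\<exists>\<phi>. quasi_iso K L \<phi>"
proof -
  define \<phi> where "\<phi> d = nat_mat (obj K d) (obj L d) (f d)" for d
  note s = sheaf_complexD(1)
  note fc = v_chainD[OF v_quasi_isoD(1)[OF f], unfolded vcomplex_of_simps]
  have \<phi>: "natural (obj K d) (obj L d) (\<phi> d)" for d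
    unfolding \<phi>_def by (rule natural_nat_mat(1)[OF s[OF K] s[OF L] fc(1)])
  have eq: "app (\<phi> d \<sigma>) v = f d \<sigma> v" if "v \<in> fin_space (stalk_dim (obj K d) \<sigma>)" for d \<sigma> v
    unfolding \<phi>_def by (rule natural_nat_mat(2)[OF s[OF K] s[OF L] fc(1) that])
  have v: "v_chain (vcomplex_of K) (vcomplex_of L) (\<lambda>d \<sigma>. app (\<phi> d \<sigma>))"
    unfolding v_chain_def vcomplex_of_simps vsheaf_of_simps
  proof (intro conjI allI impI)
    show "v_natural (vsheaf_of (obj K d)) (vsheaf_of (obj L d)) (\<lambda>\<sigma>. app (\<phi> d \<sigma>))" for d
      using \<phi> natural_iff_v_natural[OF s[OF K] s[OF L]] by blast
    fix d \<sigma> and v :: "nat \<Rightarrow> 'b" assume v: "v \<in> fin_space (stalk_dim (obj K d) \<sigma>)"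
    have "app (\<phi> (d + 1) \<sigma>) (app (dif K d \<sigma>) v) = f (d + 1) \<sigma> (app (dif K d \<sigma>) v)"
      by (rule eq[OF app_fin_space[OF naturalD(1)[OF sheaf_complexD(2)[OF K]]]])
    also have "\<dots> = app (dif L d \<sigma>) (app (\<phi> d \<sigma>) v)"
      using fc(2)[of v d \<sigma>] v eq[OF v] by simp
    finally show "app (\<phi> (d + 1) \<sigma>) (app (dif K d \<sigma>) v) = app (dif L d \<sigma>) (app (\<phi> d \<sigma>) v)" .
  qed
  have "chain_map K L \<phi>"
    unfolding chain_map_iff_v_chain[OF K L] using v naturalD(1)[OF \<phi>] by blast
  moreover have "v_quasi_iso (vcomplex_of K) (vcomplex_of L) (\<lambda>d \<sigma>. app (\<phi> d \<sigma>))"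
    unfolding v_quasi_iso_def
  proof (intro conjI allI impI)
    fix d \<sigma> u w
    assume u: "u \<in> cstalk (vcomplex_of K) d \<sigma>" "vdif (vcomplex_of K) d \<sigma> u = 0"
      and w: "w \<in> cstalk (vcomplex_of L) (d - 1) \<sigma>" "app (\<phi> d \<sigma>) u = vdif (vcomplex_of L) (d - 1) \<sigma> w"
    have "f d \<sigma> u = vdif (vcomplex_of L) (d - 1) \<sigma> w"
      using eq[of u d \<sigma>] u(1) w(2) by simp
    then show "\<exists>x\<in>cstalk (vcomplex_of K) (d - 1) \<sigma>. u = vdif (vcomplex_of K) (d - 1) \<sigma> x"
      using v_quasi_isoD(2)[OF f, OF u w(1)] by blast
  next
    fix d \<sigma> z
    assume z: "z \<in> cstalk (vcomplex_of L) d \<sigma>" "vdif (vcomplex_of L) d \<sigma> z = 0"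
    from v_quasi_isoD(3)[OF f, OF z] obtain u w where u: "u \<in> cstalk (vcomplex_of K) d \<sigma>"
      and w: "w \<in> cstalk (vcomplex_of L) (d - 1) \<sigma>"
      and uw: "vdif (vcomplex_of K) d \<sigma> u = 0" "z = f d \<sigma> u + vdif (vcomplex_of L) (d - 1) \<sigma> w" by blast
    have "app (\<phi> d \<sigma>) u = f d \<sigma> u"
      using eq[of u d \<sigma>] u by simp
    then show "\<exists>u\<in>cstalk (vcomplex_of K) d \<sigma>. \<exists>w\<in>cstalk (vcomplex_of L) (d - 1) \<sigma>.
        vdif (vcomplex_of K) d \<sigma> u = 0 \<and> z = app (\<phi> d \<sigma>) u + vdif (vcomplex_of L) (d - 1) \<sigma> w"
      using u w uw by metis
  qed (rule v)
  ultimately have "quasi_iso K L \<phi>"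
    by (simp add: quasi_iso_iff_v_quasi_iso[OF K L])
  then show ?thesis by blast
qed

section \<open>Labeled matrices as maps of injective sheaves\<close>

text \<open>\<open>direct_sum\<close> numbers the coordinates of a stalk consecutively, while
  \<open>pos_sheaf\<close> keeps list positions. A position \<open>i\<close> corresponds to its rank
  in the support, and the \<open>pick\<close> in \<open>compress\<close> inverts this rank.\<close>

definition expand :: "'p::order list \<Rightarrow> 'p \<Rightarrow> (nat \<Rightarrow> 'k::field) \<Rightarrow> nat \<Rightarrow> 'k" where
  "expand ls \<sigma> v =
     (\<lambda>i. if i \<in> pos_support ls \<sigma> then v (card {a \<in> pos_support ls \<sigma>. a < i}) else 0)"

definition compress :: "'p::order list \<Rightarrow> 'p \<Rightarrow> (nat \<Rightarrow> 'k::field) \<Rightarrow> nat \<Rightarrow> 'k" where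
  "compress ls \<sigma> c =
     (\<lambda>k. if k < card (pos_support ls \<sigma>) then c (pick (pos_support ls \<sigma>) k) else 0)"

lemma finite_pos_support [simp]: "finite (pos_support ls \<sigma>)"
  by (simp add: pos_support_def)

lemma pickI: "a \<in> T \<Longrightarrow> card {b \<in> T. b < a} = n \<Longrightarrow> pick T n = a"
  using pick_card_in_set by blast

lemma card_less_card: "finite S \<Longrightarrow> i \<in> S \<Longrightarrow> card {a \<in> S. a < i} < card S" for i :: nat
  by (rule psubset_card_mono) auto

lemma bij_betw_pick_card:
  assumes "finite T"
  shows "bij_betw (pick T) {..<card T} T"
  by (rule bij_betw_byWitness[where f' = "\<lambda>i. card {a \<in> T. a < i}"])
     (auto simp: card_pick_le pick_card_in_set pick_in_set_le card_less_card assms)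

lemma expand_compress: "expand ls \<sigma> (compress ls \<sigma> c) = mask_fun (pos_support ls \<sigma>) c"
  by (auto simp: expand_def compress_def fun_eq_iff card_less_card pick_card_in_set)

lemma compress_expand: "v \<in> fin_space (card (pos_support ls \<sigma>)) \<Longrightarrow> compress ls \<sigma> (expand ls \<sigma> v) = v"
  by (auto simp: expand_def compress_def fun_eq_iff fin_space_def pick_in_set_le card_pick_le)

lemma compress_mask: "compress ls \<sigma> (mask_fun (pos_support ls \<sigma>) c) = compress ls \<sigma> c"
  by (auto simp: compress_def fun_eq_iff pick_in_set_le)

lemma compress_fin_space: "compress ls \<sigma> c \<in> fin_space (card (pos_support ls \<sigma>))"
  by (auto simp: compress_def fin_space_def)

lemma expand_stalk: "expand ls \<sigma> v \<in> stalk (pos_sheaf ls) \<sigma>"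
  by (simp add: expand_def stalk_pos_sheaf)

lemma lin_map_expand_pos: "lin_map (expand ls \<sigma>)" and lin_map_compress: "lin_map (compress ls \<sigma>)"
  by (rule lin_mapI; auto simp: expand_def compress_def fun_eq_iff)+

lemma pos_support_Cons:
  "pos_support (p # ls) \<sigma> = (if \<sigma> \<le> p then insert 0 (Suc ` pos_support ls \<sigma>) else Suc ` pos_support ls \<sigma>)"
unfolding set_eq_iff
proof
  show "i \<in> pos_support (p # ls) \<sigma> \<longleftrightarrow>
      i \<in> (if \<sigma> \<le> p then insert 0 (Suc ` pos_support ls \<sigma>) else Suc ` pos_support ls \<sigma>)" for i
    by (cases i) (auto simp: pos_support_def)
qed

lemma card_pos_support_Cons:
  "card (pos_support (p # ls) \<sigma>) = (if \<sigma> \<le> p then 1 else 0) + card (pos_support ls \<sigma>)"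
  by (auto simp: pos_support_Cons card_insert_if card_image)

lemma card_less_Cons:
  "card {a \<in> pos_support (p # ls) \<sigma>. a < Suc i} =
     (if \<sigma> \<le> p then 1 else 0) + card {a \<in> pos_support ls \<sigma>. a < i}"
proof -
  have "{a \<in> pos_support (p # ls) \<sigma>. a < Suc i} =
      (if \<sigma> \<le> p then insert 0 (Suc ` {a \<in> pos_support ls \<sigma>. a < i}) else Suc ` {a \<in> pos_support ls \<sigma>. a < i})"
    by (auto simp: pos_support_Cons)
  then show ?thesis by (auto simp: card_insert_if card_image)
qed

lemma expand_Cons:
  "expand (p # ls) \<sigma> v 0 = (if \<sigma> \<le> p then v 0 else 0)"
  "expand (p # ls) \<sigma> v (Suc i) = expand ls \<sigma> (\<lambda>k. v ((if \<sigma> \<le> p then 1 else 0) + k)) i"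
proof -
  show "expand (p # ls) \<sigma> v (Suc i) = expand ls \<sigma> (\<lambda>k. v ((if \<sigma> \<le> p then 1 else 0) + k)) i"
    unfolding expand_def card_less_Cons by (auto simp: pos_support_Cons)
qed (auto simp: expand_def pos_support_Cons)

lemma pick_pos_support_Cons:
  assumes "k < card (pos_support ls \<sigma>)"
  shows "pick (pos_support (p # ls) \<sigma>) ((if \<sigma> \<le> p then 1 else 0) + k) = Suc (pick (pos_support ls \<sigma>) k)"
proof (rule pickI)
  show "Suc (pick (pos_support ls \<sigma>) k) \<in> pos_support (p # ls) \<sigma>"
    using pick_in_set_le[OF assms] by (auto simp: pos_support_Cons)
  show "card {b \<in> pos_support (p # ls) \<sigma>. b < Suc (pick (pos_support ls \<sigma>) k)} = (if \<sigma> \<le> p then 1 else 0) + k"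
    unfolding card_less_Cons by (simp add: card_pick_le[OF assms])
qed

lemma compress_Cons:
  "\<sigma> \<le> p \<Longrightarrow> compress (p # ls) \<sigma> c 0 = c 0"
  "compress (p # ls) \<sigma> c ((if \<sigma> \<le> p then 1 else 0) + k) = compress ls \<sigma> (\<lambda>i. c (Suc i)) k"
proof -
  show "compress (p # ls) \<sigma> c 0 = c 0" if "\<sigma> \<le> p"
  proof -
    have "pick (pos_support (p # ls) \<sigma>) 0 = 0"
      using that by (intro pickI) (auto simp: pos_support_Cons)
    then show ?thesis using that by (simp add: compress_def card_pos_support_Cons)
  qed
  show "compress (p # ls) \<sigma> c ((if \<sigma> \<le> p then 1 else 0) + k) = compress ls \<sigma> (\<lambda>i. c (Suc i)) k"
    unfolding compress_def card_pos_support_Cons by (simp add: pick_pos_support_Cons del: pick.simps)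
qed

lemma app_four_block_diag:
  assumes "A \<in> carrier_mat m n" "D \<in> carrier_mat m' n'"
  shows "app (four_block_mat A (0\<^sub>m m n') (0\<^sub>m m' n) D) v i =
    (if i < m then app A v i else app D (\<lambda>j. v (n + j)) (i - m))"
proof -
  have "(\<Sum>j<n + n'. g j) = (\<Sum>j<n. g j) + (\<Sum>j<n'. g (n + j))" for g :: "nat \<Rightarrow> 'a"
    by (induction n') (simp_all add: add.assoc)
  then show ?thesis
    using assms by (auto simp: app_def)
qed

lemma res_direct_sum_Cons:
  assumes "res F \<sigma> \<tau> \<in> carrier_mat m n" "res (direct_sum Fs) \<sigma> \<tau> \<in> carrier_mat m' n'"
  shows "res (direct_sum (F # Fs)) \<sigma> \<tau> =
      four_block_mat (res F \<sigma> \<tau>) (0\<^sub>m m n') (0\<^sub>m m' n) (res (direct_sum Fs) \<sigma> \<tau>)"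
    and "res (direct_sum (F # Fs)) \<sigma> \<tau> \<in> carrier_mat (m + m') (n + n')"
proof -
  show *: "res (direct_sum (F # Fs)) \<sigma> \<tau> =
      four_block_mat (res F \<sigma> \<tau>) (0\<^sub>m m n') (0\<^sub>m m' n) (res (direct_sum Fs) \<sigma> \<tau>)"
    using carrier_matD[OF assms(1)] carrier_matD[OF assms(2)] by (simp add: direct_sum_def Let_def)
  show "res (direct_sum (F # Fs)) \<sigma> \<tau> \<in> carrier_mat (m + m') (n + n')"
    unfolding * using assms by (rule four_block_carrier_mat)
qed

abbreviation inj_sum :: "'p::order list \<Rightarrow> ('p, 'k::field) sheaf_data" where
  "inj_sum ls \<equiv> direct_sum (map elem_sheaf ls)"

lemma stalk_dim_inj_sum [simp]: "stalk_dim (inj_sum ls) \<sigma> = card (pos_support ls \<sigma>)"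
  by (induction ls) (simp_all add: direct_sum_def elem_sheaf_def card_pos_support_Cons, simp add: pos_support_def)

lemma res_elem_carrier:
  "\<sigma> \<le> \<tau> \<Longrightarrow> res (elem_sheaf p) \<sigma> \<tau> \<in> carrier_mat (if \<tau> \<le> p then 1 else 0) (if \<sigma> \<le> p then 1 else 0)"
  using order.trans[of \<sigma> \<tau> p] by (auto simp: elem_sheaf_def)

lemma res_inj_sum_carrier:
  assumes "\<sigma> \<le> \<tau>"
  shows "res (inj_sum ls) \<sigma> \<tau> \<in> carrier_mat (card (pos_support ls \<tau>)) (card (pos_support ls \<sigma>))"
proof (induction ls)
  case Nil
  then show ?case by (simp add: direct_sum_def pos_support_def)
next
  case (Cons p ls)
  then show ?case
    using res_direct_sum_Cons(2)[OF res_elem_carrier[OF assms, of p] Cons.IH]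
    by (simp only: list.map card_pos_support_Cons)
qed

text \<open>In list positions the block diagonal restriction just drops coordinates. The induction
  follows the head block, which is 1 by 1, 0 by 1 or 0 by 0 according to whether \<tau> \<le> p,
  only \<sigma> \<le> p, or neither holds.\<close>

lemma app_res_inj_sum:
  assumes "\<sigma> \<le> \<tau>"
  shows "app (res (inj_sum ls) \<sigma> \<tau>) v = compress ls \<tau> (expand ls \<sigma> v)"
proof (induction ls arbitrary: v)
  case Nil
  then show ?case by (simp add: direct_sum_def pos_support_def app_def compress_def)
next
  case (Cons p ls)
  let ?R = "res (inj_sum ls) \<sigma> \<tau>"
  let ?m = "if \<tau> \<le> p then 1 else 0 :: nat" and ?n = "if \<sigma> \<le> p then 1 else 0 :: nat"
  note cR = res_inj_sum_carrier[OF assms, of ls] and cE = res_elem_carrier[OF assms, of p]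
  have R: "res (inj_sum (p # ls)) \<sigma> \<tau> = four_block_mat (res (elem_sheaf p) \<sigma> \<tau>)
      (0\<^sub>m ?m (card (pos_support ls \<sigma>))) (0\<^sub>m (card (pos_support ls \<tau>)) ?n) ?R"
    using res_direct_sum_Cons(1)[OF cE cR] by simp
  show ?case
  proof
    fix i
    show "app (res (inj_sum (p # ls)) \<sigma> \<tau>) v i = compress (p # ls) \<tau> (expand (p # ls) \<sigma> v) i"
    proof (cases "i < ?m")
      case True
      then have le: "\<tau> \<le> p" "i = 0" by (auto split: if_splits)
      then have "\<sigma> \<le> p" using assms by simp
      then show ?thesis
        unfolding R app_four_block_diag[OF cE cR]
        using le by (simp add: compress_Cons(1) expand_Cons elem_sheaf_def app_def)
    next
      case False
      then have i: "i = ?m + (i - ?m)" by simp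
      have "compress (p # ls) \<tau> (expand (p # ls) \<sigma> v) i =
          compress ls \<tau> (\<lambda>k. expand (p # ls) \<sigma> v (Suc k)) (i - ?m)"
        by (subst i) (rule compress_Cons(2))
      also have "\<dots> = app ?R (\<lambda>k. v (?n + k)) (i - ?m)"
        unfolding expand_Cons(2) Cons.IH ..
      finally show ?thesis
        unfolding R app_four_block_diag[OF cE cR] using False by simp
    qed
  qed
qed

lemma v_natural_expand: "v_natural (vsheaf_of (inj_sum ls)) (pos_sheaf ls) (expand ls)"
  unfolding v_natural_def
  by (auto simp: lin_map_expand_pos expand_stalk app_res_inj_sum expand_compress rho_pos_sheaf)

lemma v_natural_compress: "v_natural (pos_sheaf ls) (vsheaf_of (inj_sum ls)) (compress ls)"
  unfolding v_natural_def
  by (auto simp: lin_map_compress compress_fin_space app_res_inj_sum expand_compress rho_pos_sheaf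
      mask_ident compress_mask)

lemma v_iso_inj_sum: "v_iso (vsheaf_of (inj_sum ls)) (pos_sheaf ls)"
  unfolding v_iso_def
  by (intro exI[of _ "expand ls"] exI[of _ "compress ls"])
     (auto simp: v_natural_expand v_natural_compress compress_expand expand_compress mask_ident)

lemma sheaf_inj_sum: "sheaf (inj_sum ls)"
proof (rule sheaf_ofI)
  show "is_vsheaf (vsheaf_of (inj_sum ls) :: ('a, nat \<Rightarrow> 'b) vsheaf)"
    unfolding is_vsheaf_def
  proof (intro conjI allI impI)
    fix \<pi> \<sigma> \<tau> :: 'a and v :: "nat \<Rightarrow> 'b" assume le: "\<pi> \<le> \<sigma>" "\<sigma> \<le> \<tau>"
    have "compress ls \<tau> (mask_fun (pos_support ls \<sigma>) (expand ls \<pi> v)) = compress ls \<tau> (expand ls \<pi> v)"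
      using pos_support_mono[OF le(2)] pick_in_set_le by (auto simp: compress_def fun_eq_iff)
    then show "rho (vsheaf_of (inj_sum ls)) \<sigma> \<tau> (rho (vsheaf_of (inj_sum ls)) \<pi> \<sigma> v) =
        rho (vsheaf_of (inj_sum ls)) \<pi> \<tau> v"
      using le order.trans[OF le] by (simp add: app_res_inj_sum expand_compress)
  qed (auto simp: subspace_fin_space lin_map_app app_res_inj_sum compress_fin_space compress_expand)
qed (simp add: res_inj_sum_carrier)

lemma injective_inj_sum: "injective_sheaf (inj_sum ls)"
proof -
  have "v_iso F F" for F :: "('a, nat \<Rightarrow> 'b) vsheaf"
    unfolding v_iso_def by (intro exI[of _ "\<lambda>_ v. v"]) (simp add: v_natural_id)
  then have "sheaf_iso (inj_sum ls :: ('a, 'b) sheaf_data) (inj_sum ls)"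
    by (simp add: sheaf_iso_iff_v_iso sheaf_inj_sum)
  then show ?thesis by (auto simp: injective_sheaf_def sheaf_inj_sum)
qed

text \<open>The mask matters: a column with label above \<sigma> may have nonzero entries in rows
  whose labels are not above \<sigma>. On the stalk at \<sigma> this is the action of the submatrix
  on \<open>St \<sigma>\<close> and \<open>St \<sigma>\<close>, written in list positions.\<close>

definition pos_map :: "'p::order list \<Rightarrow> 'k::field mat \<Rightarrow> 'p \<Rightarrow> (nat \<Rightarrow> 'k) \<Rightarrow> nat \<Rightarrow> 'k" where
  "pos_map rs M \<sigma> c = mask_fun (pos_support rs \<sigma>) (app M c)"

lemma labeled_matrixD:
  assumes "labeled_matrix rs cs M"
  shows "M \<in> carrier_mat (length rs) (length cs)"
    "i < length rs \<Longrightarrow> j < length cs \<Longrightarrow> M $$ (i, j) \<noteq> 0 \<Longrightarrow> rs ! i \<le> cs ! j"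
  using assms by (auto simp: labeled_matrix_def)

text \<open>If \<sigma> \<le> rs ! i and the entry at (i, j) is nonzero, then \<sigma> \<le> rs ! i
  \<le> cs ! j. Rows over \<sigma> thus see only columns over \<sigma>; naturality and composition
  of \<open>pos_map\<close> both rest on this.\<close>

lemma app_labeled_mask:
  assumes M: "labeled_matrix rs cs M" and i: "i \<in> pos_support rs \<sigma>"
  shows "app M (mask_fun (pos_support cs \<sigma>) c) i = app M c i"
proof -
  have "M $$ (i, j) * mask_fun (pos_support cs \<sigma>) c j = M $$ (i, j) * c j" if "j < length cs" for j
    using labeled_matrixD(2)[OF M, of i j] i that
    by (cases "M $$ (i, j) = 0") (auto simp: pos_support_def)
  then show ?thesis
    using labeled_matrixD(1)[OF M] by (auto simp: app_def intro!: sum.cong)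
qed

lemma pos_map_natural:
  assumes M: "labeled_matrix rs cs M"
  shows "v_natural (pos_sheaf cs) (pos_sheaf rs) (pos_map rs M)"
  unfolding v_natural_def
proof (intro conjI allI impI)
  fix \<sigma>
  show "lin_map (pos_map rs M \<sigma>)"
    unfolding pos_map_def by (rule lin_map_compose[OF lin_map_mask lin_map_app])
  show "pos_map rs M \<sigma> c \<in> stalk (pos_sheaf rs) \<sigma>" for c
    unfolding pos_map_def by (rule mask_stalk)
  fix \<tau> c assume le: "\<sigma> \<le> \<tau>"
  then show "pos_map rs M \<tau> (rho (pos_sheaf cs) \<sigma> \<tau> c) = rho (pos_sheaf rs) \<sigma> \<tau> (pos_map rs M \<sigma> c)"
    using app_labeled_mask[OF M] pos_support_mono[OF le]
    by (auto simp: pos_map_def rho_pos_sheaf fun_eq_iff)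
qed

lemma pos_map_comp:
  assumes N: "labeled_matrix qs rs N" and M: "labeled_matrix rs cs M"
  shows "pos_map qs N \<sigma> (pos_map rs M \<sigma> c) = pos_map qs (N * M) \<sigma> c"
  using app_labeled_mask[OF N]
  by (auto simp: pos_map_def fun_eq_iff app_mult[OF labeled_matrixD(1)[OF N] labeled_matrixD(1)[OF M]])

lemma app_labeled_submatrix:
  assumes M: "M \<in> carrier_mat (length rs) (length cs)"
  shows "app (labeled_submatrix rs cs M (St \<sigma>) (St \<sigma>)) v = compress rs \<sigma> (app M (expand cs \<sigma> v))"
    and "labeled_submatrix rs cs M (St \<sigma>) (St \<sigma>) \<in>
      carrier_mat (card (pos_support rs \<sigma>)) (card (pos_support cs \<sigma>))"
proof -
  let ?S = "pos_support rs \<sigma>" and ?T = "pos_support cs \<sigma>"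
  have sub: "labeled_submatrix rs cs M (St \<sigma>) (St \<sigma>) = submatrix M ?S ?T"
    by (simp add: labeled_submatrix_def pos_support_def)
  have S: "{i. i < dim_row M \<and> i \<in> ?S} = ?S" and T: "{j. j < dim_col M \<and> j \<in> ?T} = ?T"
    using M by (auto simp: pos_support_def)
  show c: "labeled_submatrix rs cs M (St \<sigma>) (St \<sigma>) \<in> carrier_mat (card ?S) (card ?T)"
    unfolding sub by (intro carrier_matI) (simp_all add: dim_submatrix S T)
  show "app (labeled_submatrix rs cs M (St \<sigma>) (St \<sigma>)) v = compress rs \<sigma> (app M (expand cs \<sigma> v))"
  proof
    fix k
    show "app (labeled_submatrix rs cs M (St \<sigma>) (St \<sigma>)) v k = compress rs \<sigma> (app M (expand cs \<sigma> v)) k"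
    proof (cases "k < card ?S")
      case True
      have bij: "bij_betw (pick ?T) {..<card ?T} ?T"
        by (rule bij_betw_pick_card) simp
      have "app (labeled_submatrix rs cs M (St \<sigma>) (St \<sigma>)) v k =
          (\<Sum>l<card ?T. M $$ (pick ?S k, pick ?T l) * v l)"
        using True c unfolding sub by (auto simp: app_def submatrix_index S T intro!: sum.cong)
      also have "\<dots> = (\<Sum>l<card ?T. M $$ (pick ?S k, pick ?T l) * expand cs \<sigma> v (pick ?T l))"
        by (intro sum.cong) (auto simp: expand_def card_pick_le pick_in_set_le)
      also have "\<dots> = (\<Sum>j\<in>?T. M $$ (pick ?S k, j) * expand cs \<sigma> v j)"
        by (rule sum.reindex_bij_betw[OF bij])
      also have "\<dots> = (\<Sum>j<length cs. M $$ (pick ?S k, j) * expand cs \<sigma> v j)"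
        by (rule sum.mono_neutral_left) (auto simp: pos_support_def expand_def)
      also have "\<dots> = compress rs \<sigma> (app M (expand cs \<sigma> v)) k"
        using True pick_in_set_le[OF True] M by (auto simp: compress_def app_def pos_support_def)
      finally show ?thesis .
    next
      case False
      then show ?thesis using c by (simp add: app_def compress_def)
    qed
  qed
qed

section \<open>Complexes of labeled matrices in list positions\<close>

definition pos_complex :: "('p::order, 'k::field) labeled_data \<Rightarrow> ('p, nat \<Rightarrow> 'k) vcomplex" where
  "pos_complex C =
     \<lparr> vobj = \<lambda>d. pos_sheaf (labels C d), vdif = \<lambda>d. pos_map (labels C (d + 1)) (mats C d) \<rparr>"

lemma pos_complex_simps [simp]:
  "vobj (pos_complex C) d = pos_sheaf (labels C d)"
  "vdif (pos_complex C) d = pos_map (labels C (d + 1)) (mats C d)"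
  by (simp_all add: pos_complex_def)

lemma labeled_complexD:
  assumes "labeled_complex n C"
  shows "d < 0 \<or> int n + 1 < d \<Longrightarrow> labels C d = []"
    "labeled_matrix (labels C (d + 1)) (labels C d) (mats C d)"
    "mats C (d + 1) * mats C d = 0\<^sub>m (length (labels C (d + 2))) (length (labels C d))"
  using assms by (auto simp: labeled_complex_def)

lemma is_vcomplex_pos:
  assumes C: "labeled_complex n C"
  shows "is_vcomplex (pos_complex C)"
  unfolding is_vcomplex_def pos_complex_simps
proof (intro conjI allI impI)
  fix d \<sigma> v
  have "pos_map (labels C (d + 1 + 1)) (mats C (d + 1)) \<sigma> (pos_map (labels C (d + 1)) (mats C d) \<sigma> v) =
      pos_map (labels C (d + 1 + 1)) (mats C (d + 1) * mats C d) \<sigma> v"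
    by (rule pos_map_comp[OF labeled_complexD(2)[OF C] labeled_complexD(2)[OF C]])
  then show "pos_map (labels C (d + 1 + 1)) (mats C (d + 1)) \<sigma> (pos_map (labels C (d + 1)) (mats C d) \<sigma> v) = 0"
    unfolding labeled_complexD(3)[OF C] by (simp add: pos_map_def app_zero lin_map_zero[OF lin_map_mask])
qed (rule is_vsheaf_pos pos_map_natural[OF labeled_complexD(2)[OF C]])+

context
  fixes n and C :: "('p::order, 'k::field) labeled_data"
  assumes C: "labeled_complex n C"
begin

lemma complex_of_simps:
  "obj (complex_of C) d = inj_sum (labels C d)"
  "app (dif (complex_of C) d \<sigma>) v = compress (labels C (d + 1)) \<sigma> (app (mats C d) (expand (labels C d) \<sigma> v))"
  "dif (complex_of C) d \<sigma> \<in>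
     carrier_mat (card (pos_support (labels C (d + 1)) \<sigma>)) (card (pos_support (labels C d) \<sigma>))"
  unfolding complex_of_def
  using app_labeled_submatrix[OF labeled_matrixD(1)[OF labeled_complexD(2)[OF C]], of d \<sigma>] by simp_all

lemma dif_complex_of_eq:
  "app (dif (complex_of C) d \<sigma>) v =
     compress (labels C (d + 1)) \<sigma> (pos_map (labels C (d + 1)) (mats C d) \<sigma> (expand (labels C d) \<sigma> v))"
  by (simp add: complex_of_simps pos_map_def compress_mask)

lemma sheaf_complex_complex_of: "sheaf_complex (complex_of C)"
  unfolding sheaf_complex_iff
proof (intro conjI allI)
  note P = is_vcomplexD[OF is_vcomplex_pos[OF C], unfolded pos_complex_simps]
  show "is_vcomplex (vcomplex_of (complex_of C))"
    unfolding is_vcomplex_def vcomplex_of_simps complex_of_simps(1)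
  proof (intro conjI allI impI)
    fix d
    show "v_natural (vsheaf_of (inj_sum (labels C d))) (vsheaf_of (inj_sum (labels C (d + 1))))
        (\<lambda>\<sigma>. app (dif (complex_of C) d \<sigma>))"
      unfolding dif_complex_of_eq
      by (rule v_natural_compose[OF v_natural_compose[OF v_natural_expand P(2)] v_natural_compress])
    fix \<sigma> v
    have s: "pos_map (labels C (d + 1)) (mats C d) \<sigma> c \<in> stalk (pos_sheaf (labels C (d + 1))) \<sigma>" for c
      unfolding pos_map_def by (rule mask_stalk)
    have "pos_map (labels C (d + 1 + 1)) (mats C (d + 1)) \<sigma>
        (pos_map (labels C (d + 1)) (mats C d) \<sigma> (expand (labels C d) \<sigma> v)) = 0"
      using P(4)[OF expand_stalk] .
    then show "app (dif (complex_of C) (d + 1) \<sigma>) (app (dif (complex_of C) d \<sigma>) v) = 0"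
      unfolding dif_complex_of_eq expand_compress mask_ident[OF s]
      by (simp add: lin_map_zero[OF lin_map_compress])
  qed (rule is_vsheaf_of[OF sheaf_inj_sum])
qed (simp_all add: complex_of_simps sheaf_inj_sum)

lemma injective_complex_complex_of: "injective_complex (complex_of C)"
proof -
  have "zero_sheaf (obj (complex_of C) d)" if "d < 0 \<or> int n + 1 < d" for d
    using labeled_complexD(1)[OF C that]
    by (simp add: complex_of_simps zero_sheaf_def direct_sum_def)
  then have "bounded_complex (complex_of C)"
    unfolding bounded_complex_def by blast
  then show ?thesis
    by (simp add: injective_complex_def sheaf_complex_complex_of complex_of_simps injective_inj_sum)
qed

lemma v_quasi_iso_expand:
  "v_quasi_iso (vcomplex_of (complex_of C)) (pos_complex C) (\<lambda>d. expand (labels C d))"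
proof (rule v_quasi_iso_bijI[where g = "\<lambda>d. compress (labels C d)"])
  show "is_vcomplex (vcomplex_of (complex_of C))" "is_vcomplex (pos_complex C)"
    using is_vcomplex_of[OF sheaf_complex_complex_of] is_vcomplex_pos[OF C] .
  show "v_chain (vcomplex_of (complex_of C)) (pos_complex C) (\<lambda>d. expand (labels C d))"
    unfolding v_chain_def
    by (simp add: complex_of_simps(1) v_natural_expand dif_complex_of_eq expand_compress)
       (simp add: pos_map_def mask_ident mask_stalk)
qed (auto simp: complex_of_simps compress_fin_space expand_compress mask_ident compress_expand)

lemma v_quasi_iso_compress:
  "v_quasi_iso (pos_complex C) (vcomplex_of (complex_of C)) (\<lambda>d. compress (labels C d))"
proof (rule v_quasi_iso_bijI[where g = "\<lambda>d. expand (labels C d)"])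
  show "is_vcomplex (vcomplex_of (complex_of C))" "is_vcomplex (pos_complex C)"
    using is_vcomplex_of[OF sheaf_complex_complex_of] is_vcomplex_pos[OF C] .
  show "v_chain (pos_complex C) (vcomplex_of (complex_of C)) (\<lambda>d. compress (labels C d))"
    unfolding v_chain_def
    by (simp add: complex_of_simps(1) v_natural_compress dif_complex_of_eq expand_compress mask_ident)
qed (auto simp: complex_of_simps expand_stalk expand_compress mask_ident compress_expand)

end

section \<open>Socles\<close>

definition supp_space :: "nat set \<Rightarrow> (nat \<Rightarrow> 'k::field) set" where
  "supp_space S = {c. \<forall>i. i \<notin> S \<longrightarrow> c i = 0}"

lemma subspace_supp_space: "fun_space.subspace (supp_space S)"
  by (rule fun_space.subspaceI) (auto simp: supp_space_def)

lemma unit_fun_supp_space: "i \<in> S \<Longrightarrow> unit_fun i \<in> supp_space S"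
  by (auto simp: supp_space_def unit_fun_apply)

lemma supp_space_subset_span:
  assumes "finite S" "c \<in> supp_space S"
  shows "c \<in> fun_space.span (unit_fun ` S)"
  using assms
proof (induction S arbitrary: c rule: finite_induct)
  case empty
  then have "c = 0" by (auto simp: supp_space_def)
  then show ?case using fun_space.span_zero by blast
next
  case (insert s S)
  let ?c = "c - fun_scale (c s) (unit_fun s)"
  have "?c \<in> supp_space S"
    using insert.prems insert.hyps by (auto simp: supp_space_def unit_fun_apply)
  then have 1: "?c \<in> fun_space.span (unit_fun ` insert s S)"
    using insert.IH fun_space.span_mono[of "unit_fun ` S" "unit_fun ` insert s S"] by blast
  have 2: "fun_scale (c s) (unit_fun s) \<in> fun_space.span (unit_fun ` insert s S)"
    by (intro fun_space.span_scale fun_space.span_base) simp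
  have "c = ?c + fun_scale (c s) (unit_fun s)" by simp
  then show ?case using fun_space.span_add[OF 1 2] by metis
qed

lemma independent_unit_fun: "fun_space.independent (unit_fun ` S)"
  unfolding fun_space.dependent_def
proof (safe)
  fix s assume s: "s \<in> S" "unit_fun s \<in> fun_space.span (unit_fun ` S - {unit_fun s :: nat \<Rightarrow> 'a})"
  have "unit_fun ` S - {unit_fun s :: nat \<Rightarrow> 'a} \<subseteq> supp_space (- {s})"
    by (auto simp: supp_space_def unit_fun_apply)
  then have "fun_space.span (unit_fun ` S - {unit_fun s :: nat \<Rightarrow> 'a}) \<subseteq> supp_space (- {s})"
    by (rule fun_space.span_minimal[OF _ subspace_supp_space])
  then have "(unit_fun s :: nat \<Rightarrow> 'a) \<in> supp_space (- {s})" using s(2) by blast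
  then have "(unit_fun s :: nat \<Rightarrow> 'a) s = 0" by (simp add: supp_space_def)
  then show False by (simp add: unit_fun_apply)
qed

text \<open>A dimension count: \<open>f\<close> is injective on \<open>supp_space S\<close>, so it
  sends the unit functions of \<open>S\<close> to independent vectors in a space spanned by
  \<open>card T\<close> vectors.\<close>

lemma card_supp_le:
  fixes f g :: "(nat \<Rightarrow> 'k::field) \<Rightarrow> nat \<Rightarrow> 'k"
  assumes f: "lin_map f" and T: "finite T"
    and fT: "\<And>c. c \<in> supp_space S \<Longrightarrow> f c \<in> supp_space T"
    and gf: "\<And>c. c \<in> supp_space S \<Longrightarrow> g (f c) = c"
  shows "card S \<le> card T"
proof -
  let ?U = "unit_fun :: nat \<Rightarrow> nat \<Rightarrow> 'k"
  have inj_unit: "inj_on ?U A" for A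
  proof (rule inj_onI)
    fix x y assume "?U x = ?U y"
    then have "?U x x = ?U y x" by simp
    then show "x = y" by (simp add: unit_fun_apply split: if_splits)
  qed
  have span: "fun_space.span (?U ` S) \<subseteq> supp_space S"
    by (rule fun_space.span_minimal[OF _ subspace_supp_space]) (auto intro: unit_fun_supp_space)
  have inj: "inj_on f (supp_space S)"
    by (rule inj_on_inverseI[of _ g]) (rule gf)
  have "fun_space.independent (f ` ?U ` S)"
    using f independent_unit_fun inj_on_subset[OF inj span] unfolding lin_map_def
    by (rule fun_space_pair.linear_independent_injective_image)
  moreover have "f ` ?U ` S \<subseteq> fun_space.span (?U ` T)"
    using fT unit_fun_supp_space supp_space_subset_span[OF T] by blast
  ultimately have "card (f ` ?U ` S) \<le> card (?U ` T)"
    using fun_space.independent_span_bound[of "?U ` T"] T by blast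
  moreover have "card (f ` ?U ` S) = card (?U ` S)"
    using span fun_space.span_superset by (intro card_image inj_on_subset[OF inj]) blast
  ultimately show ?thesis
    by (simp add: card_image inj_unit)
qed

definition label_positions :: "'p list \<Rightarrow> 'p \<Rightarrow> nat set" where
  "label_positions ls \<pi> = {i. i < length ls \<and> ls ! i = \<pi>}"

lemma finite_label_positions [simp]: "finite (label_positions ls \<pi>)"
  by (simp add: label_positions_def)

lemma length_eq_sum_label_positions:
  "length ls = (\<Sum>\<pi>\<in>(UNIV :: 'p::finite set). card (label_positions ls \<pi>))"
proof -
  have "length ls = (\<Sum>\<pi>\<in>UNIV. \<Sum>i | i \<in> {..<length ls} \<and> ls ! i = \<pi>. 1)"
    by (subst sum.group) auto
  then show ?thesis by (simp add: label_positions_def)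
qed

lemma label_positions_subset: "label_positions ls \<pi> \<subseteq> pos_support ls \<pi>"
  by (auto simp: label_positions_def pos_support_def)

text \<open>\<open>supp_space (label_positions ls \<pi>)\<close> is the space of maps from the skyscraper at \<open>\<pi>\<close> to
  \<open>pos_sheaf ls\<close>: the sections at \<open>\<pi>\<close> that restrict to zero at every larger element.\<close>

lemma socle_pos_sheaf:
  "c \<in> supp_space (label_positions ls \<pi>) \<longleftrightarrow>
     c \<in> stalk (pos_sheaf ls) \<pi> \<and> (\<forall>\<tau>>\<pi>. rho (pos_sheaf ls) \<pi> \<tau> c = 0)"
proof
  assume c: "c \<in> supp_space (label_positions ls \<pi>)"
  then have "c \<in> stalk (pos_sheaf ls) \<pi>"
    using label_positions_subset[of ls \<pi>] by (auto simp: supp_space_def stalk_pos_sheaf)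
  moreover have "rho (pos_sheaf ls) \<pi> \<tau> c = 0" if "\<tau> > \<pi>" for \<tau>
    using c that by (auto simp: rho_pos_sheaf supp_space_def label_positions_def pos_support_def fun_eq_iff)
  ultimately show "c \<in> stalk (pos_sheaf ls) \<pi> \<and> (\<forall>\<tau>>\<pi>. rho (pos_sheaf ls) \<pi> \<tau> c = 0)" by blast
next
  assume c: "c \<in> stalk (pos_sheaf ls) \<pi> \<and> (\<forall>\<tau>>\<pi>. rho (pos_sheaf ls) \<pi> \<tau> c = 0)"
  have "c i = 0" if "i \<notin> label_positions ls \<pi>" for i
  proof (cases "i \<in> pos_support ls \<pi>")
    case True
    \<comment> \<open>A position over \<pi> whose label differs from \<pi> has a strictly larger
      label, and restriction to that label keeps its coordinate.\<close>
    then have "ls ! i > \<pi>"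
      using that by (auto simp: pos_support_def label_positions_def)
    then have "mask_fun (pos_support ls (ls ! i)) c = 0" using c by (simp add: rho_pos_sheaf)
    then have "mask_fun (pos_support ls (ls ! i)) c i = 0" by simp
    then show ?thesis using True by (simp add: pos_support_def)
  next
    case False
    then show ?thesis using c by (simp add: stalk_pos_sheaf)
  qed
  then show "c \<in> supp_space (label_positions ls \<pi>)" by (simp add: supp_space_def)
qed

text \<open>Natural maps commute with restriction, so they preserve the vanishing of restrictions to
  larger elements that characterizes this space.\<close>

lemma v_natural_socle:
  assumes f: "v_natural (pos_sheaf ls) (pos_sheaf ls') f" and c: "c \<in> supp_space (label_positions ls \<pi>)"
  shows "f \<pi> c \<in> supp_space (label_positions ls' \<pi>)"
  unfolding socle_pos_sheaf
proof (intro conjI allI impI)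
  have c': "c \<in> stalk (pos_sheaf ls) \<pi>" "\<And>\<tau>. \<tau> > \<pi> \<Longrightarrow> rho (pos_sheaf ls) \<pi> \<tau> c = 0"
    using c unfolding socle_pos_sheaf by auto
  show "f \<pi> c \<in> stalk (pos_sheaf ls') \<pi>"
    using v_naturalD(2)[OF f c'(1)] .
  fix \<tau> assume "\<pi> < \<tau>"
  then show "rho (pos_sheaf ls') \<pi> \<tau> (f \<pi> c) = 0"
    using v_naturalD(3)[OF f less_imp_le c'(1), of \<tau>] c'(2)[of \<tau>] lin_map_zero[OF v_naturalD(1)[OF f]]
    by metis
qed

lemma v_natural_card_le:
  assumes f: "v_natural (pos_sheaf ls) (pos_sheaf ls') f"
    and gf: "\<And>c. c \<in> supp_space (label_positions ls \<pi>) \<Longrightarrow> g (f \<pi> c) = c"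
  shows "card (label_positions ls \<pi>) \<le> card (label_positions ls' \<pi>)"
  using v_naturalD(1)[OF f] finite_label_positions v_natural_socle[OF f] gf by (rule card_supp_le)

text \<open>The uniqueness half of Krull-Schmidt for injective sheaves: the multiplicity of each
  label is the dimension of an invariantly defined space.\<close>

lemma v_iso_pos_sheaf_length:
  fixes ls ls' :: "'p::{finite,order} list"
  assumes "v_iso (pos_sheaf ls :: ('p, nat \<Rightarrow> 'k::field) vsheaf) (pos_sheaf ls')"
  shows "length ls = length ls'"
proof -
  obtain f g where f: "v_natural (pos_sheaf ls) (pos_sheaf ls') f"
    and g: "v_natural (pos_sheaf ls') (pos_sheaf ls) (g :: 'p \<Rightarrow> (nat \<Rightarrow> 'k) \<Rightarrow> nat \<Rightarrow> 'k)"
    and inv: "\<And>\<sigma> v. v \<in> stalk (pos_sheaf ls) \<sigma> \<Longrightarrow> g \<sigma> (f \<sigma> v) = v"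
      "\<And>\<sigma> v. v \<in> stalk (pos_sheaf ls') \<sigma> \<Longrightarrow> f \<sigma> (g \<sigma> v) = v"
    using assms unfolding v_iso_def by blast
  have "card (label_positions ls \<pi>) = card (label_positions ls' \<pi>)" for \<pi>
    using v_natural_card_le[OF f, of \<pi> "g \<pi>"] v_natural_card_le[OF g, of \<pi> "f \<pi>"] inv
    unfolding socle_pos_sheaf by (meson order.antisym)
  then show ?thesis by (simp add: length_eq_sum_label_positions)
qed

section \<open>Minimality\<close>

lemma submatrix_labels:
  assumes M: "M \<in> carrier_mat (length rs) (length cs)"
  shows "labeled_submatrix rs cs M {\<pi>} {\<pi>} \<in>
      carrier_mat (card (label_positions rs \<pi>)) (card (label_positions cs \<pi>))"
    and "a < card (label_positions rs \<pi>) \<Longrightarrow> b < card (label_positions cs \<pi>) \<Longrightarrow>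
      labeled_submatrix rs cs M {\<pi>} {\<pi>} $$ (a, b) =
      M $$ (pick (label_positions rs \<pi>) a, pick (label_positions cs \<pi>) b)"
proof -
  let ?S = "label_positions rs \<pi>" and ?T = "label_positions cs \<pi>"
  have sub: "labeled_submatrix rs cs M {\<pi>} {\<pi>} = submatrix M ?S ?T"
    by (simp add: labeled_submatrix_def label_positions_def)
  have S: "{i. i < dim_row M \<and> i \<in> ?S} = ?S" and T: "{j. j < dim_col M \<and> j \<in> ?T} = ?T"
    using M by (auto simp: label_positions_def)
  show "labeled_submatrix rs cs M {\<pi>} {\<pi>} \<in> carrier_mat (card ?S) (card ?T)"
    unfolding sub by (intro carrier_matI) (simp_all add: dim_submatrix S T)
  show "labeled_submatrix rs cs M {\<pi>} {\<pi>} $$ (a, b) = M $$ (pick ?S a, pick ?T b)"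
    if "a < card ?S" "b < card ?T"
    using that unfolding sub by (intro submatrix_index) (simp_all add: S T)
qed

lemma label_positions_pick:
  "a < card (label_positions rs \<pi>) \<Longrightarrow> pick (label_positions rs \<pi>) a \<in> label_positions rs \<pi>"
  by (rule pick_in_set_le)

lemma label_positions_pick_ex:
  assumes "i \<in> label_positions rs \<pi>"
  obtains a where "a < card (label_positions rs \<pi>)" "pick (label_positions rs \<pi>) a = i"
  using assms pick_card_in_set[OF assms] card_less_card[OF finite_label_positions assms] by metis

lemma loop_guard_iff:
  assumes M: "mats C d \<in> carrier_mat (length (labels C (d + 1))) (length (labels C d))"
  shows "loop_guard C d \<pi> \<longleftrightarrow>
    (\<exists>i\<in>label_positions (labels C (d + 1)) \<pi>. \<exists>j\<in>label_positions (labels C d) \<pi>. mats C d $$ (i, j) \<noteq> 0)"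
proof -
  let ?S = "label_positions (labels C (d + 1)) \<pi>" and ?T = "label_positions (labels C d) \<pi>"
  let ?B = "labeled_submatrix (labels C (d + 1)) (labels C d) (mats C d) {\<pi>} {\<pi>}"
  note B = submatrix_labels[OF M, where \<pi> = \<pi>]
  have "?B \<noteq> 0\<^sub>m (dim_row ?B) (dim_col ?B) \<longleftrightarrow> (\<exists>a<card ?S. \<exists>b<card ?T. ?B $$ (a, b) \<noteq> 0)"
    using B(1) unfolding mat_eq_iff by auto
  also have "\<dots> \<longleftrightarrow> (\<exists>i\<in>?S. \<exists>j\<in>?T. mats C d $$ (i, j) \<noteq> 0)"
    using B(2) by (metis label_positions_pick label_positions_pick_ex)
  finally show ?thesis by (simp add: loop_guard_def diagonal_block_def)
qed

text \<open>At \<pi> only rows with labels above \<pi> count. A nonzero entry of such a row in a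
  column labeled \<pi> squeezes the row label to \<pi>, so nothing but the diagonal block
  acts.\<close>

lemma pos_map_socle_zero:
  assumes M: "labeled_matrix rs cs M"
    and zero: "\<And>i j. i \<in> label_positions rs \<pi> \<Longrightarrow> j \<in> label_positions cs \<pi> \<Longrightarrow> M $$ (i, j) = 0"
    and c: "c \<in> supp_space (label_positions cs \<pi>)"
  shows "pos_map rs M \<pi> c = 0"
proof
  fix i
  have "M $$ (i, j) * c j = 0" if i: "i \<in> pos_support rs \<pi>" and j: "j < length cs" for j
  proof (cases "j \<in> label_positions cs \<pi>")
    case True
    then show ?thesis
      using zero[of i j] labeled_matrixD(2)[OF M, of i j] i
      by (fastforce simp: pos_support_def label_positions_def)
  next
    case False
    then show ?thesis using c by (simp add: supp_space_def)
  qed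
  then show "pos_map rs M \<pi> c i = 0 i"
    using labeled_matrixD(1)[OF M] by (auto simp: pos_map_def app_def intro!: sum.neutral)
qed

lemma unguarded_length_le:
  fixes C :: "('p::{finite,order}, 'k::field) labeled_data" and J :: "('p, nat \<Rightarrow> 'k) vcomplex"
  assumes C: "labeled_complex n C" and guard: "\<nexists>d \<pi>. loop_guard C d \<pi>"
    and J: "is_vcomplex J" and ls: "\<And>d. vobj J d = pos_sheaf (ls d)"
    and h: "v_quasi_iso (pos_complex C) J h"
  shows "length (labels C d) \<le> length (ls d)"
proof -
  note P = is_vcomplex_pos[OF C]
  have "labels C e = []" if "e < 0" for e using labeled_complexD(1)[OF C] that by blast
  \<comment> \<open>The identity of \<open>pos_complex C\<close> is extended along \<open>h\<close>;
    the injective, bounded below target is here \<open>pos_complex C\<close> itself.\<close>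
  then obtain k s where k: "v_chain J (pos_complex C) k" and s: "v_homotopy (pos_complex C) (pos_complex C) s"
    and eq: "\<And>d \<sigma> x. x \<in> cstalk (pos_complex C) d \<sigma> \<Longrightarrow>
       x = vdif (pos_complex C) (d - 1) \<sigma> (s d \<sigma> x) + s (d + 1) \<sigma> (vdif (pos_complex C) d \<sigma> x) + k d \<sigma> (h d \<sigma> x)"
    using v_chain_extend[OF P J P pos_complex_simps(1) _ h v_chain_id] by metis
  have dif0: "vdif (pos_complex C) e \<pi> c = 0" if "c \<in> supp_space (label_positions (labels C e) \<pi>)" for e \<pi> c
  proof -
    have "\<not> loop_guard C e \<pi>" using guard by blast
    then show ?thesis
      using loop_guard_iff[OF labeled_matrixD(1)[OF labeled_complexD(2)[OF C]], of e \<pi>]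
        pos_map_socle_zero[OF labeled_complexD(2)[OF C] _ that] by auto
  qed
  have hn: "v_natural (pos_sheaf (labels C d)) (pos_sheaf (ls d)) (h d)"
    using v_chainD(1)[OF v_quasi_isoD(1)[OF h], of d] by (simp add: ls)
  have sn: "v_natural (pos_sheaf (labels C e)) (pos_sheaf (labels C (e - 1))) (s e)" for e
    using s unfolding v_homotopy_def pos_complex_simps by blast
  have "k d \<pi> (h d \<pi> c) = c" if c: "c \<in> supp_space (label_positions (labels C d) \<pi>)" for \<pi> c
  proof -
    have "c \<in> cstalk (pos_complex C) d \<pi>" using c unfolding socle_pos_sheaf by simp
    \<comment> \<open>One homotopy term vanishes because \<open>c\<close> has zero differential. In
      the other one, \<open>s d \<pi> c\<close> again lies in the space of maps from the skyscraper,
      where the differential of degree \<open>d - 1\<close> is zero.\<close>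
    from eq[OF this] have "c = 0 + s (d + 1) \<pi> 0 + k d \<pi> (h d \<pi> c)"
      unfolding dif0[OF c] dif0[OF v_natural_socle[OF sn c]] .
    then show ?thesis unfolding lin_map_zero[OF v_naturalD(1)[OF sn]] by simp
  qed
  then have "card (label_positions (labels C d) \<pi>) \<le> card (label_positions (ls d) \<pi>)" for \<pi>
    by (rule v_natural_card_le[OF hn])
  then show ?thesis
    unfolding length_eq_sum_label_positions by (rule sum_mono)
qed

section \<open>Zigzags of quasi-isomorphisms\<close>

lemma v_iso_sym: "v_iso F G \<Longrightarrow> v_iso G F"
  unfolding v_iso_def by blast

lemma v_iso_trans:
  assumes "v_iso F G" "v_iso G H"
  shows "v_iso F H"
proof -
  obtain f g where f: "v_natural F G f" "v_natural G F g"
    "\<And>\<sigma> v. v \<in> stalk F \<sigma> \<Longrightarrow> g \<sigma> (f \<sigma> v) = v" "\<And>\<sigma> v. v \<in> stalk G \<sigma> \<Longrightarrow> f \<sigma> (g \<sigma> v) = v"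
    using assms(1) unfolding v_iso_def by blast
  obtain f' g' where f': "v_natural G H f'" "v_natural H G g'"
    "\<And>\<sigma> v. v \<in> stalk G \<sigma> \<Longrightarrow> g' \<sigma> (f' \<sigma> v) = v" "\<And>\<sigma> v. v \<in> stalk H \<sigma> \<Longrightarrow> f' \<sigma> (g' \<sigma> v) = v"
    using assms(2) unfolding v_iso_def by blast
  show ?thesis
    unfolding v_iso_def
    by (intro exI[of _ "\<lambda>\<sigma> v. f' \<sigma> (f \<sigma> v)"] exI[of _ "\<lambda>\<sigma> v. g \<sigma> (g' \<sigma> v)"] conjI allI ballI
        v_natural_compose[OF f(1) f'(1)] v_natural_compose[OF f'(2) f(2)])
       (simp_all add: f f' v_naturalD(2)[OF f(1)] v_naturalD(2)[OF f'(2)])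
qed

text \<open>Transport of structure: the differentials are conjugated by the isomorphisms, which
  thereby form a chain map.\<close>

lemma v_complex_transport:
  fixes K :: "('p::order, 'i \<Rightarrow> 'k::field) vcomplex" and G :: "int \<Rightarrow> ('p, 'j \<Rightarrow> 'k) vsheaf"
  assumes K: "is_vcomplex K" and G: "\<And>d. is_vsheaf (G d)"
    and iso: "\<And>d. v_iso (vobj K d) (G d)"
  obtains L \<alpha> where "is_vcomplex L" "\<And>d. vobj L d = G d" "v_quasi_iso K L \<alpha>"
proof -
  obtain \<alpha> \<beta> where \<alpha>: "\<And>d. v_natural (vobj K d) (G d) (\<alpha> d)" and \<beta>: "\<And>d. v_natural (G d) (vobj K d) (\<beta> d)"
    and \<beta>\<alpha>: "\<And>d \<sigma> v. v \<in> cstalk K d \<sigma> \<Longrightarrow> \<beta> d \<sigma> (\<alpha> d \<sigma> v) = v"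
    and \<alpha>\<beta>: "\<And>d \<sigma> v. v \<in> stalk (G d) \<sigma> \<Longrightarrow> \<alpha> d \<sigma> (\<beta> d \<sigma> v) = v"
    using iso unfolding v_iso_def by metis
  define L where "L = \<lparr> vobj = G, vdif = \<lambda>d \<sigma> v. \<alpha> (d + 1) \<sigma> (vdif K d \<sigma> (\<beta> d \<sigma> v)) \<rparr>"
  have L_simps: "vobj L d = G d" "vdif L d = (\<lambda>\<sigma> v. \<alpha> (d + 1) \<sigma> (vdif K d \<sigma> (\<beta> d \<sigma> v)))" for d
    by (simp_all add: L_def)
  have L: "is_vcomplex L"
    unfolding is_vcomplex_def L_simps
  proof (intro conjI allI impI)
    fix d
    show "is_vsheaf (G d)" by (rule G)
    show "v_natural (G d) (G (d + 1)) (\<lambda>\<sigma> v. \<alpha> (d + 1) \<sigma> (vdif K d \<sigma> (\<beta> d \<sigma> v)))"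
      by (rule v_natural_compose[OF v_natural_compose[OF \<beta> is_vcomplexD(2)[OF K]] \<alpha>])
    fix \<sigma> v assume "v \<in> stalk (G d) \<sigma>"
    then have b: "\<beta> d \<sigma> v \<in> cstalk K d \<sigma>" by (rule v_naturalD(2)[OF \<beta>])
    show "\<alpha> (d + 1 + 1) \<sigma> (vdif K (d + 1) \<sigma> (\<beta> (d + 1) \<sigma> (\<alpha> (d + 1) \<sigma> (vdif K d \<sigma> (\<beta> d \<sigma> v))))) = 0"
      unfolding \<beta>\<alpha>[OF is_vcomplexD(8)[OF K b]] is_vcomplexD(4)[OF K b]
      by (rule lin_map_zero[OF v_naturalD(1)[OF \<alpha>]])
  qed
  have "v_quasi_iso K L \<alpha>"
  proof (rule v_quasi_iso_bijI[OF K L, where g = \<beta>])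
    show "v_chain K L \<alpha>"
      unfolding v_chain_def L_simps by (simp add: \<alpha> \<beta>\<alpha>)
  qed (simp_all add: L_simps \<beta>\<alpha> \<alpha>\<beta> v_naturalD(2)[OF \<beta>])
  then show thesis using L L_simps(1) that by blast
qed

lemma injective_complex_coordinates:
  assumes J: "injective_complex J"
  obtains L ls a \<alpha> where "is_vcomplex L" "\<And>d. vobj L d = pos_sheaf (ls d)" "\<And>d. d < a \<Longrightarrow> ls d = []"
    "v_quasi_iso (vcomplex_of J) L \<alpha>" "\<And>d. sheaf_iso (obj J d) (inj_sum (ls d))"
proof -
  have Js: "sheaf_complex J" and Jb: "bounded_complex J" and Ji: "\<And>d. injective_sheaf (obj J d)"
    using J by (auto simp: injective_complex_def)
  have "\<exists>ls. \<forall>d. sheaf_iso (obj J d) (inj_sum (ls d))"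
    using Ji unfolding injective_sheaf_def by metis
  then obtain ls where ls: "\<And>d. sheaf_iso (obj J d) (inj_sum (ls d))" by blast
  have iso: "v_iso (vsheaf_of (obj J d)) (pos_sheaf (ls d))" for d
    using ls[of d] sheaf_iso_iff_v_iso[OF sheaf_complexD(1)[OF Js] sheaf_inj_sum]
      v_iso_trans[OF _ v_iso_inj_sum] by blast
  obtain a b where ab: "\<And>d. d < a \<or> b < d \<Longrightarrow> zero_sheaf (obj J d)"
    using Jb unfolding bounded_complex_def by blast
  \<comment> \<open>A nonempty list would give a nonzero section at its first label, in a sheaf
    isomorphic to a zero sheaf.\<close>
  have "ls d = []" if "d < a" for d
  proof (rule ccontr)
    assume ne: "ls d \<noteq> []"
    obtain \<alpha> \<beta> where \<alpha>: "v_natural (vsheaf_of (obj J d)) (pos_sheaf (ls d)) \<alpha>"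
      and \<beta>: "v_natural (pos_sheaf (ls d)) (vsheaf_of (obj J d)) \<beta>"
      and inv: "\<And>\<sigma> v. v \<in> stalk (pos_sheaf (ls d)) \<sigma> \<Longrightarrow> \<alpha> \<sigma> (\<beta> \<sigma> v) = v"
      using iso[of d] unfolding v_iso_def by blast
    let ?u = "unit_fun 0 :: nat \<Rightarrow> 'b" and ?p = "ls d ! 0"
    have u: "?u \<in> stalk (pos_sheaf (ls d)) ?p"
      using ne by (auto simp: stalk_pos_sheaf unit_fun_apply pos_support_def)
    have "\<beta> ?p ?u \<in> fin_space 0"
      using v_naturalD(2)[OF \<beta> u] ab[of d] that by (simp add: zero_sheaf_def)
    then have "\<beta> ?p ?u = 0" by (auto simp: fin_space_def)
    then have "?u = 0" using inv[OF u] lin_map_zero[OF v_naturalD(1)[OF \<alpha>]] by metis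
    then have "?u 0 = 0" by (metis zero_fun_apply)
    then show False by (simp add: unit_fun_apply)
  qed
  moreover obtain L \<alpha> where "is_vcomplex L" "\<And>d. vobj L d = pos_sheaf (ls d)" "v_quasi_iso (vcomplex_of J) L \<alpha>"
    using v_complex_transport[OF is_vcomplex_of[OF Js], of "\<lambda>d. pos_sheaf (ls d)"] iso is_vsheaf_pos
    unfolding vcomplex_of_simps(1) by metis
  ultimately show thesis using ls that by blast
qed

text \<open>Induction along the zigzag, carrying a quasi-isomorphism from the current complex to the
  fixed \<open>L\<close>. An arrow into the current complex is composed with it; along an arrow out
  of the current complex the map is extended, which works because \<open>L\<close> is injective and
  bounded below.\<close>

lemma quasi_isomorphic_v_quasi_iso:
  fixes L :: "('p::order, nat \<Rightarrow> 'k::field) vcomplex"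
  assumes J: "sheaf_complex J" and L: "is_vcomplex L" and ls: "\<And>d. vobj L d = pos_sheaf (ls d)"
    and bound: "\<And>d. d < a \<Longrightarrow> ls d = []" and \<alpha>: "v_quasi_iso (vcomplex_of J) L \<alpha>"
    and JK: "quasi_isomorphic J K"
  obtains h where "v_quasi_iso (vcomplex_of K) L h"
proof -
  let ?R = "\<lambda>K L :: ('p, 'k) complex_data. sheaf_complex K \<and> sheaf_complex L \<and> (\<exists>f. quasi_iso K L f)"
  have "equivclp ?R J K" using JK by (simp add: quasi_isomorphic_def)
  then have "sheaf_complex K \<and> (\<exists>h. v_quasi_iso (vcomplex_of K) L h)"
  proof (induction rule: equivclp_induct)
    case base
    then show ?case using J \<alpha> by blast
  next
    case (step X Y)
    then obtain h where h: "v_quasi_iso (vcomplex_of X) L h" by blast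
    from step(2) have X: "sheaf_complex X" and Y: "sheaf_complex Y" by auto
    note vX = is_vcomplex_of[OF X] and vY = is_vcomplex_of[OF Y]
    from step(2) consider f where "quasi_iso X Y f" | f where "quasi_iso Y X f" by blast
    then have "\<exists>h. v_quasi_iso (vcomplex_of Y) L h"
    proof cases
      case 1
      then have "v_quasi_iso (vcomplex_of X) (vcomplex_of Y) (\<lambda>d \<sigma>. app (f d \<sigma>))"
        using quasi_iso_iff_v_quasi_iso[OF X Y] by blast
      then show ?thesis using v_quasi_iso_extend[OF vX vY L ls bound _ h] by metis
    next
      case 2
      then have "v_quasi_iso (vcomplex_of Y) (vcomplex_of X) (\<lambda>d \<sigma>. app (f d \<sigma>))"
        using quasi_iso_iff_v_quasi_iso[OF Y X] by blast
      then show ?thesis using v_quasi_iso_compose[OF vY vX L _ h] by blast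
    qed
    then show ?case using Y by blast
  qed
  then show thesis using that by blast
qed

section \<open>Direct sums\<close>

text \<open>Stalks are spaces on initial segments of coordinates, so the first summand of a direct
  sum is included by the identity and reached by a mask; only the second one needs a shift of
  indices.\<close>

definition tail_fun :: "nat \<Rightarrow> (nat \<Rightarrow> 'k::field) \<Rightarrow> nat \<Rightarrow> 'k" where
  "tail_fun n v = (\<lambda>j. v (n + j))"

definition shift_fun :: "nat \<Rightarrow> (nat \<Rightarrow> 'k::field) \<Rightarrow> nat \<Rightarrow> 'k" where
  "shift_fun n v = (\<lambda>i. if i < n then 0 else v (i - n))"

lemma lin_map_tail: "lin_map (tail_fun n)" and lin_map_shift: "lin_map (shift_fun n)"
  by (rule lin_mapI; auto simp: tail_fun_def shift_fun_def fun_eq_iff)+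

lemma tail_shift [simp]: "tail_fun n (shift_fun n v) = v"
  by (auto simp: tail_fun_def shift_fun_def)

lemma mask_shift: "mask_fun {..<n} (shift_fun n v) = 0"
  by (auto simp: shift_fun_def fun_eq_iff)

lemma tail_fin_space: "v \<in> fin_space (n + m) \<Longrightarrow> tail_fun n v \<in> fin_space m"
  by (auto simp: tail_fun_def fin_space_def)

lemma shift_fin_space: "v \<in> fin_space m \<Longrightarrow> shift_fun n v \<in> fin_space (n + m)"
  by (auto simp: shift_fun_def fin_space_def)

lemma mask_fin_space: "mask_fun {..<n} v \<in> fin_space n"
  by (auto simp: fin_space_def)

lemma mask_fin_space_ident: "v \<in> fin_space n \<Longrightarrow> mask_fun {..<n} v = v"
  by (auto simp: fin_space_def fun_eq_iff)

lemma tail_fin_space_zero: "v \<in> fin_space n \<Longrightarrow> tail_fun n v = 0"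
  by (auto simp: fin_space_def tail_fun_def fun_eq_iff)

lemma fin_space_mono: "v \<in> fin_space n \<Longrightarrow> v \<in> fin_space (n + m)"
  by (auto simp: fin_space_def)

lemma mask_shift_tail: "mask_fun {..<n} v + shift_fun n (tail_fun n v) = v"
  by (auto simp: fun_eq_iff shift_fun_def tail_fun_def)

lemma app_mask: "A \<in> carrier_mat m n \<Longrightarrow> app A (mask_fun {..<n} v) = app A v"
  by (auto simp: app_def fun_eq_iff intro!: sum.cong)

lemma stalk_dim_direct_sum_Cons [simp]:
  "stalk_dim (direct_sum (F # Fs)) \<sigma> = stalk_dim F \<sigma> + stalk_dim (direct_sum Fs) \<sigma>"
  "stalk_dim (direct_sum []) \<sigma> = 0"
  by (simp_all add: direct_sum_def)

lemma app_res_direct_sum_Cons: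
  assumes F: "sheaf F" and Fs: "sheaf (direct_sum Fs)" and le: "\<sigma> \<le> \<tau>"
  shows "app (res (direct_sum (F # Fs)) \<sigma> \<tau>) v =
    app (res F \<sigma> \<tau>) v + shift_fun (stalk_dim F \<tau>) (app (res (direct_sum Fs) \<sigma> \<tau>) (tail_fun (stalk_dim F \<sigma>) v))"
proof -
  note c = sheafD(1)[OF F le] and c' = sheafD(1)[OF Fs le]
  show ?thesis
    unfolding res_direct_sum_Cons(1)[OF c c'] fun_eq_iff app_four_block_diag[OF c c']
    using app_fin_space[OF c, of v] by (auto simp: shift_fun_def tail_fun_def fin_space_def)
qed

lemma sheaf_direct_sum_Cons:
  assumes F: "sheaf (F :: ('a::order, 'b::field) sheaf_data)" and Fs: "sheaf (direct_sum Fs)"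
  shows "sheaf (direct_sum (F # Fs))"
proof -
  note a = app_res_direct_sum_Cons[OF F Fs]
  note vF = is_vsheafD[OF is_vsheaf_of[OF F], unfolded vsheaf_of_simps]
    and vFs = is_vsheafD[OF is_vsheaf_of[OF Fs], unfolded vsheaf_of_simps]
  show ?thesis
  proof (rule sheaf_ofI)
    show "res (direct_sum (F # Fs)) \<sigma> \<tau> \<in>
        carrier_mat (stalk_dim (direct_sum (F # Fs)) \<tau>) (stalk_dim (direct_sum (F # Fs)) \<sigma>)" if "\<sigma> \<le> \<tau>" for \<sigma> \<tau>
      using res_direct_sum_Cons(2)[OF sheafD(1)[OF F that] sheafD(1)[OF Fs that]] by simp
    show "is_vsheaf (vsheaf_of (direct_sum (F # Fs)))"
      unfolding is_vsheaf_def vsheaf_of_simps stalk_dim_direct_sum_Cons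
    proof (intro conjI allI impI)
      fix \<sigma> \<tau> :: 'a and v :: "nat \<Rightarrow> 'b" assume le: "\<sigma> \<le> \<tau>"
      show "app (res (direct_sum (F # Fs)) \<sigma> \<tau>) v \<in> fin_space (stalk_dim F \<tau> + stalk_dim (direct_sum Fs) \<tau>)"
        unfolding a[OF le]
        by (intro fun_space.subspace_add[OF subspace_fin_space] fin_space_mono shift_fin_space
            app_fin_space[OF sheafD(1)[OF F le]] app_fin_space[OF sheafD(1)[OF Fs le]])
    next
      fix \<sigma> :: 'a and v :: "nat \<Rightarrow> 'b" assume v: "v \<in> fin_space (stalk_dim F \<sigma> + stalk_dim (direct_sum Fs) \<sigma>)"
      have "app (res F \<sigma> \<sigma>) v = mask_fun {..<stalk_dim F \<sigma>} v"
        using app_mask[OF sheafD(1)[OF F order.refl], of \<sigma> v] vF(4)[OF mask_fin_space] by metis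
      then show "app (res (direct_sum (F # Fs)) \<sigma> \<sigma>) v = v"
        unfolding a[OF order.refl] using vFs(4)[OF tail_fin_space[OF v]] mask_shift_tail by metis
    next
      fix \<pi> \<sigma> \<tau> :: 'a and v :: "nat \<Rightarrow> 'b"
      assume le: "\<pi> \<le> \<sigma>" "\<sigma> \<le> \<tau>" and v: "v \<in> fin_space (stalk_dim F \<pi> + stalk_dim (direct_sum Fs) \<pi>)"
      let ?w = "app (res (direct_sum (F # Fs)) \<pi> \<sigma>) v"
      let ?x = "app (res F \<pi> \<sigma>) v" and ?y = "app (res (direct_sum Fs) \<pi> \<sigma>) (tail_fun (stalk_dim F \<pi>) v)"
      have x: "?x \<in> fin_space (stalk_dim F \<sigma>)" by (rule app_fin_space[OF sheafD(1)[OF F le(1)]])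
      have "mask_fun {..<stalk_dim F \<sigma>} ?w = ?x"
        unfolding a[OF le(1)] lin_map_add[OF lin_map_mask] mask_shift mask_fin_space_ident[OF x] by simp
      then have 1: "app (res F \<sigma> \<tau>) ?w = app (res F \<sigma> \<tau>) ?x"
        using app_mask[OF sheafD(1)[OF F le(2)], of ?w] by simp
      have 2: "tail_fun (stalk_dim F \<sigma>) ?w = ?y"
        unfolding a[OF le(1)] lin_map_add[OF lin_map_tail] tail_fin_space_zero[OF x] by simp
      have "app (res F \<sigma> \<tau>) ?x = app (res F \<pi> \<tau>) v"
        using vF(5)[OF le mask_fin_space[of "stalk_dim F \<pi>" v]]
          app_mask[OF sheafD(1)[OF F le(1)], of v] app_mask[OF sheafD(1)[OF F order.trans[OF le]], of v]
        by simp
      then show "app (res (direct_sum (F # Fs)) \<sigma> \<tau>) ?w = app (res (direct_sum (F # Fs)) \<pi> \<tau>) v"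
        unfolding a[OF le(2)] a[OF order.trans[OF le]] 1 2 using vFs(5)[OF le tail_fin_space[OF v]] by simp
    qed (rule subspace_fin_space lin_map_app)+
  qed
qed

lemma sheaf_direct_sum:
  assumes "\<And>F. F \<in> set Fs \<Longrightarrow> sheaf (F :: ('a::order, 'b::field) sheaf_data)"
  shows "sheaf (direct_sum Fs)"
  using assms
proof (induction Fs)
  case Nil
  have "direct_sum [] = (inj_sum [] :: ('a, 'b) sheaf_data)" by simp
  then show ?case using sheaf_inj_sum by metis
qed (simp add: sheaf_direct_sum_Cons)

context
  fixes F :: "('p::order, 'k::field) sheaf_data" and Fs :: "('p, 'k) sheaf_data list"
  assumes F: "sheaf F" and Fs: "sheaf (direct_sum Fs)"
begin

lemma v_natural_head:
  "v_natural (vsheaf_of (direct_sum (F # Fs))) (vsheaf_of F) (\<lambda>\<sigma>. mask_fun {..<stalk_dim F \<sigma>})"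
  unfolding v_natural_def
proof (intro conjI allI impI)
  fix \<sigma> \<tau> :: 'p and v assume le: "\<sigma> \<le> \<tau>"
  show "mask_fun {..<stalk_dim F \<tau>} (rho (vsheaf_of (direct_sum (F # Fs))) \<sigma> \<tau> v) =
      rho (vsheaf_of F) \<sigma> \<tau> (mask_fun {..<stalk_dim F \<sigma>} v)"
    unfolding vsheaf_of_simps app_res_direct_sum_Cons[OF F Fs le] lin_map_add[OF lin_map_mask] mask_shift
      mask_fin_space_ident[OF app_fin_space[OF sheafD(1)[OF F le]]] app_mask[OF sheafD(1)[OF F le]] by simp
qed (simp_all add: lin_map_mask mask_fin_space)

lemma v_natural_tail:
  "v_natural (vsheaf_of (direct_sum (F # Fs))) (vsheaf_of (direct_sum Fs)) (\<lambda>\<sigma>. tail_fun (stalk_dim F \<sigma>))"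
  unfolding v_natural_def
proof (intro conjI allI impI)
  fix \<sigma> \<tau> :: 'p and v assume le: "\<sigma> \<le> \<tau>"
  show "tail_fun (stalk_dim F \<tau>) (rho (vsheaf_of (direct_sum (F # Fs))) \<sigma> \<tau> v) =
      rho (vsheaf_of (direct_sum Fs)) \<sigma> \<tau> (tail_fun (stalk_dim F \<sigma>) v)"
    unfolding vsheaf_of_simps app_res_direct_sum_Cons[OF F Fs le] lin_map_add[OF lin_map_tail]
      tail_fin_space_zero[OF app_fin_space[OF sheafD(1)[OF F le]]] by simp
qed (simp_all add: lin_map_tail tail_fin_space)

lemma v_natural_inl:
  "v_natural (vsheaf_of F) (vsheaf_of (direct_sum (F # Fs))) (\<lambda>\<sigma> v. v)"
  unfolding v_natural_def
proof (intro conjI allI impI)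
  fix \<sigma> \<tau> :: 'p and v assume le: "\<sigma> \<le> \<tau>" and v: "v \<in> stalk (vsheaf_of F) \<sigma>"
  have t: "tail_fun (stalk_dim F \<sigma>) v = 0" using v by (intro tail_fin_space_zero) simp
  show "rho (vsheaf_of F) \<sigma> \<tau> v = rho (vsheaf_of (direct_sum (F # Fs))) \<sigma> \<tau> v"
    unfolding vsheaf_of_simps app_res_direct_sum_Cons[OF F Fs le] t
      lin_map_zero[OF lin_map_app] lin_map_zero[OF lin_map_shift] by simp
qed (simp_all add: fin_space_mono)

lemma v_natural_inr:
  "v_natural (vsheaf_of (direct_sum Fs)) (vsheaf_of (direct_sum (F # Fs))) (\<lambda>\<sigma>. shift_fun (stalk_dim F \<sigma>))"
  unfolding v_natural_def
proof (intro conjI allI impI)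
  fix \<sigma> \<tau> :: 'p and v assume le: "\<sigma> \<le> \<tau>"
  have z: "app (res F \<sigma> \<tau>) (shift_fun (stalk_dim F \<sigma>) v) = 0"
    using app_mask[OF sheafD(1)[OF F le], of "shift_fun (stalk_dim F \<sigma>) v"]
    unfolding mask_shift lin_map_zero[OF lin_map_app] by simp
  show "shift_fun (stalk_dim F \<tau>) (rho (vsheaf_of (direct_sum Fs)) \<sigma> \<tau> v) =
      rho (vsheaf_of (direct_sum (F # Fs))) \<sigma> \<tau> (shift_fun (stalk_dim F \<sigma>) v)"
    unfolding vsheaf_of_simps app_res_direct_sum_Cons[OF F Fs le] z by simp
qed (simp_all add: lin_map_shift shift_fin_space)

text \<open>Recognition of a biproduct by its projections \<open>p\<close>, \<open>p'\<close> and
  injections \<open>q\<close>, \<open>q'\<close>.\<close>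

lemma v_iso_direct_sum_ConsI:
  assumes V: "is_vsheaf V"
    and p: "v_natural V (vsheaf_of F) p" and p': "v_natural V (vsheaf_of (direct_sum Fs)) p'"
    and q: "v_natural (vsheaf_of F) V q" and q': "v_natural (vsheaf_of (direct_sum Fs)) V q'"
    and inv: "\<And>\<sigma> x. x \<in> fin_space (stalk_dim F \<sigma>) \<Longrightarrow> p \<sigma> (q \<sigma> x) = x"
      "\<And>\<sigma> x. x \<in> fin_space (stalk_dim F \<sigma>) \<Longrightarrow> p' \<sigma> (q \<sigma> x) = 0"
      "\<And>\<sigma> y. y \<in> fin_space (stalk_dim (direct_sum Fs) \<sigma>) \<Longrightarrow> p \<sigma> (q' \<sigma> y) = 0"
      "\<And>\<sigma> y. y \<in> fin_space (stalk_dim (direct_sum Fs) \<sigma>) \<Longrightarrow> p' \<sigma> (q' \<sigma> y) = y"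
      "\<And>\<sigma> v. v \<in> stalk V \<sigma> \<Longrightarrow> q \<sigma> (p \<sigma> v) + q' \<sigma> (p' \<sigma> v) = v"
  shows "v_iso V (vsheaf_of (direct_sum (F # Fs)))"
proof -
  let ?f = "\<lambda>\<sigma> v. p \<sigma> v + shift_fun (stalk_dim F \<sigma>) (p' \<sigma> v)"
  let ?g = "\<lambda>\<sigma> w. q \<sigma> (mask_fun {..<stalk_dim F \<sigma>} w) + q' \<sigma> (tail_fun (stalk_dim F \<sigma>) w)"
  let ?n = "\<lambda>\<sigma>. stalk_dim F \<sigma>"
  have W: "is_vsheaf (vsheaf_of (direct_sum (F # Fs)))"
    by (rule is_vsheaf_of[OF sheaf_direct_sum_Cons[OF F Fs]])
  have f: "v_natural V (vsheaf_of (direct_sum (F # Fs))) ?f"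
    by (rule v_natural_plus[OF v_natural_compose[OF p v_natural_inl] v_natural_compose[OF p' v_natural_inr] W])
  have g: "v_natural (vsheaf_of (direct_sum (F # Fs))) V ?g"
    by (rule v_natural_plus[OF v_natural_compose[OF v_natural_head q] v_natural_compose[OF v_natural_tail q'] V])
  have "?g \<sigma> (?f \<sigma> v) = v" if v: "v \<in> stalk V \<sigma>" for \<sigma> v
  proof -
    have pv: "p \<sigma> v \<in> fin_space (?n \<sigma>)" using v_naturalD(2)[OF p v] by simp
    have "mask_fun {..<?n \<sigma>} (?f \<sigma> v) = p \<sigma> v" "tail_fun (?n \<sigma>) (?f \<sigma> v) = p' \<sigma> v"
      unfolding lin_map_add[OF lin_map_mask] lin_map_add[OF lin_map_tail] mask_shift tail_shift
        mask_fin_space_ident[OF pv] tail_fin_space_zero[OF pv] by simp_all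
    then show ?thesis using inv(5)[OF v] by metis
  qed
  moreover have "?f \<sigma> (?g \<sigma> w) = w" if w: "w \<in> fin_space (?n \<sigma> + stalk_dim (direct_sum Fs) \<sigma>)" for \<sigma> w
    unfolding lin_map_add[OF v_naturalD(1)[OF p]] lin_map_add[OF v_naturalD(1)[OF p']]
      inv(1,2)[OF mask_fin_space] inv(3,4)[OF tail_fin_space[OF w]]
    using mask_shift_tail by simp
  ultimately show ?thesis
    unfolding v_iso_def using f g by (intro exI[of _ ?f] exI[of _ ?g]) simp
qed

end

lemma v_isoE:
  assumes "v_iso F G"
  obtains f g where "v_natural F G f" "v_natural G F g"
    "\<And>\<sigma> v. v \<in> stalk F \<sigma> \<Longrightarrow> g \<sigma> (f \<sigma> v) = v" "\<And>\<sigma> v. v \<in> stalk G \<sigma> \<Longrightarrow> f \<sigma> (g \<sigma> v) = v"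
  using assms unfolding v_iso_def by blast

lemma v_iso_direct_sum_Cons_cong:
  fixes F G :: "('p::order, 'k::field) sheaf_data"
  assumes F: "sheaf F" and Fs: "sheaf (direct_sum Fs)" and G: "sheaf G" and Gs: "sheaf (direct_sum Gs)"
    and iso: "v_iso (vsheaf_of F) (vsheaf_of G)" "v_iso (vsheaf_of (direct_sum Fs)) (vsheaf_of (direct_sum Gs))"
  shows "v_iso (vsheaf_of (direct_sum (F # Fs))) (vsheaf_of (direct_sum (G # Gs)))"
proof -
  obtain f g where f: "v_natural (vsheaf_of F) (vsheaf_of G) f" "v_natural (vsheaf_of G) (vsheaf_of F) g"
    "\<And>\<sigma> v. v \<in> stalk (vsheaf_of F) \<sigma> \<Longrightarrow> g \<sigma> (f \<sigma> v) = v" "\<And>\<sigma> v. v \<in> stalk (vsheaf_of G) \<sigma> \<Longrightarrow> f \<sigma> (g \<sigma> v) = v"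
    using v_isoE[OF iso(1)] by blast
  obtain f' g' where f': "v_natural (vsheaf_of (direct_sum Fs)) (vsheaf_of (direct_sum Gs)) f'"
    "v_natural (vsheaf_of (direct_sum Gs)) (vsheaf_of (direct_sum Fs)) g'"
    "\<And>\<sigma> v. v \<in> stalk (vsheaf_of (direct_sum Fs)) \<sigma> \<Longrightarrow> g' \<sigma> (f' \<sigma> v) = v"
    "\<And>\<sigma> v. v \<in> stalk (vsheaf_of (direct_sum Gs)) \<sigma> \<Longrightarrow> f' \<sigma> (g' \<sigma> v) = v"
    using v_isoE[OF iso(2)] by blast
  note l = lin_map_zero[OF v_naturalD(1)[OF f(1)]] lin_map_zero[OF v_naturalD(1)[OF f'(1)]]
  have g0: "g \<sigma> x \<in> fin_space (stalk_dim F \<sigma>)" if "x \<in> fin_space (stalk_dim G \<sigma>)" for \<sigma> x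
    using v_naturalD(2)[OF f(2)] that by simp
  show ?thesis
  proof (rule v_iso_direct_sum_ConsI[OF G Gs is_vsheaf_of[OF sheaf_direct_sum_Cons[OF F Fs]]
        v_natural_compose[OF v_natural_head[OF F Fs] f(1)] v_natural_compose[OF v_natural_tail[OF F Fs] f'(1)]
        v_natural_compose[OF f(2) v_natural_inl[OF F Fs]] v_natural_compose[OF f'(2) v_natural_inr[OF F Fs]]])
    fix \<sigma> and x :: "nat \<Rightarrow> 'k" assume x: "x \<in> fin_space (stalk_dim G \<sigma>)"
    show "f \<sigma> (mask_fun {..<stalk_dim F \<sigma>} (g \<sigma> x)) = x"
      using f(4) x by (simp add: mask_fin_space_ident[OF g0[OF x]])
    show "f' \<sigma> (tail_fun (stalk_dim F \<sigma>) (g \<sigma> x)) = 0"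
      unfolding tail_fin_space_zero[OF g0[OF x]] by (rule l)
  next
    fix \<sigma> and y :: "nat \<Rightarrow> 'k" assume y: "y \<in> fin_space (stalk_dim (direct_sum Gs) \<sigma>)"
    show "f \<sigma> (mask_fun {..<stalk_dim F \<sigma>} (shift_fun (stalk_dim F \<sigma>) (g' \<sigma> y))) = 0"
      unfolding mask_shift by (rule l)
    show "f' \<sigma> (tail_fun (stalk_dim F \<sigma>) (shift_fun (stalk_dim F \<sigma>) (g' \<sigma> y))) = y"
      using f'(4) y by simp
  next
    fix \<sigma> and v :: "nat \<Rightarrow> 'k" assume v: "v \<in> stalk (vsheaf_of (direct_sum (F # Fs))) \<sigma>"
    then have "v \<in> fin_space (stalk_dim F \<sigma> + stalk_dim (direct_sum Fs) \<sigma>)" by simp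
    from f'(3)[unfolded vsheaf_of_simps, OF tail_fin_space[OF this]]
      f(3)[unfolded vsheaf_of_simps, OF mask_fin_space[of "stalk_dim F \<sigma>" v]]
    show "g \<sigma> (f \<sigma> (mask_fun {..<stalk_dim F \<sigma>} v)) +
        shift_fun (stalk_dim F \<sigma>) (g' \<sigma> (f' \<sigma> (tail_fun (stalk_dim F \<sigma>) v))) = v"
      by (simp only: mask_shift_tail)
  qed
qed

text \<open>\<open>indecomposable\<close> speaks of two-element lists, so the second summand turns
  up as \<open>direct_sum [B]\<close>, which has the same stalks as \<open>B\<close> and the same
  action of restrictions.\<close>

lemma v_natural_direct_sum_single:
  assumes B: "sheaf B"
  shows "v_natural V (vsheaf_of (direct_sum [B])) f \<longleftrightarrow> v_natural V (vsheaf_of B) f"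
    and "v_natural (vsheaf_of (direct_sum [B])) V f \<longleftrightarrow> v_natural (vsheaf_of B) V f"
proof -
  have nil: "sheaf (direct_sum [] :: ('a, 'b) sheaf_data)" by (rule sheaf_direct_sum) simp
  have z: "app (res (direct_sum [] :: ('a, 'b) sheaf_data) \<sigma> \<tau>) v = 0" for \<sigma> \<tau> v
    by (simp add: direct_sum_def app_zero)
  have "app (res (direct_sum [B]) \<sigma> \<tau>) v = app (res B \<sigma> \<tau>) v" if "\<sigma> \<le> \<tau>" for \<sigma> \<tau> v
    unfolding app_res_direct_sum_Cons[OF B nil that] z lin_map_zero[OF lin_map_shift] by simp
  then show "v_natural V (vsheaf_of (direct_sum [B])) f \<longleftrightarrow> v_natural V (vsheaf_of B) f"
    "v_natural (vsheaf_of (direct_sum [B])) V f \<longleftrightarrow> v_natural (vsheaf_of B) V f"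
    unfolding v_natural_def by auto
qed

section \<open>Splitting off a summand\<close>

text \<open>The kernel of a sheaf map is a family of subspaces, whereas \<open>sheaf_data\<close>
  wants stalks of the form \<open>fin_space r\<close>. A basis of \<open>W\<close>, enumerated by
  \<open>e\<close>, provides mutually inverse coordinate maps.\<close>

lemma subspace_coordinates:
  fixes W :: "(nat \<Rightarrow> 'k::field) set"
  assumes W: "fun_space.subspace W" and sub: "W \<subseteq> fin_space n"
  obtains r and u w :: "(nat \<Rightarrow> 'k) \<Rightarrow> nat \<Rightarrow> 'k" where "lin_map u" "lin_map w"
    "\<And>c. c \<in> fin_space r \<Longrightarrow> u c \<in> W" "\<And>c. c \<in> fin_space r \<Longrightarrow> w (u c) = c"
    "\<And>x. x \<in> W \<Longrightarrow> w x \<in> fin_space r" "\<And>x. x \<in> W \<Longrightarrow> u (w x) = x"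
proof -
  let ?U = "unit_fun :: nat \<Rightarrow> nat \<Rightarrow> 'k"
  have fin: "fin_space m = supp_space {..<m}" for m
    by (auto simp: fin_space_def supp_space_def not_less)
  have span: "fun_space.span (?U ` {..<m}) = fin_space m" for m
  proof
    show "fun_space.span (?U ` {..<m}) \<subseteq> fin_space m"
      by (rule fun_space.span_minimal[OF _ subspace_fin_space]) auto
    show "fin_space m \<subseteq> fun_space.span (?U ` {..<m})"
      unfolding fin using supp_space_subset_span[of "{..<m}"] by blast
  qed
  obtain B where B: "B \<subseteq> W" "fun_space.independent B" "W \<subseteq> fun_space.span B"
    by (rule fun_space.maximal_independent_subset)
  have WB: "W = fun_space.span B"
    using B(3) fun_space.span_minimal[OF B(1) W] by blast
  have "finite B"
    using fun_space.independent_span_bound[OF _ B(2), of "?U ` {..<n}"] B(1) sub span by auto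
  then obtain e where e: "bij_betw e {..<card B} B"
    using ex_bij_betw_nat_finite by (metis atLeast0LessThan)
  let ?r = "card B"
  have inj_unit: "inj ?U"
    by (rule injI) (metis unit_fun_apply zero_neq_one)
  obtain u where u: "lin_map u" "\<forall>x\<in>?U ` {..<?r}. u x = e (the_inv ?U x)"
    using fun_space_pair.linear_independent_extend[OF independent_unit_fun, of "{..<?r}" "\<lambda>x. e (the_inv ?U x)"] unfolding lin_map_def by blast
  obtain w where w: "lin_map w" "\<forall>x\<in>B. w x = ?U (the_inv_into {..<?r} e x)"
    using fun_space_pair.linear_independent_extend[OF B(2), of "\<lambda>x. ?U (the_inv_into {..<?r} e x)"] unfolding lin_map_def by blast
  have ue: "u (?U k) = e k" if "k < ?r" for k
    using u(2) that by (simp add: the_inv_f_f[OF inj_unit])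
  have we: "w (e k) = ?U k" if "k < ?r" for k
    using w(2) that e bij_betwE[OF e] by (simp add: the_inv_into_f_f bij_betw_imp_inj_on)
  have eB: "e k \<in> B" if "k < ?r" for k using bij_betwE[OF e] that by simp
  have Be: "\<exists>k<?r. x = e k" if "x \<in> B" for x using e that by (auto simp: bij_betw_def)
  note lw = lin_map_compose[OF w(1) u(1)] and lu = lin_map_compose[OF u(1) w(1)]
  show thesis
  proof
    show "u c \<in> W" if "c \<in> fin_space ?r" for c
    proof -
      have "u ` fun_space.span (?U ` {..<?r}) = fun_space.span (u ` ?U ` {..<?r})"
        using fun_space_pair.linear_span_image u(1) unfolding lin_map_def by blast
      also have "\<dots> \<subseteq> W" unfolding WB by (intro fun_space.span_mono) (auto simp: ue eB)
      finally show ?thesis using that unfolding span by blast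
    qed
    show "w x \<in> fin_space ?r" if "x \<in> W" for x
    proof -
      have "w ` fun_space.span B = fun_space.span (w ` B)"
        using fun_space_pair.linear_span_image w(1) unfolding lin_map_def by blast
      also have "\<dots> \<subseteq> fun_space.span (?U ` {..<?r})"
        by (intro fun_space.span_mono) (auto simp: we dest!: Be)
      finally show ?thesis using that unfolding span WB by blast
    qed
    show "w (u c) = c" if "c \<in> fin_space ?r" for c
    proof (rule fun_space_pair.linear_eq_on_span[OF lw[unfolded lin_map_def] lin_map_ident[unfolded lin_map_def]])
      show "c \<in> fun_space.span (?U ` {..<?r})" using that unfolding span .
    qed (auto simp: ue we)
    show "u (w x) = x" if "x \<in> W" for x
    proof (rule fun_space_pair.linear_eq_on_span[OF lu[unfolded lin_map_def] lin_map_ident[unfolded lin_map_def]])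
      show "x \<in> fun_space.span B" using that unfolding WB .
      show "u (w y) = y" if "y \<in> B" for y using Be[OF that] by (auto simp: ue we)
    qed
  qed (rule u(1) w(1))+
qed

text \<open>The composite of \<open>p\<close> and \<open>q\<close> is an idempotent on
  \<open>G\<close>, which therefore splits into the image of \<open>q\<close> and the kernel of
  \<open>p\<close>; the latter becomes \<open>B\<close> through coordinates chosen at each stalk.
  The last conclusion remembers that \<open>B\<close> stands for the kernel: where \<open>B\<close>
  vanishes, \<open>p\<close> is injective.\<close>

lemma split_retraction:
  fixes G E :: "('p::order, 'k::field) sheaf_data"
  assumes G: "sheaf G" and E: "sheaf E"
    and p: "v_natural (vsheaf_of G) (vsheaf_of E) p" and q: "v_natural (vsheaf_of E) (vsheaf_of G) q"
    and pq: "\<And>\<sigma> y. y \<in> fin_space (stalk_dim E \<sigma>) \<Longrightarrow> p \<sigma> (q \<sigma> y) = y"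
  obtains B where "sheaf B" "v_iso (vsheaf_of G) (vsheaf_of (direct_sum [E, B]))"
    "\<And>\<sigma> x. stalk_dim B \<sigma> = 0 \<Longrightarrow> x \<in> fin_space (stalk_dim G \<sigma>) \<Longrightarrow> p \<sigma> x = 0 \<Longrightarrow> x = 0"
proof -
  define W where "W \<sigma> = {x \<in> fin_space (stalk_dim G \<sigma>). p \<sigma> x = 0}" for \<sigma>
  have lp: "lin_map (p \<sigma>)" and lq: "lin_map (q \<sigma>)" for \<sigma> using v_naturalD(1)[OF p] v_naturalD(1)[OF q] by auto
  have subW: "fun_space.subspace (W \<sigma>)" for \<sigma>
    by (rule fun_space.subspaceI)
       (auto simp: W_def lin_map_simps[OF lp] fin_space_def)
  have "\<exists>r u w. lin_map u \<and> lin_map w \<and> (\<forall>c\<in>fin_space r. u c \<in> W \<sigma> \<and> w (u c) = c) \<and>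
      (\<forall>x\<in>W \<sigma>. w x \<in> fin_space r \<and> u (w x) = x)" for \<sigma>
  proof -
    have "W \<sigma> \<subseteq> fin_space (stalk_dim G \<sigma>)" by (auto simp: W_def)
    then show ?thesis
    proof (rule subspace_coordinates[OF subW])
      fix r and u w :: "(nat \<Rightarrow> 'k) \<Rightarrow> nat \<Rightarrow> 'k"
      assume "lin_map u" "lin_map w"
        "\<And>c. c \<in> fin_space r \<Longrightarrow> u c \<in> W \<sigma>" "\<And>c. c \<in> fin_space r \<Longrightarrow> w (u c) = c"
        "\<And>x. x \<in> W \<sigma> \<Longrightarrow> w x \<in> fin_space r" "\<And>x. x \<in> W \<sigma> \<Longrightarrow> u (w x) = x"
      then show ?thesis by (intro exI[of _ r] exI[of _ u] exI[of _ w]) simp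
    qed
  qed
  then obtain r u w where u: "\<And>\<sigma>. lin_map (u \<sigma>)" and w: "\<And>\<sigma>. lin_map (w \<sigma>)"
    and uW: "\<And>\<sigma> c. c \<in> fin_space (r \<sigma>) \<Longrightarrow> u \<sigma> c \<in> W \<sigma>" and wu: "\<And>\<sigma> c. c \<in> fin_space (r \<sigma>) \<Longrightarrow> w \<sigma> (u \<sigma> c) = c"
    and wW: "\<And>\<sigma> x. x \<in> W \<sigma> \<Longrightarrow> w \<sigma> x \<in> fin_space (r \<sigma>)" and uw: "\<And>\<sigma> x. x \<in> W \<sigma> \<Longrightarrow> u \<sigma> (w \<sigma> x) = x"
    by metis
  let ?V = "vsheaf_of G"
  note V = is_vsheaf_of[OF G]
  note VD = is_vsheafD[OF V, unfolded vsheaf_of_simps]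
  have resW: "app (res G \<sigma> \<tau>) x \<in> W \<tau>" if "\<sigma> \<le> \<tau>" "x \<in> W \<sigma>" for \<sigma> \<tau> x
    using v_naturalD(3)[OF p that(1), of x] VD(3)[OF that(1), of x] that(2)
    by (simp add: W_def lin_map_zero[OF lin_map_app])
  \<comment> \<open>Coordinates at different stalks are unrelated, so a restriction of
    \<open>B\<close> passes through the kernel inside \<open>G\<close> and back.\<close>
  define B where "B = \<lparr> stalk_dim = r,
     res = \<lambda>\<sigma> \<tau>. mat_of (r \<tau>) (r \<sigma>) (\<lambda>c. w \<tau> (app (res G \<sigma> \<tau>) (u \<sigma> c))) \<rparr>"
  have dimB: "stalk_dim B \<sigma> = r \<sigma>" for \<sigma> by (simp add: B_def)
  have resB: "app (res B \<sigma> \<tau>) c = w \<tau> (app (res G \<sigma> \<tau>) (u \<sigma> c))" if "\<sigma> \<le> \<tau>" "c \<in> fin_space (r \<sigma>)" for \<sigma> \<tau> c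
    unfolding B_def sheaf_data.simps
    by (rule app_mat_of[OF lin_map_compose[OF w lin_map_compose[OF lin_map_app u]] that(2)])
       (rule wW[OF resW[OF that(1) uW[OF that(2)]]])
  have B: "sheaf B"
  proof (rule sheaf_ofI)
    show "res B \<sigma> \<tau> \<in> carrier_mat (stalk_dim B \<tau>) (stalk_dim B \<sigma>)" for \<sigma> \<tau> by (simp add: B_def)
    show "is_vsheaf (vsheaf_of B)"
      unfolding is_vsheaf_def vsheaf_of_simps dimB
    proof (intro conjI allI impI)
      fix \<sigma> \<tau> and c :: "nat \<Rightarrow> 'k" assume "\<sigma> \<le> \<tau>" "c \<in> fin_space (r \<sigma>)"
      then show "app (res B \<sigma> \<tau>) c \<in> fin_space (r \<tau>)" by (simp add: resB wW resW uW)
    next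
      fix \<sigma> and c :: "nat \<Rightarrow> 'k" assume c: "c \<in> fin_space (r \<sigma>)"
      have "u \<sigma> c \<in> fin_space (stalk_dim G \<sigma>)" using uW[OF c] by (simp add: W_def)
      then show "app (res B \<sigma> \<sigma>) c = c"
        unfolding resB[OF order.refl c] using VD(4) wu[OF c] by simp
    next
      fix \<pi> \<sigma> \<tau> and c :: "nat \<Rightarrow> 'k" assume le: "\<pi> \<le> \<sigma>" "\<sigma> \<le> \<tau>" and c: "c \<in> fin_space (r \<pi>)"
      have "u \<pi> c \<in> fin_space (stalk_dim G \<pi>)" using uW[OF c] by (simp add: W_def)
      then show "app (res B \<sigma> \<tau>) (app (res B \<pi> \<sigma>) c) = app (res B \<pi> \<tau>) c"
        unfolding resB[OF le(1) c] resB[OF order.trans[OF le] c]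
          resB[OF le(2) wW[OF resW[OF le(1) uW[OF c]]]] uw[OF resW[OF le(1) uW[OF c]]]
        using VD(5)[OF le] by simp
    qed (rule subspace_fin_space lin_map_app)+
  qed
  \<comment> \<open>The complementary projection, onto the kernel of \<open>p\<close>.\<close>
  let ?k = "\<lambda>\<sigma> x. x - q \<sigma> (p \<sigma> x)"
  have k: "v_natural ?V ?V ?k"
    by (rule v_natural_minus[OF v_natural_id v_natural_compose[OF p q] V])
  have kW: "?k \<sigma> x \<in> W \<sigma>" if "x \<in> fin_space (stalk_dim G \<sigma>)" for \<sigma> x
    using v_naturalD(2)[OF k, of x \<sigma>] v_naturalD(2)[OF p, of x \<sigma>] pq that
    by (simp add: W_def lin_map_diff[OF lp])
  have p': "v_natural ?V (vsheaf_of B) (\<lambda>\<sigma> x. w \<sigma> (?k \<sigma> x))"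
    unfolding v_natural_def vsheaf_of_simps dimB
  proof (intro conjI allI impI)
    fix \<sigma>
    show "lin_map (\<lambda>x. w \<sigma> (?k \<sigma> x))" by (rule lin_map_compose[OF w v_naturalD(1)[OF k]])
    fix x :: "nat \<Rightarrow> 'k" assume x: "x \<in> fin_space (stalk_dim G \<sigma>)"
    show "w \<sigma> (?k \<sigma> x) \<in> fin_space (r \<sigma>)" by (rule wW[OF kW[OF x]])
    fix \<tau> assume le: "\<sigma> \<le> \<tau>"
    show "w \<tau> (?k \<tau> (app (res G \<sigma> \<tau>) x)) = app (res B \<sigma> \<tau>) (w \<sigma> (?k \<sigma> x))"
      unfolding resB[OF le wW[OF kW[OF x]]] uw[OF kW[OF x]]
      using v_naturalD(3)[OF k le, of x] x by simp
  qed
  have q': "v_natural (vsheaf_of B) ?V u"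
    unfolding v_natural_def vsheaf_of_simps dimB
  proof (intro conjI allI impI)
    fix \<sigma> and c :: "nat \<Rightarrow> 'k" assume c: "c \<in> fin_space (r \<sigma>)"
    show "u \<sigma> c \<in> fin_space (stalk_dim G \<sigma>)" using uW[OF c] by (simp add: W_def)
    fix \<tau> assume le: "\<sigma> \<le> \<tau>"
    show "u \<tau> (app (res B \<sigma> \<tau>) c) = app (res G \<sigma> \<tau>) (u \<sigma> c)"
      unfolding resB[OF le c] by (rule uw[OF resW[OF le uW[OF c]]])
  qed (rule u)
  have Bs: "sheaf (direct_sum [B])" using sheaf_direct_sum[of "[B]"] B by simp
  have "v_iso ?V (vsheaf_of (direct_sum (E # [B])))"
  proof (rule v_iso_direct_sum_ConsI[OF E Bs V p _ q])
    show "v_natural ?V (vsheaf_of (direct_sum [B])) (\<lambda>\<sigma> x. w \<sigma> (?k \<sigma> x))"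
      "v_natural (vsheaf_of (direct_sum [B])) ?V u"
      using p' q' unfolding v_natural_direct_sum_single[OF B] .
    fix \<sigma>
    show "p \<sigma> (q \<sigma> y) = y" "w \<sigma> (?k \<sigma> (q \<sigma> y)) = 0" if "y \<in> fin_space (stalk_dim E \<sigma>)" for y
      using pq[OF that] lin_map_zero[OF w] by simp_all
    show "p \<sigma> (u \<sigma> c) = 0" "w \<sigma> (?k \<sigma> (u \<sigma> c)) = c" if "c \<in> fin_space (stalk_dim (direct_sum [B]) \<sigma>)" for c
    proof -
      have c: "c \<in> fin_space (r \<sigma>)" using that by (simp add: dimB)
      then show *: "p \<sigma> (u \<sigma> c) = 0" using uW by (simp add: W_def)
      show "w \<sigma> (?k \<sigma> (u \<sigma> c)) = c" unfolding * lin_map_zero[OF lq] using wu[OF c] by simp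
    qed
    show "q \<sigma> (p \<sigma> v) + u \<sigma> (w \<sigma> (?k \<sigma> v)) = v" if "v \<in> stalk ?V \<sigma>" for v
      using uw[OF kW[of v \<sigma>]] that by simp
  qed
  moreover have "x = 0" if "stalk_dim B \<sigma> = 0" "x \<in> fin_space (stalk_dim G \<sigma>)" "p \<sigma> x = 0" for \<sigma> x
  proof -
    have x: "x \<in> W \<sigma>" using that by (simp add: W_def)
    have "w \<sigma> x = 0" using wW[OF x] that(1) by (auto simp: dimB fin_space_def)
    then show ?thesis using uw[OF x] lin_map_zero[OF u] by metis
  qed
  ultimately show thesis using B that by blast
qed

section \<open>Counting indecomposable summands\<close>

lemma sheaf_elem: "sheaf (elem_sheaf \<pi> :: ('p::order, 'k::field) sheaf_data)"
proof -
  show ?thesis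
    unfolding sheaf_def
  proof (intro conjI allI impI)
    fix \<rho> \<sigma> \<tau> :: 'p assume "\<rho> \<le> \<sigma> \<and> \<sigma> \<le> \<tau>"
    then show "res (elem_sheaf \<pi> :: ('p, 'k) sheaf_data) \<sigma> \<tau> * res (elem_sheaf \<pi>) \<rho> \<sigma> = res (elem_sheaf \<pi>) \<rho> \<tau>"
      using order.trans[of \<sigma> \<tau> \<pi>] by (auto simp: elem_sheaf_def)
  qed (use res_elem_carrier in \<open>auto simp: elem_sheaf_def\<close>)
qed

lemma stalk_dim_elem: "stalk_dim (elem_sheaf \<pi>) \<sigma> = (if \<sigma> \<le> \<pi> then 1 else 0)"
  by (simp add: elem_sheaf_def)

lemma app_res_elem:
  "app (res (elem_sheaf \<pi>) \<sigma> \<tau>) y = (if \<tau> \<le> \<pi> then mask_fun {..<1} y else 0)"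
  using app_mask[of "1\<^sub>m 1" 1 1 y] app_one[OF mask_fin_space[of 1 y]]
  by (auto simp: elem_sheaf_def app_zero)

text \<open>Endomorphisms of \<open>[\<pi>]\<close> are scalars, so the idempotent induced by the
  projection to \<open>A\<close> is 0 or 1, and \<open>A\<close> or \<open>B\<close> vanishes
  accordingly.\<close>

lemma indecomposable_elem: "indecomposable (elem_sheaf \<pi> :: ('p::order, 'k::field) sheaf_data)"
  unfolding indecomposable_def
proof (intro conjI allI impI)
  let ?E = "elem_sheaf \<pi> :: ('p, 'k) sheaf_data"
  show "sheaf ?E" by (rule sheaf_elem)
  show "\<not> zero_sheaf ?E" by (auto simp: zero_sheaf_def stalk_dim_elem intro!: exI[of _ \<pi>])
  fix A B :: "('p, 'k) sheaf_data" assume *: "sheaf A \<and> sheaf B \<and> sheaf_iso ?E (direct_sum [A, B])"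
  then have A: "sheaf A" and B: "sheaf B" by auto
  have Bs: "sheaf (direct_sum [B])" using sheaf_direct_sum[of "[B]"] B by simp
  have S: "sheaf (direct_sum [A, B])" by (rule sheaf_direct_sum) (use A B in auto)
  obtain f g where f: "v_natural (vsheaf_of ?E) (vsheaf_of (direct_sum [A, B])) f"
    and g: "v_natural (vsheaf_of (direct_sum [A, B])) (vsheaf_of ?E) g"
    and gf: "\<And>\<sigma> v. v \<in> stalk (vsheaf_of ?E) \<sigma> \<Longrightarrow> g \<sigma> (f \<sigma> v) = v"
    and fg: "\<And>\<sigma> v. v \<in> stalk (vsheaf_of (direct_sum [A, B])) \<sigma> \<Longrightarrow> f \<sigma> (g \<sigma> v) = v"
    using * v_isoE sheaf_iso_iff_v_iso[OF sheaf_elem S] by metis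
  define m where "m \<sigma> = (mask_fun {..<stalk_dim A \<sigma>} :: (nat \<Rightarrow> 'k) \<Rightarrow> nat \<Rightarrow> 'k)" for \<sigma>
  define e where "e \<sigma> v = g \<sigma> (m \<sigma> (f \<sigma> v))" for \<sigma> v
  have mm: "m \<sigma> (m \<sigma> v) = m \<sigma> v" for \<sigma> v by (auto simp: m_def fun_eq_iff)
  have m: "v_natural (vsheaf_of (direct_sum [A, B])) (vsheaf_of (direct_sum [A, B])) m"
    unfolding m_def using v_natural_compose[OF v_natural_head[OF A Bs] v_natural_inl[OF A Bs]] by simp
  have e: "v_natural (vsheaf_of ?E) (vsheaf_of ?E) e"
    unfolding e_def by (rule v_natural_compose[OF v_natural_compose[OF f m] g])
  let ?u = "unit_fun 0 :: nat \<Rightarrow> 'k"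
  define c where "c = e \<pi> ?u 0"
  have scal: "y = fun_scale (y 0) ?u" if "y \<in> fin_space 1" for y
    using that by (auto simp: fin_space_def fun_eq_iff unit_fun_apply)
  have ec: "e \<sigma> y = fun_scale c y" if le: "\<sigma> \<le> \<pi>" and y: "y \<in> fin_space 1" for \<sigma> y
  proof -
    have s: "y \<in> stalk (vsheaf_of ?E) \<sigma>" using le y by (simp add: stalk_dim_elem)
    have 1: "e \<sigma> y \<in> fin_space 1" using v_naturalD(2)[OF e s] le by (simp add: stalk_dim_elem)
    have "e \<pi> ?u \<in> fin_space 1" using v_naturalD(2)[OF e, of ?u \<pi>] by (simp add: stalk_dim_elem)
    then have eu: "e \<pi> ?u = fun_scale c ?u" unfolding c_def by (rule scal)
    \<comment> \<open>Restriction from \<sigma> to \<pi> is the identity on the one-dimensional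
      stalk, so naturality forces the same scalar at \<sigma> as at \<pi>.\<close>
    have "e \<sigma> y = e \<pi> y"
      using v_naturalD(3)[OF e le s] mask_fin_space_ident[OF y] mask_fin_space_ident[OF 1]
      by (simp add: app_res_elem)
    also have "\<dots> = fun_scale (y 0) (e \<pi> ?u)"
      by (subst scal[OF y]) (rule lin_map_scale[OF v_naturalD(1)[OF e]])
    also have "\<dots> = fun_scale c (fun_scale (y 0) ?u)"
      unfolding eu by (simp add: fun_eq_iff)
    finally show ?thesis using scal[OF y] by simp
  qed
  have u1: "?u \<in> fin_space 1" by simp
  have fm: "m \<pi> (f \<pi> ?u) \<in> stalk (vsheaf_of (direct_sum [A, B])) \<pi>"
    by (rule v_naturalD(2)[OF m v_naturalD(2)[OF f]]) (simp add: stalk_dim_elem)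
  have "e \<pi> (e \<pi> ?u) = e \<pi> ?u"
    unfolding e_def fg[OF fm] mm ..
  moreover have eu: "e \<pi> ?u = fun_scale c ?u" by (rule ec[OF order.refl u1])
  ultimately have "fun_scale c (fun_scale c ?u) 0 = fun_scale c ?u 0"
    using lin_map_scale[OF v_naturalD(1)[OF e], of \<pi> c ?u] by metis
  then have "c = 0 \<or> c = 1" by (auto simp: unit_fun_apply)
  have out: "e \<sigma> y = fun_scale c y" if y: "y \<in> stalk (vsheaf_of ?E) \<sigma>" for \<sigma> y
  proof (cases "\<sigma> \<le> \<pi>")
    case True
    then show ?thesis using y by (intro ec) (simp_all add: stalk_dim_elem)
  next
    case False
    have "y = 0" using y False by (auto simp: stalk_dim_elem fin_space_def)
    then show ?thesis using lin_map_zero[OF v_naturalD(1)[OF e]] fun_space.scale_zero_right by metis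
  qed
  \<comment> \<open>Conjugated back by the isomorphism, the projection to \<open>A\<close> is itself
    multiplication by \<open>c\<close>.\<close>
  have mc: "m \<sigma> v = fun_scale c v" if v: "v \<in> stalk (vsheaf_of (direct_sum [A, B])) \<sigma>" for \<sigma> v
  proof -
    have "m \<sigma> v = f \<sigma> (g \<sigma> (m \<sigma> (f \<sigma> (g \<sigma> v))))"
      unfolding fg[OF v] using fg[OF v_naturalD(2)[OF m v]] by simp
    also have "\<dots> = f \<sigma> (fun_scale c (g \<sigma> v))"
      using out[OF v_naturalD(2)[OF g v]] by (simp add: e_def)
    also have "\<dots> = fun_scale c v"
      unfolding lin_map_scale[OF v_naturalD(1)[OF f]] fg[OF v] ..
    finally show ?thesis .
  qed
  from \<open>c = 0 \<or> c = 1\<close> show "zero_sheaf A \<or> zero_sheaf B"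
  proof
    assume c: "c = 0"
    have "stalk_dim A \<sigma> = 0" for \<sigma>
    proof (rule ccontr)
      assume "stalk_dim A \<sigma> \<noteq> 0"
      then have "m \<sigma> ?u = fun_scale c ?u" "0 < stalk_dim A \<sigma>" by (auto intro!: mc)
      then have "m \<sigma> ?u 0 = 0" using c by simp
      then show False using \<open>0 < stalk_dim A \<sigma>\<close> by (simp add: m_def unit_fun_apply)
    qed
    then show ?thesis by (simp add: zero_sheaf_def)
  next
    assume c: "c = 1"
    have "stalk_dim B \<sigma> = 0" for \<sigma>
    proof (rule ccontr)
      assume "stalk_dim B \<sigma> \<noteq> 0"
      \<comment> \<open>The first coordinate that belongs to \<open>B\<close>; the projection to
        \<open>A\<close> kills it.\<close>
      let ?v = "unit_fun (stalk_dim A \<sigma>) :: nat \<Rightarrow> 'k"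
      have "m \<sigma> ?v = fun_scale c ?v" using \<open>stalk_dim B \<sigma> \<noteq> 0\<close> by (intro mc) simp
      then have "m \<sigma> ?v (stalk_dim A \<sigma>) = 1" using c by (simp add: unit_fun_apply)
      then show False by (simp add: m_def)
    qed
    then show ?thesis by (simp add: zero_sheaf_def)
  qed
qed

text \<open>At a maximal element \<pi> of the support of \<open>G\<close>, sections restrict to zero
  strictly above, so \<open>a\<close> sends a nonzero one to a vector \<open>w\<close> supported on
  positions labeled \<pi>. A nonzero coordinate of \<open>w\<close> gives a map from
  \<open>G\<close> to \<open>[\<pi>]\<close>, and \<open>w\<close> gives through \<open>r\<close> a
  map back; so \<open>[\<pi>]\<close> splits off, and indecomposability leaves no
  complement.\<close>

lemma indecomposable_retract:
  fixes G :: "('p::{finite,order}, 'k::field) sheaf_data"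
  assumes G: "indecomposable G"
    and a: "v_natural (vsheaf_of G) (pos_sheaf ls) a" and r: "v_natural (pos_sheaf ls) (vsheaf_of G) r"
    and ra: "\<And>\<sigma> v. v \<in> fin_space (stalk_dim G \<sigma>) \<Longrightarrow> r \<sigma> (a \<sigma> v) = v"
  shows "\<exists>\<pi>. v_iso (vsheaf_of G) (vsheaf_of (elem_sheaf \<pi>))"
proof -
  have Gs: "sheaf G" and nz: "\<not> zero_sheaf G"
    using G by (auto simp: indecomposable_def)
  have "\<exists>\<pi>\<in>{\<sigma>. stalk_dim G \<sigma> \<noteq> 0}. \<forall>\<tau>\<in>{\<sigma>. stalk_dim G \<sigma> \<noteq> 0}. \<pi> \<le> \<tau> \<longrightarrow> \<pi> = \<tau>"
    using nz by (intro finite_has_maximal) (auto simp: zero_sheaf_def)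
  then obtain \<pi> where \<pi>: "stalk_dim G \<pi> \<noteq> 0" "\<And>\<tau>. \<pi> < \<tau> \<Longrightarrow> stalk_dim G \<tau> = 0"
    by fastforce
  let ?E = "elem_sheaf \<pi> :: ('p, 'k) sheaf_data"
  define v where "v = (unit_fun 0 :: nat \<Rightarrow> 'k)"
  define w where "w = a \<pi> v"
  have v: "v \<in> fin_space (stalk_dim G \<pi>)" using \<pi>(1) by (simp add: v_def)
  have w: "w \<in> supp_space (label_positions ls \<pi>)"
    unfolding socle_pos_sheaf
  proof (intro conjI allI impI)
    show "w \<in> stalk (pos_sheaf ls) \<pi>"
      unfolding w_def using v_naturalD(2)[OF a, of v \<pi>] v by simp
    fix \<tau> assume "\<pi> < \<tau>"
    then have "app (res G \<pi> \<tau>) v \<in> fin_space 0"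
      using app_fin_space[OF sheafD(1)[OF Gs, of \<pi> \<tau>]] \<pi>(2) by (metis less_imp_le)
    then have "app (res G \<pi> \<tau>) v = 0" by (auto simp: fin_space_def)
    then show "rho (pos_sheaf ls) \<pi> \<tau> w = 0"
      unfolding w_def
      using v_naturalD(3)[OF a less_imp_le[OF \<open>\<pi> < \<tau>\<close>], of v] v lin_map_zero[OF v_naturalD(1)[OF a]]
      by (metis vsheaf_of_simps)
  qed
  have "w \<noteq> 0"
  proof
    assume "w = 0"
    then have "v = 0" using ra[OF v] lin_map_zero[OF v_naturalD(1)[OF r]] unfolding w_def by metis
    then have "v 0 = 0" by (metis zero_fun_apply)
    then show False by (simp add: v_def unit_fun_apply)
  qed
  then obtain i where i: "w i \<noteq> 0" by (auto simp: fun_eq_iff)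
  then have i\<pi>: "i \<in> label_positions ls \<pi>" using w by (auto simp: supp_space_def)
  have isup: "i \<in> pos_support ls \<sigma>" if "\<sigma> \<le> \<pi>" for \<sigma>
    using i\<pi> that by (auto simp: label_positions_def pos_support_def)
  \<comment> \<open>Dividing by \<open>w i\<close> makes the composite of \<open>q\<close> and
    \<open>p\<close> the identity of \<open>[\<pi>]\<close>.\<close>
  define p where "p \<sigma> x = (\<lambda>k :: nat. if \<sigma> \<le> \<pi> \<and> k = 0 then a \<sigma> x i / w i else 0)" for \<sigma> and x :: "nat \<Rightarrow> 'k"
  \<comment> \<open>Being supported on positions labeled \<pi>, the vector \<open>w\<close> is a
    section over every \<sigma> \<le> \<pi>, compatibly with restriction; so the generator of
    \<open>[\<pi>]\<close> may be sent to its image under \<open>r\<close>.\<close>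
  define q where "q \<sigma> y = r \<sigma> (if \<sigma> \<le> \<pi> then fun_scale (y 0) w else 0)" for \<sigma> and y :: "nat \<Rightarrow> 'k"
  note al = lin_map_simps[OF v_naturalD(1)[OF a]] and rl = lin_map_simps[OF v_naturalD(1)[OF r]]
  have mw: "mask_fun (pos_support ls \<tau>) w = (if \<tau> \<le> \<pi> then w else 0)" for \<tau>
    using w by (auto simp: fun_eq_iff supp_space_def label_positions_def pos_support_def)
  have ws: "w \<in> stalk (pos_sheaf ls) \<sigma>" if "\<sigma> \<le> \<pi>" for \<sigma>
    using mw[of \<sigma>] mask_stalk[of ls \<sigma> w] that by simp
  have subs: "fun_space.subspace (stalk (pos_sheaf ls) \<sigma> :: (nat \<Rightarrow> 'k) set)" for \<sigma>
    by (rule is_vsheafD(1)[OF is_vsheaf_pos])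
  have p: "v_natural (vsheaf_of G) (vsheaf_of ?E) p"
    unfolding v_natural_def vsheaf_of_simps stalk_dim_elem
  proof (intro conjI allI impI)
    fix \<sigma>
    show "lin_map (p \<sigma>)"
      by (rule lin_mapI) (auto simp: p_def al fun_eq_iff add_divide_distrib)
    show "p \<sigma> x \<in> fin_space (if \<sigma> \<le> \<pi> then 1 else 0)" for x
      by (auto simp: p_def fin_space_def)
    fix \<tau> and x :: "nat \<Rightarrow> 'k" assume le: "\<sigma> \<le> \<tau>" and x: "x \<in> fin_space (stalk_dim G \<sigma>)"
    show "p \<tau> (app (res G \<sigma> \<tau>) x) = app (res ?E \<sigma> \<tau>) (p \<sigma> x)"
      using v_naturalD(3)[OF a le, of x] x isup[of \<tau>] order.trans[OF le, of \<pi>]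
      unfolding app_res_elem by (auto simp: p_def fun_eq_iff rho_pos_sheaf)
  qed
  have q: "v_natural (vsheaf_of ?E) (vsheaf_of G) q"
    unfolding v_natural_def vsheaf_of_simps
  proof (intro conjI allI impI)
    fix \<sigma>
    show "lin_map (q \<sigma>)"
      by (rule lin_mapI) (simp_all add: q_def rl fun_space.scale_left_distrib)
    have z: "(if \<sigma> \<le> \<pi> then fun_scale (y 0) w else 0) \<in> stalk (pos_sheaf ls) \<sigma>" for y :: "nat \<Rightarrow> 'k"
      using ws fun_space.subspace_scale[OF subs] fun_space.subspace_0[OF subs] by simp
    show "q \<sigma> y \<in> fin_space (stalk_dim G \<sigma>)" for y
      unfolding q_def using v_naturalD(2)[OF r z] by simp
    fix \<tau> and y :: "nat \<Rightarrow> 'k" assume le: "\<sigma> \<le> \<tau>"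
    have c1: "app (res G \<sigma> \<tau>) (q \<sigma> y) = r \<tau> (mask_fun (pos_support ls \<tau>) (if \<sigma> \<le> \<pi> then fun_scale (y 0) w else 0))"
      using v_naturalD(3)[OF r le z[of y]] by (simp add: q_def rho_pos_sheaf)
    have c2: "mask_fun (pos_support ls \<tau>) (if \<sigma> \<le> \<pi> then fun_scale (y 0) w else 0) =
        (if \<tau> \<le> \<pi> then fun_scale (y 0) w else 0)"
      using order.trans[OF le, of \<pi>] lin_map_scale[OF lin_map_mask, of "pos_support ls \<tau>" "y 0" w] mw[of \<tau>]
        lin_map_zero[OF lin_map_mask, of "pos_support ls \<tau>"]
      by auto
    show "q \<tau> (app (res ?E \<sigma> \<tau>) y) = app (res G \<sigma> \<tau>) (q \<sigma> y)"
    proof (cases "\<tau> \<le> \<pi>")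
      case True
      then have "app (res ?E \<sigma> \<tau>) y 0 = y 0" by (simp add: app_res_elem)
      then show ?thesis
        using True c1[unfolded c2] unfolding q_def by (simp only: if_True)
    next
      case False
      then show ?thesis
        using c1[unfolded c2] unfolding q_def by (simp only: if_False)
    qed
  qed
  have pq: "p \<sigma> (q \<sigma> y) = y" if y: "y \<in> fin_space (stalk_dim ?E \<sigma>)" for \<sigma> y
  proof (cases "\<sigma> \<le> \<pi>")
    case True
    have s: "r \<sigma> w \<in> fin_space (stalk_dim G \<sigma>)" using v_naturalD(2)[OF r ws[OF True]] by simp
    \<comment> \<open>Coordinate \<open>i\<close> can be read off after restriction to \<pi>, where
      \<open>r\<close> sends \<open>w\<close> back to \<open>v\<close> and \<open>a\<close> sends
      \<open>v\<close> to \<open>w\<close>.\<close>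
    have "a \<sigma> (r \<sigma> w) i = mask_fun (pos_support ls \<pi>) (a \<sigma> (r \<sigma> w)) i"
      using isup[of \<pi>] by simp
    also have "mask_fun (pos_support ls \<pi>) (a \<sigma> (r \<sigma> w)) = a \<pi> (app (res G \<sigma> \<pi>) (r \<sigma> w))"
      using v_naturalD(3)[OF a True, of "r \<sigma> w"] s by (simp add: rho_pos_sheaf)
    also have "app (res G \<sigma> \<pi>) (r \<sigma> w) = r \<pi> (mask_fun (pos_support ls \<pi>) w)"
      using v_naturalD(3)[OF r True ws[OF True]] by (simp add: rho_pos_sheaf)
    also have "\<dots> = v" unfolding mw using ra[OF v] by (simp add: w_def)
    finally have "a \<sigma> (r \<sigma> w) i = w i" by (simp add: w_def)
    then have "p \<sigma> (q \<sigma> y) k = y k" for k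
      using True y i by (auto simp: p_def q_def rl al stalk_dim_elem fin_space_def)
    then show ?thesis by blast
  next
    case False
    then have "y = 0" using y by (auto simp: stalk_dim_elem fin_space_def)
    then show ?thesis using lin_map_zero[OF v_naturalD(1)[OF p]] lin_map_zero[OF v_naturalD(1)[OF q]] by metis
  qed
  obtain B where B: "sheaf B" "v_iso (vsheaf_of G) (vsheaf_of (direct_sum [?E, B]))"
    and ker: "\<And>\<sigma> x. stalk_dim B \<sigma> = 0 \<Longrightarrow> x \<in> fin_space (stalk_dim G \<sigma>) \<Longrightarrow> p \<sigma> x = 0 \<Longrightarrow> x = 0"
    using split_retraction[OF Gs sheaf_elem p q pq] by blast
  have "sheaf (direct_sum [?E, B])" by (rule sheaf_direct_sum) (use B(1) sheaf_elem in auto)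
  then have "sheaf_iso G (direct_sum [?E, B])" using B(2) sheaf_iso_iff_v_iso[OF Gs] by blast
  then have "zero_sheaf ?E \<or> zero_sheaf B" using G B(1) sheaf_elem unfolding indecomposable_def by blast
  moreover have "\<not> zero_sheaf ?E" by (auto simp: zero_sheaf_def stalk_dim_elem intro!: exI[of _ \<pi>])
  ultimately have B0: "stalk_dim B \<sigma> = 0" for \<sigma> unfolding zero_sheaf_def by blast
  have "q \<sigma> (p \<sigma> x) = x" if x: "x \<in> fin_space (stalk_dim G \<sigma>)" for \<sigma> x
  proof -
    have px: "p \<sigma> x \<in> fin_space (stalk_dim ?E \<sigma>)" using v_naturalD(2)[OF p] x by simp
    have "x - q \<sigma> (p \<sigma> x) = 0"
    proof (rule ker[OF B0])
      show "x - q \<sigma> (p \<sigma> x) \<in> fin_space (stalk_dim G \<sigma>)"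
        using v_naturalD(2)[OF q, of "p \<sigma> x" \<sigma>] px x by (intro fun_space.subspace_diff[OF subspace_fin_space]) simp_all
      show "p \<sigma> (x - q \<sigma> (p \<sigma> x)) = 0"
        unfolding lin_map_diff[OF v_naturalD(1)[OF p]] pq[OF px] by simp
    qed
    then show ?thesis by simp
  qed
  then have "v_iso (vsheaf_of G) (vsheaf_of ?E)"
    unfolding v_iso_def vsheaf_of_simps using p q pq by blast
  then show ?thesis by blast
qed

text \<open>A summand of a retract of \<open>pos_sheaf ls\<close> is again such a retract, whereas
  an isomorphism would not pass to the tail of the list. Hence the induction runs over retracts with
  a fixed \<open>ls\<close>.\<close>

lemma indecomposable_sum_retract:
  fixes Fs :: "('p::{finite,order}, 'k::field) sheaf_data list"
  assumes "\<And>F. F \<in> set Fs \<Longrightarrow> indecomposable F"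
    and "v_natural (vsheaf_of (direct_sum Fs)) (pos_sheaf ls) a" "v_natural (pos_sheaf ls) (vsheaf_of (direct_sum Fs)) r"
    and "\<And>\<sigma> v. v \<in> fin_space (stalk_dim (direct_sum Fs) \<sigma>) \<Longrightarrow> r \<sigma> (a \<sigma> v) = v"
  shows "\<exists>\<rho>s. length \<rho>s = length Fs \<and> v_iso (vsheaf_of (direct_sum Fs)) (vsheaf_of (inj_sum \<rho>s))"
  using assms
proof (induction Fs arbitrary: a r)
  case Nil
  have "v_iso (vsheaf_of (direct_sum [] :: ('p, 'k) sheaf_data)) (vsheaf_of (inj_sum []))"
    unfolding v_iso_def by (intro exI[of _ "\<lambda>_ v. v"]) (simp add: v_natural_id)
  then show ?case by (intro exI[of _ "[]"]) simp
next
  case (Cons F Fs)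
  have F: "sheaf F" and Fs: "sheaf (direct_sum Fs)"
    using Cons.prems(1) by (auto simp: indecomposable_def intro: sheaf_direct_sum)
  note a = Cons.prems(2) and r = Cons.prems(3) and ra = Cons.prems(4)
  have "\<exists>\<pi>. v_iso (vsheaf_of F) (vsheaf_of (elem_sheaf \<pi>))"
  proof (rule indecomposable_retract)
    show "indecomposable F" using Cons.prems(1) by simp
    show "v_natural (vsheaf_of F) (pos_sheaf ls) a"
      using v_natural_compose[OF v_natural_inl[OF F Fs] a] .
    show "v_natural (pos_sheaf ls) (vsheaf_of F) (\<lambda>\<sigma> c. mask_fun {..<stalk_dim F \<sigma>} (r \<sigma> c))"
      using v_natural_compose[OF r v_natural_head[OF F Fs]] .
    show "mask_fun {..<stalk_dim F \<sigma>} (r \<sigma> (a \<sigma> v)) = v" if "v \<in> fin_space (stalk_dim F \<sigma>)" for \<sigma> v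
      using ra[of v \<sigma>] fin_space_mono[OF that] mask_fin_space_ident[OF that] by simp
  qed
  then obtain \<pi> where \<pi>: "v_iso (vsheaf_of F) (vsheaf_of (elem_sheaf \<pi>))" by blast
  have "\<exists>\<rho>s. length \<rho>s = length Fs \<and> v_iso (vsheaf_of (direct_sum Fs)) (vsheaf_of (inj_sum \<rho>s))"
  proof (rule Cons.IH)
    show "indecomposable G" if "G \<in> set Fs" for G using Cons.prems(1) that by simp
    show "v_natural (vsheaf_of (direct_sum Fs)) (pos_sheaf ls) (\<lambda>\<sigma> y. a \<sigma> (shift_fun (stalk_dim F \<sigma>) y))"
      using v_natural_compose[OF v_natural_inr[OF F Fs] a] .
    show "v_natural (pos_sheaf ls) (vsheaf_of (direct_sum Fs)) (\<lambda>\<sigma> c. tail_fun (stalk_dim F \<sigma>) (r \<sigma> c))"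
      using v_natural_compose[OF r v_natural_tail[OF F Fs]] .
    show "tail_fun (stalk_dim F \<sigma>) (r \<sigma> (a \<sigma> (shift_fun (stalk_dim F \<sigma>) v))) = v"
      if "v \<in> fin_space (stalk_dim (direct_sum Fs) \<sigma>)" for \<sigma> v
      using ra[of "shift_fun (stalk_dim F \<sigma>) v" \<sigma>] shift_fin_space[OF that] by simp
  qed
  then obtain \<rho>s where \<rho>s: "length \<rho>s = length Fs" "v_iso (vsheaf_of (direct_sum Fs)) (vsheaf_of (inj_sum \<rho>s))" by blast
  have "v_iso (vsheaf_of (direct_sum (F # Fs))) (vsheaf_of (inj_sum (\<pi> # \<rho>s)))"
    using v_iso_direct_sum_Cons_cong[OF F Fs sheaf_elem sheaf_inj_sum \<pi> \<rho>s(2)] by simp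
  then show ?case using \<rho>s(1) by (intro exI[of _ "\<pi> # \<rho>s"]) simp
qed

text \<open>The definite description requires uniqueness of the length: any decomposition into
  indecomposables is first replaced by one into sheaves \<open>[\<rho>]\<close> of the same length,
  and then the multiplicities of labels are compared.\<close>

lemma num_indecomposable_summands_eq:
  fixes F :: "('p::{finite,order}, 'k::field) sheaf_data"
  assumes F: "sheaf F" and iso: "sheaf_iso F (inj_sum ls)"
  shows "num_indecomposable_summands F = length ls"
  unfolding num_indecomposable_summands_def
proof (rule the_equality)
  show "\<exists>Fs. (\<forall>G\<in>set Fs. indecomposable G) \<and> sheaf_iso F (direct_sum Fs) \<and> length Fs = length ls"
    using iso indecomposable_elem by (intro exI[of _ "map elem_sheaf ls"]) auto
  fix m
  assume "\<exists>Fs. (\<forall>G\<in>set Fs. indecomposable G) \<and> sheaf_iso F (direct_sum Fs) \<and> length Fs = m"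
  then obtain Fs where Fs: "\<And>G. G \<in> set Fs \<Longrightarrow> indecomposable G" "sheaf_iso F (direct_sum Fs)" "length Fs = m"
    by blast
  have S: "sheaf (direct_sum Fs)"
    by (rule sheaf_direct_sum) (use Fs(1) in \<open>auto simp: indecomposable_def\<close>)
  have FL: "v_iso (vsheaf_of F) (pos_sheaf ls)"
    using iso sheaf_iso_iff_v_iso[OF F sheaf_inj_sum] v_iso_trans[OF _ v_iso_inj_sum] by blast
  have 1: "v_iso (vsheaf_of (direct_sum Fs)) (pos_sheaf ls)"
    using Fs(2) sheaf_iso_iff_v_iso[OF F S] v_iso_trans[OF v_iso_sym FL] by blast
  then obtain a r where "v_natural (vsheaf_of (direct_sum Fs)) (pos_sheaf ls) a"
    "v_natural (pos_sheaf ls) (vsheaf_of (direct_sum Fs)) r"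
    "\<And>\<sigma> v. v \<in> fin_space (stalk_dim (direct_sum Fs) \<sigma>) \<Longrightarrow> r \<sigma> (a \<sigma> v) = v"
    unfolding v_iso_def vsheaf_of_simps by blast
  from indecomposable_sum_retract[OF Fs(1) this] obtain \<rho>s where
    \<rho>s: "length \<rho>s = length Fs" "v_iso (vsheaf_of (direct_sum Fs)) (vsheaf_of (inj_sum \<rho>s))" by blast
  have "v_iso (pos_sheaf \<rho>s :: ('p, nat \<Rightarrow> 'k) vsheaf) (pos_sheaf ls)"
    using v_iso_trans[OF v_iso_sym[OF v_iso_trans[OF \<rho>s(2) v_iso_inj_sum]] 1] .
  then show "m = length ls" using v_iso_pos_sheaf_length \<rho>s(1) Fs(3) by metis
qed

section \<open>Change of basis\<close>

text \<open>A nonzero term in the sum for the entry (i, j) yields qs ! i \<le> rs ! l \<le> cs ! j.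
  If both outer labels are \<pi>, so is the middle one, hence diagonal blocks multiply among
  themselves. The last two parts are what this says about vanishing, used to compare a diagonal
  block before and after a change of basis.\<close>

lemma labeled_matrix_mult:
  assumes N: "labeled_matrix qs rs N" and M: "labeled_matrix rs cs M"
  shows "labeled_matrix qs cs (N * M)"
    and "\<And>i j. i \<in> label_positions qs \<pi> \<Longrightarrow> j \<in> label_positions cs \<pi> \<Longrightarrow>
      (\<And>l. l \<in> label_positions rs \<pi> \<Longrightarrow> M $$ (l, j) = 0) \<Longrightarrow> (N * M) $$ (i, j) = 0"
    and "\<And>i j. i \<in> label_positions qs \<pi> \<Longrightarrow> j \<in> label_positions cs \<pi> \<Longrightarrow>
      (\<And>l. l \<in> label_positions rs \<pi> \<Longrightarrow> N $$ (i, l) = 0) \<Longrightarrow> (N * M) $$ (i, j) = 0"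
proof -
  note Nc = labeled_matrixD(1)[OF N] and Mc = labeled_matrixD(1)[OF M]
  have entry: "(N * M) $$ (i, j) = (\<Sum>l<length rs. N $$ (i, l) * M $$ (l, j))"
    if "i < length qs" "j < length cs" for i j
    using that Nc Mc by (auto simp: scalar_prod_def atLeast0LessThan intro!: sum.cong)
  have between: "qs ! i \<le> rs ! l \<and> rs ! l \<le> cs ! j"
    if "i < length qs" "j < length cs" "l < length rs" "N $$ (i, l) \<noteq> 0" "M $$ (l, j) \<noteq> 0" for i j l
    using that labeled_matrixD(2)[OF N, of i l] labeled_matrixD(2)[OF M, of l j] by auto
  show "labeled_matrix qs cs (N * M)"
    unfolding labeled_matrix_def
  proof (intro conjI allI impI)
    show "N * M \<in> carrier_mat (length qs) (length cs)" using Nc Mc by simp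
    fix i j assume ij: "i < length qs" "j < length cs" "(N * M) $$ (i, j) \<noteq> 0"
    then obtain l where "l < length rs" "N $$ (i, l) * M $$ (l, j) \<noteq> 0"
      unfolding entry[OF ij(1,2)] by (metis (no_types, lifting) lessThan_iff sum.neutral)
    then show "qs ! i \<le> cs ! j" using between[OF ij(1,2), of l] by auto
  qed
  show "(N * M) $$ (i, j) = 0"
    if ij: "i \<in> label_positions qs \<pi>" "j \<in> label_positions cs \<pi>"
      and z: "\<And>l. l \<in> label_positions rs \<pi> \<Longrightarrow> M $$ (l, j) = 0" for i j
  proof -
    have ij': "i < length qs" "j < length cs" using ij by (auto simp: label_positions_def)
    have "N $$ (i, l) * M $$ (l, j) = 0" if "l < length rs" for l
    proof (rule ccontr)
      assume "N $$ (i, l) * M $$ (l, j) \<noteq> 0"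
      then have "l \<in> label_positions rs \<pi>"
        using between[OF ij' that] ij that by (auto simp: label_positions_def intro: order.antisym)
      with z \<open>N $$ (i, l) * M $$ (l, j) \<noteq> 0\<close> show False by auto
    qed
    then show ?thesis unfolding entry[OF ij'] by (intro sum.neutral) auto
  qed
  show "(N * M) $$ (i, j) = 0"
    if ij: "i \<in> label_positions qs \<pi>" "j \<in> label_positions cs \<pi>"
      and z: "\<And>l. l \<in> label_positions rs \<pi> \<Longrightarrow> N $$ (i, l) = 0" for i j
  proof -
    have ij': "i < length qs" "j < length cs" using ij by (auto simp: label_positions_def)
    have "N $$ (i, l) * M $$ (l, j) = 0" if "l < length rs" for l
    proof (rule ccontr)
      assume "N $$ (i, l) * M $$ (l, j) \<noteq> 0"
      then have "l \<in> label_positions rs \<pi>"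
        using between[OF ij' that] ij that by (auto simp: label_positions_def intro: order.antisym)
      with z \<open>N $$ (i, l) * M $$ (l, j) \<noteq> 0\<close> show False by auto
    qed
    then show ?thesis unfolding entry[OF ij'] by (intro sum.neutral) auto
  qed
qed

lemma change_of_basisD:
  assumes "change_of_basis ls A B"
  shows "labeled_matrix ls ls A" "A \<in> carrier_mat (length ls) (length ls)"
    "B \<in> carrier_mat (length ls) (length ls)" "A * B = 1\<^sub>m (length ls)" "B * A = 1\<^sub>m (length ls)"
  using assms by (auto simp: change_of_basis_def inverts_mat_def labeled_matrix_def)

text \<open>The labels make \<open>A\<close> preserve the span of the unit vectors with label at most \<open>\<rho>\<close>. Its
  inverse does too: compressing \<open>A\<close> and \<open>B\<close> to that span and extending by the identity gives
  square matrices with a one-sided, hence two-sided, inverse.\<close>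

lemma change_of_basis_inverse_labeled:
  assumes AB: "change_of_basis ls A B"
  shows "labeled_matrix ls ls B"
  unfolding labeled_matrix_def
proof (intro conjI allI impI)
  let ?n = "length ls"
  note A = change_of_basisD(1)[OF AB] and Ac = change_of_basisD(2)[OF AB] and Bc = change_of_basisD(3)[OF AB]
  show "B \<in> carrier_mat ?n ?n" by (rule Bc)
  fix i j assume ij: "i < ?n" "j < ?n" "B $$ (i, j) \<noteq> 0"
  define U where "U = {l. l < ?n \<and> ls ! l \<le> ls ! j}"
  have BA: "app B (app A c) = c" if "c \<in> fin_space ?n" for c
    using app_mult[OF Bc Ac, of c] app_one[OF that] by (simp add: change_of_basisD(5)[OF AB])
  have ABc: "app A (app B c) = c" if "c \<in> fin_space ?n" for c
    using app_mult[OF Ac Bc, of c] app_one[OF that] by (simp add: change_of_basisD(4)[OF AB])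
  have AU: "mask_fun U (app A (mask_fun U c)) = app A (mask_fun U c)" for c
  proof
    fix l
    show "mask_fun U (app A (mask_fun U c)) l = app A (mask_fun U c) l"
    proof (cases "l \<in> U")
      case False
      have "A $$ (l, m) * mask_fun U c m = 0" if "l < ?n" "m < ?n" for m
        using labeled_matrixD(2)[OF A that] False that by (force simp: U_def)
      then show ?thesis using False Ac by (auto simp: app_def intro!: sum.neutral)
    qed simp
  qed
  define E where "E M c = mask_fun U (app M (mask_fun U c)) + (c - mask_fun U c)" for M and c :: "nat \<Rightarrow> 'b"
  have mm: "mask_fun U (mask_fun U c) = mask_fun U c" for c :: "nat \<Rightarrow> 'b" by (auto simp: fun_eq_iff)
  have Ul: "mask_fun U c \<in> fin_space ?n" for c :: "nat \<Rightarrow> 'b"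
    by (auto simp: fin_space_def U_def)
  have lE: "lin_map (E M)" for M
    unfolding E_def
    by (intro lin_map_plus lin_map_minus lin_map_ident lin_map_mask lin_map_compose[OF lin_map_mask]
        lin_map_compose[OF lin_map_app])
  have Ef: "E M c \<in> fin_space ?n" if "c \<in> fin_space ?n" for M c
    unfolding E_def using Ul that
    by (intro fun_space.subspace_add[OF subspace_fin_space] fun_space.subspace_diff[OF subspace_fin_space])
  have mE: "mask_fun U (E M c) = mask_fun U (app M (mask_fun U c))" for M c
    unfolding E_def lin_map_add[OF lin_map_mask] lin_map_diff[OF lin_map_mask] mm by simp
  have EE: "E B (E A c) = c" if "c \<in> fin_space ?n" for c
  proof -
    have "E B (E A c) = mask_fun U (app B (app A (mask_fun U c))) + (E A c - app A (mask_fun U c))"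
      unfolding E_def[of B] mE AU ..
    also have "app B (app A (mask_fun U c)) = mask_fun U c" by (rule BA[OF Ul])
    also have "E A c - app A (mask_fun U c) = c - mask_fun U c" unfolding E_def AU by simp
    finally show ?thesis unfolding mm by simp
  qed
  have "mat_of ?n ?n (E B) * mat_of ?n ?n (E A) = 1\<^sub>m ?n"
    by (rule app_eqI[of _ ?n ?n])
       (auto simp: app_mult[OF mat_of_carrier mat_of_carrier] app_mat_of[OF lE] Ef EE app_one
         intro: mult_carrier_mat[OF mat_of_carrier mat_of_carrier])
  then have inv: "mat_of ?n ?n (E A) * mat_of ?n ?n (E B) = 1\<^sub>m ?n"
    by (rule mat_mult_left_right_inverse[OF mat_of_carrier mat_of_carrier])
  define c where "c = (unit_fun j :: nat \<Rightarrow> 'b)"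
  have c: "c \<in> fin_space ?n" using ij by (simp add: c_def)
  have cU: "mask_fun U c = c" using ij by (auto simp: c_def U_def unit_fun_apply fun_eq_iff)
  have "E A (E B c) = c"
    using app_mult[OF mat_of_carrier mat_of_carrier, of ?n ?n "E A" ?n "E B" c] c
    by (simp add: inv app_one app_mat_of[OF lE] Ef)
  moreover have EB: "E B c = mask_fun U (app B c)" unfolding E_def cU by simp
  \<comment> \<open>Applying \<open>B\<close> to this shows that column \<open>j\<close> of
    \<open>B\<close> is supported in \<open>U\<close>, the rows with label at most
    \<open>ls ! j\<close>.\<close>
  ultimately have "app A (mask_fun U (app B c)) = c"
    unfolding EB unfolding E_def mm AU by simp
  then have "app B c = mask_fun U (app B c)" using BA[OF Ul[of "app B c"]] by metis
  then have "app B c i = mask_fun U (app B c) i" by metis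
  moreover have "app B c i = B $$ (i, j)" using ij Bc by (simp add: c_def app_unit)
  ultimately have "i \<in> U" using ij(3) by (metis mask_apply)
  then show "ls ! i \<le> ls ! j" by (simp add: U_def)
qed

lemma change_of_basis_sym: "change_of_basis ls A B \<Longrightarrow> change_of_basis ls B A"
  using change_of_basis_inverse_labeled[of ls A B] change_of_basisD(2)[of ls A B]
  by (auto simp: change_of_basis_def)

lemma change_of_basis_one: "change_of_basis ls (1\<^sub>m (length ls)) (1\<^sub>m (length ls))"
  by (auto simp: change_of_basis_def labeled_matrix_def inverts_mat_def)

lemma change_of_basis_mult:
  assumes A: "change_of_basis ls A A'" and B: "change_of_basis ls B B'"
  shows "change_of_basis ls (A * B) (B' * A')"
proof -
  note a = change_of_basisD[OF A] and b = change_of_basisD[OF B]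
  have "A * B * (B' * A') = A * (B * B') * A'"
    using a(2,3) b(2,3) by (simp add: assoc_mult_mat[of _ "length ls" "length ls" _ "length ls" _ "length ls"])
  moreover have "B' * A' * (A * B) = B' * (A' * A) * B"
    using a(2,3) b(2,3) by (simp add: assoc_mult_mat[of _ "length ls" "length ls" _ "length ls" _ "length ls"])
  ultimately show ?thesis
    using labeled_matrix_mult(1)[OF a(1) b(1)] a b
    by (auto simp: change_of_basis_def inverts_mat_def)
qed

text \<open>All degrees are changed at once by a family \<open>T\<close> with inverse
  \<open>T'\<close>, so that one conjugation formula covers every matrix; in degrees where nothing
  happens the family is the identity.\<close>

lemma base_change:
  assumes C: "labeled_complex n C"
    and labels: "labels D = labels C"
    and T: "\<And>e. change_of_basis (labels C e) (T e) (T' e)"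
    and mats: "\<And>e. mats D e = T (e + 1) * mats C e * T' e"
  shows "labeled_complex n D" and "v_quasi_iso (pos_complex C) (pos_complex D) (\<lambda>e. pos_map (labels C e) (T e))"
proof -
  let ?n = "\<lambda>e. length (labels C e)"
  note t = change_of_basisD[OF T] and M = labeled_complexD(2)[OF C]
  note T' = change_of_basis_inverse_labeled[OF T]
  note Mc = labeled_matrixD(1)[OF M]
  have lab: "labeled_matrix (labels C (e + 1)) (labels C e) (mats D e)" for e
    unfolding mats by (rule labeled_matrix_mult(1)[OF labeled_matrix_mult(1)[OF t(1) M] T'])
  have TD: "mats D e * T e = T (e + 1) * mats C e" for e
  proof -
    have "mats D e * T e = T (e + 1) * mats C e * (T' e * T e)"
      unfolding mats by (rule assoc_mult_mat[OF mult_carrier_mat[OF t(2) Mc] t(3) t(2)])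
    then show ?thesis using t(5)[of e] right_mult_one_mat[OF mult_carrier_mat[OF t(2) Mc, of e]] by simp
  qed
  show D: "labeled_complex n D"
    unfolding labeled_complex_def labels
  proof (intro conjI allI impI)
    fix e
    show "labels C e = []" if "e < 0 \<or> int n + 1 < e"
      using labeled_complexD(1)[OF C that] .
    show "labeled_matrix (labels C (e + 1)) (labels C e) (mats D e)" by (rule lab)
    have c2: "T (e + 1 + 1) \<in> carrier_mat (?n (e + 1 + 1)) (?n (e + 1 + 1))"
      "mats C (e + 1) \<in> carrier_mat (?n (e + 1 + 1)) (?n (e + 1))" "mats D (e + 1) \<in> carrier_mat (?n (e + 1 + 1)) (?n (e + 1))"
      using t(2)[of "e + 1 + 1"] Mc[of "e + 1"] labeled_matrixD(1)[OF lab[of "e + 1"]] by auto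
    have "mats D (e + 1) * mats D e = mats D (e + 1) * T (e + 1) * mats C e * T' e"
      unfolding mats[of e] using c2(3) t(2)[of "e + 1"] Mc[of e] t(3)[of e]
      by (simp add: assoc_mult_mat[of _ "?n (e + 1 + 1)" "?n (e + 1)" _ "?n (e + 1)" _ "?n e"]
          assoc_mult_mat[of _ "?n (e + 1 + 1)" "?n (e + 1)" _ "?n e" _ "?n e"]
          assoc_mult_mat[of _ "?n (e + 1)" "?n (e + 1)" _ "?n e" _ "?n e"])
    also have "\<dots> = T (e + 1 + 1) * (mats C (e + 1) * mats C e) * T' e"
      unfolding TD assoc_mult_mat[OF c2(1) c2(2) Mc] ..
    also have "\<dots> = 0\<^sub>m (?n (e + 2)) (?n e)"
      unfolding labeled_complexD(3)[OF C]
      using right_mult_zero_mat[OF c2(1), of "?n e"] left_mult_zero_mat[OF t(3)[of e], of "?n (e + 2)"]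
      by (simp add: add.assoc)
    finally show "mats D (e + 1) * mats D e = 0\<^sub>m (?n (e + 2)) (?n e)" .
  qed
  show "v_quasi_iso (pos_complex C) (pos_complex D) (\<lambda>e. pos_map (labels C e) (T e))"
  proof (rule v_quasi_iso_bijI[OF is_vcomplex_pos[OF C] is_vcomplex_pos[OF D],
        where g = "\<lambda>e. pos_map (labels C e) (T' e)"])
    show "v_chain (pos_complex C) (pos_complex D) (\<lambda>e. pos_map (labels C e) (T e))"
      unfolding v_chain_def pos_complex_simps labels
    proof (intro conjI allI impI)
      show "v_natural (pos_sheaf (labels C e)) (pos_sheaf (labels C e)) (pos_map (labels C e) (T e))" for e
        by (rule pos_map_natural[OF t(1)])
      show "pos_map (labels C (e + 1)) (T (e + 1)) \<sigma> (pos_map (labels C (e + 1)) (mats C e) \<sigma> v) =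
          pos_map (labels C (e + 1)) (mats D e) \<sigma> (pos_map (labels C e) (T e) \<sigma> v)" for e \<sigma> v
        unfolding pos_map_comp[OF t(1) M] pos_map_comp[OF lab t(1)] TD ..
    qed
    fix e \<sigma> and z :: "nat \<Rightarrow> 'b"
    have one: "pos_map (labels C e) (1\<^sub>m (?n e)) \<sigma> z = z" if "z \<in> stalk (pos_sheaf (labels C e)) \<sigma>"
    proof -
      have "z \<in> fin_space (?n e)" using that by (auto simp: stalk_pos_sheaf pos_support_def fin_space_def)
      then show ?thesis by (simp add: pos_map_def app_one mask_ident[OF that])
    qed
    show "pos_map (labels C e) (T' e) \<sigma> z \<in> cstalk (pos_complex C) e \<sigma>"
      by (simp add: pos_map_def mask_stalk)
    show "pos_map (labels C e) (T e) \<sigma> (pos_map (labels C e) (T' e) \<sigma> z) = z" if "z \<in> cstalk (pos_complex D) e \<sigma>"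
      unfolding pos_map_comp[OF t(1) T'] t(4) using one that by (simp add: labels)
    show "pos_map (labels C e) (T' e) \<sigma> (pos_map (labels C e) (T e) \<sigma> z) = z" if "z \<in> cstalk (pos_complex C) e \<sigma>"
      unfolding pos_map_comp[OF T' t(1)] t(5) using one that by simp
  qed
qed

text \<open>The last conclusion recovers the old matrix from the new one by labeled factors; it
  serves to carry vanishing of the diagonal block from \<open>D\<close> back to
  \<open>C\<close>.\<close>

lemma basis_step_quasi_iso:
  assumes C: "labeled_complex n C" and step: "basis_step d \<pi> C D"
  shows "labeled_complex n D" "\<exists>f. v_quasi_iso (pos_complex C) (pos_complex D) f" "labels D = labels C"
    "normalized_at (labels C (d + 1)) (labels C d) \<pi> (mats D d)"
    "\<exists>L R. labeled_matrix (labels C (d + 1)) (labels C (d + 1)) L \<and> labeled_matrix (labels C d) (labels C d) R \<and>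
       mats C d = L * mats D d * R"
proof -
  obtain L L' R R' where L: "change_of_basis (labels C (d + 1)) L L'" and R: "change_of_basis (labels C d) R R'"
    and norm: "normalized_at (labels C (d + 1)) (labels C d) \<pi> (L * mats C d * R)"
    and D: "D = C\<lparr> mats := (mats C) (d := L * mats C d * R, d - 1 := R' * mats C (d - 1), d + 1 := mats C (d + 1) * L') \<rparr>"
    using step unfolding basis_step_def by blast
  let ?n = "\<lambda>e. length (labels C e)"
  \<comment> \<open>\<open>base_change\<close> multiplies by \<open>T (e + 1)\<close> on the left
    and by \<open>T' e\<close> on the right, so degree \<open>d\<close> gets the inverse of
    \<open>R\<close> and degree \<open>d + 1\<close> gets \<open>L\<close>.\<close>
  define T where "T e = (if e = d then R' else if e = d + 1 then L else 1\<^sub>m (?n e))" for e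
  define T' where "T' e = (if e = d then R else if e = d + 1 then L' else 1\<^sub>m (?n e))" for e
  note Mc = labeled_matrixD(1)[OF labeled_complexD(2)[OF C]]
  have TT: "change_of_basis (labels C e) (T e) (T' e)" for e
    using L change_of_basis_sym[OF R] change_of_basis_one by (auto simp: T_def T'_def)
  have Mc1: "mats C (d - 1) \<in> carrier_mat (?n d) (?n (d - 1))"
    and Mc2: "mats C (d + 1) \<in> carrier_mat (?n (d + 1 + 1)) (?n (d + 1))"
    using Mc[of "d - 1"] Mc[of "d + 1"] by auto
  have mats: "mats D e = T (e + 1) * mats C e * T' e" for e
  proof -
    consider "e = d" | "e = d - 1" | "e = d + 1" | "e \<noteq> d" "e \<noteq> d - 1" "e \<noteq> d + 1" by blast
    then show ?thesis
    proof cases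
      case 1
      then show ?thesis by (simp add: D T_def T'_def)
    next
      case 2
      have "R' * mats C (d - 1) \<in> carrier_mat (?n d) (?n (d - 1))"
        using change_of_basisD(3)[OF R] Mc1 by simp
      from right_mult_one_mat[OF this] show ?thesis using 2 by (simp add: D T_def T'_def)
    next
      case 3
      then show ?thesis using Mc2 change_of_basisD(3)[OF L] by (simp add: D T_def T'_def)
    next
      case 4
      then show ?thesis using Mc[of e] by (auto simp: D T_def T'_def)
    qed
  qed
  have labels: "labels D = labels C" by (simp add: D)
  show "labels D = labels C" by fact
  show "labeled_complex n D" "\<exists>f. v_quasi_iso (pos_complex C) (pos_complex D) f"
    using base_change[OF C labels TT mats] by blast+
  show "normalized_at (labels C (d + 1)) (labels C d) \<pi> (mats D d)" using norm by (simp add: D)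
  have "mats C d = L' * mats D d * R'"
  proof -
    note l = change_of_basisD[OF L] and r = change_of_basisD[OF R]
    have "L' * (L * mats C d * R) * R' = (L' * L) * mats C d * (R * R')"
      using l(2,3) r(2,3) Mc[of d]
      by (simp add: assoc_mult_mat[of _ "?n (d + 1)" "?n (d + 1)" _ "?n d" _ "?n d"]
          assoc_mult_mat[of _ "?n (d + 1)" "?n (d + 1)" _ "?n (d + 1)" _ "?n d"]
          assoc_mult_mat[of _ "?n (d + 1)" "?n d" _ "?n d" _ "?n d"])
    then show ?thesis using l(5) r(4) Mc[of d] by (simp add: D)
  qed
  then show "\<exists>L R. labeled_matrix (labels C (d + 1)) (labels C (d + 1)) L \<and> labeled_matrix (labels C d) (labels C d) R \<and>
       mats C d = L * mats D d * R"
    using change_of_basis_inverse_labeled[OF L] change_of_basis_inverse_labeled[OF R] by blast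
qed

section \<open>Normal form of the diagonal block\<close>

lemma change_of_basis_mat_of:
  fixes f g :: "(nat \<Rightarrow> 'k::field) \<Rightarrow> nat \<Rightarrow> 'k"
  assumes f: "lin_map f" and g: "lin_map g"
    and fin: "\<And>c. c \<in> fin_space (length ls) \<Longrightarrow> f c \<in> fin_space (length ls)"
      "\<And>c. c \<in> fin_space (length ls) \<Longrightarrow> g c \<in> fin_space (length ls)"
    and inv: "\<And>c. c \<in> fin_space (length ls) \<Longrightarrow> f (g c) = c" "\<And>c. c \<in> fin_space (length ls) \<Longrightarrow> g (f c) = c"
    and labeled: "\<And>i j. i < length ls \<Longrightarrow> j < length ls \<Longrightarrow> f (unit_fun j) i \<noteq> 0 \<Longrightarrow> ls ! i \<le> ls ! j"
  shows "change_of_basis ls (mat_of (length ls) (length ls) f) (mat_of (length ls) (length ls) g)"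
proof -
  let ?n = "length ls"
  have "mat_of ?n ?n f * mat_of ?n ?n g = 1\<^sub>m ?n"
    by (rule app_eqI[of _ ?n ?n])
       (auto simp: app_mult[OF mat_of_carrier mat_of_carrier] app_mat_of[OF f] app_mat_of[OF g] fin inv app_one
         intro: mult_carrier_mat[OF mat_of_carrier mat_of_carrier])
  moreover have "mat_of ?n ?n g * mat_of ?n ?n f = 1\<^sub>m ?n"
    by (rule app_eqI[of _ ?n ?n])
       (auto simp: app_mult[OF mat_of_carrier mat_of_carrier] app_mat_of[OF f] app_mat_of[OF g] fin inv app_one
         intro: mult_carrier_mat[OF mat_of_carrier mat_of_carrier])
  ultimately show ?thesis
    using labeled by (auto simp: change_of_basis_def labeled_matrix_def inverts_mat_def mat_of_def)
qed

definition labeled_equiv :: "'p::order list \<Rightarrow> 'p list \<Rightarrow> 'k::field mat \<Rightarrow> 'k mat \<Rightarrow> bool" where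
  "labeled_equiv rs cs M N \<longleftrightarrow>
     (\<exists>L L' R R'. change_of_basis rs L L' \<and> change_of_basis cs R R' \<and> N = L * M * R)"

lemma labeled_equiv_refl:
  assumes "labeled_matrix rs cs M"
  shows "labeled_equiv rs cs M M"
  unfolding labeled_equiv_def using change_of_basis_one[of rs] change_of_basis_one[of cs] labeled_matrixD(1)[OF assms]
  by (metis left_mult_one_mat right_mult_one_mat)

lemma labeled_equiv_labeled:
  assumes "labeled_equiv rs cs M N" "labeled_matrix rs cs M"
  shows "labeled_matrix rs cs N"
  using assms labeled_matrix_mult(1) change_of_basisD(1) unfolding labeled_equiv_def by metis

lemma labeled_equiv_trans:
  assumes M: "labeled_matrix rs cs M" and "labeled_equiv rs cs M N" "labeled_equiv rs cs N P"
  shows "labeled_equiv rs cs M P"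
proof -
  obtain L L' R R' where L: "change_of_basis rs L L'" and R: "change_of_basis cs R R'" and N: "N = L * M * R"
    using assms(2) unfolding labeled_equiv_def by blast
  obtain K K' S S' where K: "change_of_basis rs K K'" and S: "change_of_basis cs S S'" and P: "P = K * N * S"
    using assms(3) unfolding labeled_equiv_def by blast
  note c = change_of_basisD(2)[OF L] change_of_basisD(2)[OF R] change_of_basisD(2)[OF K] change_of_basisD(2)[OF S]
    labeled_matrixD(1)[OF M]
  let ?r = "length rs" and ?c = "length cs"
  have "P = (K * L) * M * (R * S)"
    unfolding P N using c
    by (simp add: assoc_mult_mat[of _ ?r ?r _ ?r _ ?c] assoc_mult_mat[of _ ?r ?r _ ?c _ ?c]
        assoc_mult_mat[of _ ?r ?c _ ?c _ ?c])
  then show ?thesis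
    unfolding labeled_equiv_def using change_of_basis_mult[OF K L] change_of_basis_mult[OF R S] by blast
qed

text \<open>Row and column operations are given as functions on coefficient vectors; an entry of the
  result is then read off from the image of a single unit vector, without matrix products.\<close>

lemma labeled_equiv_functions:
  fixes M :: "'k::field mat"
  assumes M: "M \<in> carrier_mat (length rs) (length cs)"
    and L: "change_of_basis rs (mat_of (length rs) (length rs) f) L'" and f: "lin_map f"
      "\<And>c. c \<in> fin_space (length rs) \<Longrightarrow> f c \<in> fin_space (length rs)"
    and R: "change_of_basis cs (mat_of (length cs) (length cs) g) R'" and g: "lin_map g"
      "\<And>c. c \<in> fin_space (length cs) \<Longrightarrow> g c \<in> fin_space (length cs)"
  obtains N where "labeled_equiv rs cs M N"
    "\<And>a b. a < length rs \<Longrightarrow> b < length cs \<Longrightarrow> N $$ (a, b) = f (app M (g (unit_fun b))) a"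
proof -
  let ?r = "length rs" and ?c = "length cs"
  define N where "N = mat_of ?r ?r f * M * mat_of ?c ?c g"
  have cL: "mat_of ?r ?r f * M \<in> carrier_mat ?r ?c" using mult_carrier_mat[OF mat_of_carrier M] .
  have N: "N \<in> carrier_mat ?r ?c" unfolding N_def by (rule mult_carrier_mat[OF cL mat_of_carrier])
  have "N $$ (a, b) = f (app M (g (unit_fun b))) a" if "a < ?r" "b < ?c" for a b
  proof -
    have u: "(unit_fun b :: nat \<Rightarrow> 'k) \<in> fin_space ?c" using that by simp
    have "N $$ (a, b) = app N (unit_fun b) a" using that N by (simp add: app_unit)
    also have "app N (unit_fun b) = f (app M (g (unit_fun b)))"
      unfolding N_def app_mult[OF cL mat_of_carrier] app_mult[OF mat_of_carrier M]
        app_mat_of[OF g(1) u g(2)[OF u]]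
      by (rule app_mat_of[OF f(1) app_fin_space[OF M] f(2)[OF app_fin_space[OF M]]])
    finally show ?thesis .
  qed
  moreover have "labeled_equiv rs cs M N" unfolding labeled_equiv_def N_def using L R by blast
  ultimately show thesis using that by blast
qed

lemma change_of_basis_transpose:
  assumes "i < length ls" "j < length ls" "ls ! i = ls ! j"
  shows "change_of_basis ls (mat_of (length ls) (length ls) (\<lambda>c. c \<circ> Transposition.transpose i j))
     (mat_of (length ls) (length ls) (\<lambda>c. c \<circ> Transposition.transpose i j) :: 'k mat)"
    and "\<And>c :: nat \<Rightarrow> 'k. c \<in> fin_space (length ls) \<Longrightarrow> c \<circ> Transposition.transpose i j \<in> fin_space (length ls)"
    and "lin_map (\<lambda>c. c \<circ> Transposition.transpose i j :: nat \<Rightarrow> 'k::field)"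
proof -
  show lin: "lin_map (\<lambda>c. c \<circ> Transposition.transpose i j :: nat \<Rightarrow> 'k)"
    by (rule lin_mapI) (simp_all add: comp_fun_space)
  show fin: "c \<in> fin_space (length ls) \<Longrightarrow> c \<circ> Transposition.transpose i j \<in> fin_space (length ls)"
    for c :: "nat \<Rightarrow> 'k"
    using assms by (auto simp: fin_space_def Transposition.transpose_def)
  have inv: "(c \<circ> Transposition.transpose i j) \<circ> Transposition.transpose i j = c" for c :: "nat \<Rightarrow> 'k"
    by (auto simp: fun_eq_iff)
  show "change_of_basis ls (mat_of (length ls) (length ls) (\<lambda>c. c \<circ> Transposition.transpose i j :: nat \<Rightarrow> 'k))
     (mat_of (length ls) (length ls) (\<lambda>c. c \<circ> Transposition.transpose i j))"
    using assms
    by (intro change_of_basis_mat_of lin fin inv)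
       (auto simp: unit_fun_apply Transposition.transpose_def split: if_splits)
qed

text \<open>Clearing column \<open>j\<close> adds a multiple of row \<open>i\<close> to row
  \<open>a\<close> only if the entry at (a, j) is nonzero, and then rs ! a \<le> cs ! j = rs ! i, so
  the operation is labeled. Columns are treated in the same way, again because the pivot has equal
  labels. The remaining entries form the Schur complement.\<close>

lemma labeled_pivot:
  fixes M :: "'k::field mat"
  assumes M: "labeled_matrix rs cs M" and i: "i < length rs" and j: "j < length cs"
    and eq: "rs ! i = cs ! j" and nz: "M $$ (i, j) \<noteq> 0"
  obtains N where "labeled_equiv rs cs M N" "N $$ (i, j) = 1"
    "\<And>a. a < length rs \<Longrightarrow> a \<noteq> i \<Longrightarrow> N $$ (a, j) = 0" "\<And>b. b < length cs \<Longrightarrow> b \<noteq> j \<Longrightarrow> N $$ (i, b) = 0"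
    "\<And>a b. a < length rs \<Longrightarrow> b < length cs \<Longrightarrow> a \<noteq> i \<Longrightarrow> b \<noteq> j \<Longrightarrow>
       N $$ (a, b) = M $$ (a, b) - M $$ (a, j) * M $$ (i, b) / M $$ (i, j)"
proof -
  let ?r = "length rs" and ?c = "length cs" and ?k = "M $$ (i, j)"
  note Mc = labeled_matrixD(1)[OF M]
  define f where "f v = (\<lambda>a. if a = i then v i / ?k else if a < ?r then v a - M $$ (a, j) / ?k * v i else 0)"
    for v :: "nat \<Rightarrow> 'k"
  define f' where "f' v = (\<lambda>a. if a = i then ?k * v i else if a < ?r then v a + M $$ (a, j) * v i else 0)"
    for v :: "nat \<Rightarrow> 'k"
  \<comment> \<open>The multiple of unit vector \<open>j\<close> that has to be subtracted in order
    to clear row \<open>i\<close>. It does not depend on coordinate \<open>j\<close>, so reversing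
    its sign inverts the operation.\<close>
  define S where "S v = (\<Sum>b\<in>{..<?c} - {j}. M $$ (i, b) / ?k * v b)" for v :: "nat \<Rightarrow> 'k"
  define g where "g v = (\<lambda>b. if b = j then v j - S v else v b)" for v :: "nat \<Rightarrow> 'k"
  define g' where "g' v = (\<lambda>b. if b = j then v j + S v else v b)" for v :: "nat \<Rightarrow> 'k"
  have S_cong: "S v = S w" if "\<And>b. b \<noteq> j \<Longrightarrow> v b = w b" for v w
    unfolding S_def using that by (intro sum.cong) auto
  have S_unit: "S (unit_fun b) = (if b = j \<or> b \<ge> ?c then 0 else M $$ (i, b) / ?k)" for b
    unfolding S_def by (auto simp: unit_fun_apply if_distrib cong: if_cong)
  have f: "lin_map f" and f': "lin_map f'"
    by (rule lin_mapI; auto simp: f_def f'_def fun_eq_iff algebra_simps add_divide_distrib)+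
  have S_lin: "S (v + w) = S v + S w" "S (fun_scale c v) = c * S v" for v w c
    unfolding S_def by (simp_all add: sum.distrib sum_distrib_left add_divide_distrib algebra_simps)
  have g: "lin_map g" and g': "lin_map g'"
    by (rule lin_mapI; auto simp: g_def g'_def S_lin fun_eq_iff algebra_simps)+
  have ff: "f v \<in> fin_space ?r" "f' v \<in> fin_space ?r" for v
    using i by (auto simp: f_def f'_def fin_space_def)
  have gf: "g v \<in> fin_space ?c" "g' v \<in> fin_space ?c" if "v \<in> fin_space ?c" for v
    using j that by (auto simp: g_def g'_def fin_space_def)
  have L: "change_of_basis rs (mat_of ?r ?r f) (mat_of ?r ?r f')"
  proof (rule change_of_basis_mat_of[OF f f' ff])
    show "f (f' c) = c" "f' (f c) = c" if "c \<in> fin_space ?r" for c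
      using that nz i by (auto simp: f_def f'_def fin_space_def fun_eq_iff)
    fix a b assume a: "a < ?r" and "f (unit_fun b) a \<noteq> 0"
    then have "a = b \<or> b = i \<and> M $$ (a, j) \<noteq> 0"
      by (auto simp: f_def unit_fun_apply split: if_splits)
    then show "rs ! a \<le> rs ! b"
      using labeled_matrixD(2)[OF M a j] eq by auto
  qed
  have R: "change_of_basis cs (mat_of ?c ?c g) (mat_of ?c ?c g')"
  proof (rule change_of_basis_mat_of[OF g g' gf])
    have "S (g v) = S v" "S (g' v) = S v" for v
      by (rule S_cong; simp add: g_def g'_def)+
    then show "g (g' c) = c" "g' (g c) = c" for c
      by (auto simp: g_def[of "g' c"] g'_def[of "g c"] fun_eq_iff) (simp_all add: g_def g'_def)
    fix b' b assume b: "b < ?c" and "g (unit_fun b) b' \<noteq> 0"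
    then have "b' = b \<or> b' = j \<and> M $$ (i, b) \<noteq> 0"
      by (auto simp: g_def S_unit unit_fun_apply split: if_splits)
    then show "cs ! b' \<le> cs ! b"
      using labeled_matrixD(2)[OF M i b] eq by auto
  qed
  obtain N where N: "labeled_equiv rs cs M N"
    and entry: "\<And>a b. a < ?r \<Longrightarrow> b < ?c \<Longrightarrow> N $$ (a, b) = f (app M (g (unit_fun b))) a"
    using labeled_equiv_functions[OF Mc L f ff(1) R g gf(1)] by blast
  have col: "app M (g (unit_fun b)) a =
      (if b = j then M $$ (a, j) else M $$ (a, b) - M $$ (a, j) * M $$ (i, b) / ?k)"
    if "a < ?r" "b < ?c" for a b
  proof -
    have "g (unit_fun b) = (if b = j then unit_fun j else unit_fun b - fun_scale (M $$ (i, b) / ?k) (unit_fun j))"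
      using that by (auto simp: g_def S_unit unit_fun_apply fun_eq_iff)
    then show ?thesis
      using that j Mc by (auto simp: lin_map_simps[OF lin_map_app] app_unit)
  qed
  show thesis
  proof
    show "labeled_equiv rs cs M N" by (rule N)
    show "N $$ (i, j) = 1" using entry[OF i j] col[OF i j] nz by (simp add: f_def)
    show "N $$ (a, j) = 0" if "a < ?r" "a \<noteq> i" for a
      using entry[OF that(1) j] col[OF that(1) j] col[OF i j] nz that by (simp add: f_def)
    show "N $$ (i, b) = 0" if "b < ?c" "b \<noteq> j" for b
      using entry[OF i that(1)] col[OF i that(1)] nz that by (simp add: f_def)
    show "N $$ (a, b) = M $$ (a, b) - M $$ (a, j) * M $$ (i, b) / ?k"
      if "a < ?r" "b < ?c" "a \<noteq> i" "b \<noteq> j" for a b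
      using entry[OF that(1,2)] col[OF that(1,2)] col[OF i that(2)] nz that by (simp add: f_def)
  qed
qed

lemma labeled_swap:
  fixes M :: "'k::field mat"
  assumes M: "labeled_matrix rs cs M"
    and i: "i < length rs" "i' < length rs" "rs ! i = rs ! i'"
    and j: "j < length cs" "j' < length cs" "cs ! j = cs ! j'"
  obtains N where "labeled_equiv rs cs M N"
    "\<And>a b. a < length rs \<Longrightarrow> b < length cs \<Longrightarrow>
       N $$ (a, b) = M $$ (Transposition.transpose i i' a, Transposition.transpose j j' b)"
proof -
  note ti = change_of_basis_transpose[OF i, where 'k = 'k] and tj = change_of_basis_transpose[OF j, where 'k = 'k]
  obtain N where N: "labeled_equiv rs cs M N"
    and entry: "\<And>a b. a < length rs \<Longrightarrow> b < length cs \<Longrightarrow>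
      N $$ (a, b) = (app M (unit_fun b \<circ> Transposition.transpose j j') \<circ> Transposition.transpose i i') a"
    using labeled_equiv_functions[OF labeled_matrixD(1)[OF M] ti(1,3,2) tj(1,3,2)] by blast
  have "unit_fun b \<circ> Transposition.transpose j j' = (unit_fun (Transposition.transpose j j' b) :: nat \<Rightarrow> 'k)" for b
    by (auto simp: fun_eq_iff unit_fun_apply Transposition.transpose_def)
  moreover have "Transposition.transpose j j' b < length cs" if "b < length cs" for b
    using that j by (auto simp: Transposition.transpose_def)
  moreover have "Transposition.transpose i i' a < length rs" if "a < length rs" for a
    using that i by (auto simp: Transposition.transpose_def)
  ultimately have "N $$ (a, b) = M $$ (Transposition.transpose i i' a, Transposition.transpose j j' b)"
    if "a < length rs" "b < length cs" for a b
    using entry[OF that] that labeled_matrixD(1)[OF M] by (simp add: app_unit)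
  then show thesis using N that by blast
qed

text \<open>Isolation concerns the whole row and column, not only their parts labeled \<pi>.\<close>

definition isolated_entry :: "'k::field mat \<Rightarrow> nat \<Rightarrow> nat \<Rightarrow> bool" where
  "isolated_entry M i j \<longleftrightarrow>
     (\<forall>a<dim_row M. a \<noteq> i \<longrightarrow> M $$ (a, j) = 0) \<and> (\<forall>b<dim_col M. b \<noteq> j \<longrightarrow> M $$ (i, b) = 0)"

text \<open>Elimination invariant: the first \<open>t\<close> diagonal places of the \<pi>-block,
  counted within the block by \<open>pick\<close>, are finished. Pivots are kept on the diagonal
  because the normal form asks for a diagonal block.\<close>

definition pivots ::
  "'p list \<Rightarrow> 'p list \<Rightarrow> 'p \<Rightarrow> nat \<Rightarrow> 'k::field mat \<Rightarrow> bool" where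
  "pivots rs cs \<pi> t M \<longleftrightarrow> t \<le> card (label_positions rs \<pi>) \<and> t \<le> card (label_positions cs \<pi>) \<and>
     (\<forall>s<t. M $$ (pick (label_positions rs \<pi>) s, pick (label_positions cs \<pi>) s) = 1 \<and>
        isolated_entry M (pick (label_positions rs \<pi>) s) (pick (label_positions cs \<pi>) s))"

lemma pick_inject:
  "a < card S \<Longrightarrow> b < card S \<Longrightarrow> pick S a = pick S b \<longleftrightarrow> a = b"
  using card_pick_le by metis

lemma label_positionsD: "i \<in> label_positions ls \<pi> \<Longrightarrow> i < length ls" "i \<in> label_positions ls \<pi> \<Longrightarrow> ls ! i = \<pi>"
  by (auto simp: label_positions_def)

text \<open>A nonzero entry is swapped to place \<open>t\<close> and used as pivot. Finished pivots
  survive, because the swaps touch only places from \<open>t\<close> on, and because finished rows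
  and columns are zero where they meet the new pivot column and row, which kills the Schur
  correction.\<close>

lemma pivots_step:
  fixes M :: "'k::field mat"
  assumes M: "labeled_matrix rs cs M" and piv: "pivots rs cs \<pi> t M"
    and a: "t \<le> a" "a < card (label_positions rs \<pi>)" and b: "t \<le> b" "b < card (label_positions cs \<pi>)"
    and nz: "M $$ (pick (label_positions rs \<pi>) a, pick (label_positions cs \<pi>) b) \<noteq> 0"
  obtains N where "labeled_equiv rs cs M N" "pivots rs cs \<pi> (Suc t) N"
proof -
  let ?S = "label_positions rs \<pi>" and ?T = "label_positions cs \<pi>"
  let ?p = "pick ?S" and ?q = "pick ?T"
  have t: "t < card ?S" "t < card ?T" using a b by auto
  have p: "?p s < length rs" "rs ! ?p s = \<pi>" if "s < card ?S" for s
    using label_positionsD[OF label_positions_pick[OF that]] .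
  have q: "?q s < length cs" "cs ! ?q s = \<pi>" if "s < card ?T" for s
    using label_positionsD[OF label_positions_pick[OF that]] .
  have eqp: "rs ! ?p a = rs ! ?p t" and eqq: "cs ! ?q b = cs ! ?q t"
    using p(2)[OF a(2)] p(2)[OF t(1)] q(2)[OF b(2)] q(2)[OF t(2)] by simp_all
  let ?\<tau> = "Transposition.transpose (?p a) (?p t)" and ?\<tau>' = "Transposition.transpose (?q b) (?q t)"
  obtain M1 where M1: "labeled_equiv rs cs M M1"
    and e1: "\<And>x y. x < length rs \<Longrightarrow> y < length cs \<Longrightarrow> M1 $$ (x, y) = M $$ (?\<tau> x, ?\<tau>' y)"
    using labeled_swap[OF M p(1)[OF a(2)] p(1)[OF t(1)] eqp q(1)[OF b(2)] q(1)[OF t(2)] eqq] by metis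
  have M1l: "labeled_matrix rs cs M1" using labeled_equiv_labeled[OF M1 M] .
  have nz1: "M1 $$ (?p t, ?q t) \<noteq> 0"
    using nz e1[OF p(1)[OF t(1)] q(1)[OF t(2)]] by simp
  have \<tau>l: "?\<tau> x < length rs" if "x < length rs" for x
    using that p(1)[OF a(2)] p(1)[OF t(1)] by (auto simp: Transposition.transpose_def)
  have \<tau>l': "?\<tau>' y < length cs" if "y < length cs" for y
    using that q(1)[OF b(2)] q(1)[OF t(2)] by (auto simp: Transposition.transpose_def)
  note Mc = labeled_matrixD(1)[OF M]
  have old: "M1 $$ (?p s, ?q s) = 1" "\<And>x. x < length rs \<Longrightarrow> x \<noteq> ?p s \<Longrightarrow> M1 $$ (x, ?q s) = 0"
    "\<And>y. y < length cs \<Longrightarrow> y \<noteq> ?q s \<Longrightarrow> M1 $$ (?p s, y) = 0" if s: "s < t" for s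
  proof -
    have sS: "s < card ?S" "s < card ?T" using s t by auto
    have fix_p: "?\<tau> (?p s) = ?p s"
      using pick_inject[OF sS(1) a(2)] pick_inject[OF sS(1) t(1)] s a(1) by (simp add: Transposition.transpose_def)
    have fix_q: "?\<tau>' (?q s) = ?q s"
      using pick_inject[OF sS(2) b(2)] pick_inject[OF sS(2) t(2)] s b(1) by (simp add: Transposition.transpose_def)
    have o: "M $$ (?p s, ?q s) = 1" "isolated_entry M (?p s) (?q s)"
      using piv s by (auto simp: pivots_def)
    show "M1 $$ (?p s, ?q s) = 1"
      using e1[OF p(1)[OF sS(1)] q(1)[OF sS(2)]] fix_p fix_q o(1) by simp
    show "M1 $$ (x, ?q s) = 0" if x: "x < length rs" "x \<noteq> ?p s" for x
    proof -
      have "?\<tau> x \<noteq> ?p s" using x(2) fix_p by (metis transpose_involutory)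
      then show ?thesis
        using e1[OF x(1) q(1)[OF sS(2)]] fix_q o(2) \<tau>l[OF x(1)] Mc by (simp add: isolated_entry_def)
    qed
    show "M1 $$ (?p s, y) = 0" if y: "y < length cs" "y \<noteq> ?q s" for y
    proof -
      have "?\<tau>' y \<noteq> ?q s" using y(2) fix_q by (metis transpose_involutory)
      then show ?thesis
        using e1[OF p(1)[OF sS(1)] y(1)] fix_p o(2) \<tau>l'[OF y(1)] Mc by (simp add: isolated_entry_def)
    qed
  qed
  have "rs ! ?p t = cs ! ?q t" using p(2)[OF t(1)] q(2)[OF t(2)] by simp
  then obtain N where N: "labeled_equiv rs cs M1 N" "N $$ (?p t, ?q t) = 1"
    and n1: "\<And>x. x < length rs \<Longrightarrow> x \<noteq> ?p t \<Longrightarrow> N $$ (x, ?q t) = 0"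
    and n2: "\<And>y. y < length cs \<Longrightarrow> y \<noteq> ?q t \<Longrightarrow> N $$ (?p t, y) = 0"
    and n3: "\<And>x y. x < length rs \<Longrightarrow> y < length cs \<Longrightarrow> x \<noteq> ?p t \<Longrightarrow> y \<noteq> ?q t \<Longrightarrow>
       N $$ (x, y) = M1 $$ (x, y) - M1 $$ (x, ?q t) * M1 $$ (?p t, y) / M1 $$ (?p t, ?q t)"
    using labeled_pivot[OF M1l p(1)[OF t(1)] q(1)[OF t(2)] _ nz1] by metis
  have Nl: "labeled_matrix rs cs N" using labeled_equiv_labeled[OF N(1) M1l] .
  note Nc = labeled_matrixD(1)[OF Nl]
  have "N $$ (?p s, ?q s) = 1 \<and> isolated_entry N (?p s) (?q s)" if s: "s < Suc t" for s
  proof (cases "s = t")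
    case True
    then show ?thesis using N(2) n1 n2 Nc by (simp add: isolated_entry_def)
  next
    case False
    then have s: "s < t" using s by simp
    have sS: "s < card ?S" "s < card ?T" using s t by auto
    have ne: "?p s \<noteq> ?p t" "?q s \<noteq> ?q t"
      using pick_inject[OF sS(1) t(1)] pick_inject[OF sS(2) t(2)] s by auto
    have row0: "M1 $$ (?p s, ?q t) = 0" using old(3)[OF s q(1)[OF t(2)]] ne(2) by simp
    have col0: "M1 $$ (?p t, ?q s) = 0" using old(2)[OF s p(1)[OF t(1)]] ne(1) by simp
    have "N $$ (?p s, ?q s) = 1"
      using n3[OF p(1)[OF sS(1)] q(1)[OF sS(2)] ne] old(1)[OF s] row0 by simp
    moreover have "N $$ (x, ?q s) = 0" if "x < length rs" "x \<noteq> ?p s" for x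
      using n3[OF that(1) q(1)[OF sS(2)] _ ne(2)] n2[OF q(1)[OF sS(2)] ne(2)] old(2)[OF s that] col0
      by (cases "x = ?p t") auto
    moreover have "N $$ (?p s, y) = 0" if "y < length cs" "y \<noteq> ?q s" for y
      using n3[OF p(1)[OF sS(1)] that(1) ne(1)] n1[OF p(1)[OF sS(1)] ne(1)] old(3)[OF s that] row0
      by (cases "y = ?q t") auto
    ultimately show ?thesis using Nc by (simp add: isolated_entry_def)
  qed
  then have "pivots rs cs \<pi> (Suc t) N" using t by (simp add: pivots_def)
  then show thesis using that labeled_equiv_trans[OF M M1 N(1)] by blast
qed

text \<open>Elimination goes on while the block has a nonzero entry beyond the first
  \<open>t\<close> places. When none is left, every nonzero block entry is a finished pivot, and
  isolation yields all parts of the normal form.\<close>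

lemma ex_normalized:
  fixes M :: "'k::field mat"
  assumes "labeled_matrix rs cs M" "pivots rs cs \<pi> t M"
  shows "\<exists>N. labeled_equiv rs cs M N \<and> normalized_at rs cs \<pi> N"
  using assms
proof (induction "card (label_positions rs \<pi>) - t" arbitrary: t M rule: less_induct)
  case less
  let ?S = "label_positions rs \<pi>" and ?T = "label_positions cs \<pi>"
  let ?p = "pick ?S" and ?q = "pick ?T"
  note M = less.prems(1) and piv = less.prems(2)
  show ?case
  proof (cases "\<exists>a b. t \<le> a \<and> a < card ?S \<and> t \<le> b \<and> b < card ?T \<and> M $$ (?p a, ?q b) \<noteq> 0")
    case True
    then obtain a b where ab: "t \<le> a" "a < card ?S" "t \<le> b" "b < card ?T" "M $$ (?p a, ?q b) \<noteq> 0" by blast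
    obtain N where N: "labeled_equiv rs cs M N" "pivots rs cs \<pi> (Suc t) N"
      using pivots_step[OF M piv ab] by blast
    have "card ?S - Suc t < card ?S - t" using ab by simp
    from less.hyps[OF this labeled_equiv_labeled[OF N(1) M] N(2)] labeled_equiv_trans[OF M N(1)]
    show ?thesis by blast
  next
    case False
    note Mc = labeled_matrixD(1)[OF M]
    have nz: "a = b \<and> a < t" if ab: "a < card ?S" "b < card ?T" "M $$ (?p a, ?q b) \<noteq> 0" for a b
    proof -
      have pl: "?p a < length rs" and ql: "?q b < length cs"
        using label_positionsD(1)[OF label_positions_pick[OF ab(1)]] label_positionsD(1)[OF label_positions_pick[OF ab(2)]] .
      have "a < t \<or> b < t" using False ab by (metis not_le)
      then show ?thesis
      proof
        assume "a < t"
        then have "isolated_entry M (?p a) (?q a)" "a < card ?T" using piv by (auto simp: pivots_def)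
        then have "?q b = ?q a" using ab(3) ql Mc by (auto simp: isolated_entry_def)
        then show ?thesis using pick_inject[OF ab(2) \<open>a < card ?T\<close>] \<open>a < t\<close> by simp
      next
        assume "b < t"
        then have "isolated_entry M (?p b) (?q b)" "b < card ?S" using piv by (auto simp: pivots_def)
        then have "?p a = ?p b" using ab(3) pl Mc by (auto simp: isolated_entry_def)
        then show ?thesis using pick_inject[OF ab(1) \<open>b < card ?S\<close>] \<open>b < t\<close> by simp
      qed
    qed
    have iso: "isolated_entry M i j \<and> M $$ (i, j) = 1 \<and> (\<exists>a<t. i = ?p a \<and> j = ?q a)"
      if ij: "i \<in> ?S" "j \<in> ?T" "M $$ (i, j) \<noteq> 0" for i j
    proof -
      obtain a where a: "a < card ?S" "?p a = i" using label_positions_pick_ex[OF ij(1)] .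
      obtain b where b: "b < card ?T" "?q b = j" using label_positions_pick_ex[OF ij(2)] .
      have "a = b" "a < t" using nz[OF a(1) b(1)] ij(3) a b by auto
      then show ?thesis using piv a b by (auto simp: pivots_def)
    qed
    have "normalized_at rs cs \<pi> M"
      unfolding normalized_at_def
    proof (intro conjI allI impI)
      let ?B = "labeled_submatrix rs cs M {\<pi>} {\<pi>}"
      have B: "?B \<in> carrier_mat (card ?S) (card ?T)" using submatrix_labels(1)[OF Mc] .
      have Be: "?B $$ (a, b) = M $$ (?p a, ?q b)" if "a < card ?S" "b < card ?T" for a b
        using submatrix_labels(2)[OF Mc that] .
      show "diagonal_mat ?B"
        unfolding diagonal_mat_def using B Be nz by auto
      have dims: "dim_row ?B = card ?S" "dim_col ?B = card ?T" using B by auto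
      have val: "?B $$ (a, b) \<in> {0, 1}" if ab: "a < card ?S" "b < card ?T" for a b
        unfolding Be[OF ab]
        using iso[OF label_positions_pick[OF ab(1)] label_positions_pick[OF ab(2)]] by auto
      show "elements_mat ?B \<subseteq> {0, 1}"
      proof
        fix x assume "x \<in> elements_mat ?B"
        then obtain a b where ab: "a < dim_row ?B" "b < dim_col ?B" and x: "x = ?B $$ (a, b)"
          by (elim elements_matD[THEN exE] exE conjE)
        have "a < card ?S" "b < card ?T" using ab unfolding dims .
        then show "x \<in> {0, 1}" unfolding x by (rule val)
      qed
      show "(\<forall>i<length rs. rs ! i = \<pi> \<longrightarrow> M $$ (i, j) = 0) \<or> (\<forall>i<length rs. rs ! i \<noteq> \<pi> \<longrightarrow> M $$ (i, j) = 0)"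
        if "j < length cs" "cs ! j = \<pi>" for j
      proof (cases "\<exists>i\<in>?S. M $$ (i, j) \<noteq> 0")
        case True
        then obtain i where i: "i \<in> ?S" "M $$ (i, j) \<noteq> 0" by blast
        have "j \<in> ?T" using that by (simp add: label_positions_def)
        then have "isolated_entry M i j" using iso i by blast
        then show ?thesis using i(1) Mc by (auto simp: isolated_entry_def label_positions_def)
      qed (auto simp: label_positions_def)
      show "(\<forall>j<length cs. cs ! j = \<pi> \<longrightarrow> M $$ (i, j) = 0) \<or> (\<forall>j<length cs. cs ! j \<noteq> \<pi> \<longrightarrow> M $$ (i, j) = 0)"
        if "i < length rs" "rs ! i = \<pi>" for i
      proof (cases "\<exists>j\<in>?T. M $$ (i, j) \<noteq> 0")
        case True
        then obtain j where j: "j \<in> ?T" "M $$ (i, j) \<noteq> 0" by blast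
        have "i \<in> ?S" using that by (simp add: label_positions_def)
        then have "isolated_entry M i j" using iso j by blast
        then show ?thesis using j(1) Mc by (auto simp: isolated_entry_def label_positions_def)
      qed (auto simp: label_positions_def)
    qed
    then show ?thesis using labeled_equiv_refl[OF M] by blast
  qed
qed

lemma ex_basis_step:
  assumes C: "labeled_complex n C"
  shows "\<exists>D. basis_step d \<pi> C D"
proof -
  have "pivots (labels C (d + 1)) (labels C d) \<pi> 0 (mats C d)" by (simp add: pivots_def)
  from ex_normalized[OF labeled_complexD(2)[OF C] this]
  show ?thesis unfolding labeled_equiv_def basis_step_def by blast
qed

text \<open>The invariant of the inner loop. Unlike the normal form it does not refer to the
  numbering within the block, so it passes directly to the matrix after a deletion.\<close>

definition isolated_block :: "('p, 'k::field) labeled_data \<Rightarrow> int \<Rightarrow> 'p \<Rightarrow> bool" where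
  "isolated_block C d \<pi> \<longleftrightarrow>
     (\<forall>i\<in>label_positions (labels C (d + 1)) \<pi>. \<forall>j\<in>label_positions (labels C d) \<pi>.
        mats C d $$ (i, j) \<noteq> 0 \<longrightarrow> isolated_entry (mats C d) i j)"

text \<open>In the column of the entry, the other \<pi>-rows are excluded by diagonality and the
  remaining rows by the two zero alternatives, of which the entry itself rules out the first; rows
  behave alike. This covers every admissible outcome of step (i), not only the one found by
  elimination.\<close>

lemma normalized_at_block:
  assumes M: "M \<in> carrier_mat (length rs) (length cs)" and norm: "normalized_at rs cs \<pi> M"
    and ij: "i \<in> label_positions rs \<pi>" "j \<in> label_positions cs \<pi>" "M $$ (i, j) \<noteq> 0"
  shows "M $$ (i, j) = 1" "isolated_entry M i j"
proof -
  let ?S = "label_positions rs \<pi>" and ?T = "label_positions cs \<pi>" and ?B = "labeled_submatrix rs cs M {\<pi>} {\<pi>}"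
  note B = submatrix_labels(1)[OF M, of \<pi>] and Be = submatrix_labels(2)[OF M, where \<pi> = \<pi>]
  obtain a where a: "a < card ?S" "pick ?S a = i" using label_positions_pick_ex[OF ij(1)] .
  obtain b where b: "b < card ?T" "pick ?T b = j" using label_positions_pick_ex[OF ij(2)] .
  have diag: "diagonal_mat ?B" and el: "elements_mat ?B \<subseteq> {0, 1}"
    using norm by (auto simp: normalized_at_def)
  have nz: "x = y" if "x < card ?S" "y < card ?T" "?B $$ (x, y) \<noteq> 0" for x y
    using diag B that unfolding diagonal_mat_def by auto
  have ab: "a = b" using nz[OF a(1) b(1)] Be[OF a(1) b(1)] ij(3) a b by simp
  have "?B $$ (a, b) \<in> {0, 1}" by (rule subsetD[OF el elements_matI[OF B a(1) b(1) refl]])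
  then show "M $$ (i, j) = 1" using Be[OF a(1) b(1)] ij(3) a b by simp
  note il = label_positionsD[OF ij(1)] and jl = label_positionsD[OF ij(2)]
  have col: "(\<forall>i<length rs. rs ! i = \<pi> \<longrightarrow> M $$ (i, j) = 0) \<or> (\<forall>i<length rs. rs ! i \<noteq> \<pi> \<longrightarrow> M $$ (i, j) = 0)"
    using norm jl unfolding normalized_at_def by (elim conjE allE[of _ j]) simp
  have row: "(\<forall>j<length cs. cs ! j = \<pi> \<longrightarrow> M $$ (i, j) = 0) \<or> (\<forall>j<length cs. cs ! j \<noteq> \<pi> \<longrightarrow> M $$ (i, j) = 0)"
    using norm il unfolding normalized_at_def by (elim conjE allE[of _ i]) simp
  show "isolated_entry M i j"
    unfolding isolated_entry_def
  proof (intro conjI allI impI)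
    fix x assume "x < dim_row M" and ne: "x \<noteq> i"
    then have x: "x < length rs" using M by simp
    show "M $$ (x, j) = 0"
    proof (cases "rs ! x = \<pi>")
      case True
      then have "x \<in> ?S" using x by (simp add: label_positions_def)
      then obtain a' where a': "a' < card ?S" "pick ?S a' = x" by (rule label_positions_pick_ex)
      then have "a' \<noteq> b" using ne a(2) ab by blast
      then have "?B $$ (a', b) = 0" using nz[OF a'(1) b(1)] by blast
      then show ?thesis unfolding Be[OF a'(1) b(1)] a'(2) b(2) .
    next
      case False
      with col il ij(3) x show ?thesis by blast
    qed
  next
    fix y assume "y < dim_col M" and ne: "y \<noteq> j"
    then have y: "y < length cs" using M by simp
    show "M $$ (i, y) = 0"
    proof (cases "cs ! y = \<pi>")
      case True
      then have "y \<in> ?T" using y by (simp add: label_positions_def)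
      then obtain b' where b': "b' < card ?T" "pick ?T b' = y" by (rule label_positions_pick_ex)
      then have "a \<noteq> b'" using ne b(2) ab by blast
      then have "?B $$ (a, b') = 0" using nz[OF a(1) b'(1)] by blast
      then show ?thesis unfolding Be[OF a(1) b'(1)] a(2) b'(2) .
    next
      case False
      with row jl ij(3) y show ?thesis by blast
    qed
  qed
qed

text \<open>If the new block were zero, so would be the old one, which arises from it by labeled
  factors. Each pass through the outer loop therefore performs at least one deletion before it can
  leave the inner loop.\<close>

lemma basis_step_block:
  assumes C: "labeled_complex n C" and step: "basis_step d \<pi> C D"
  shows "isolated_block D d \<pi>" and "loop_guard C d \<pi> \<Longrightarrow> \<exists>E. delete_step d \<pi> D E"
proof -
  let ?S = "label_positions (labels C (d + 1)) \<pi>" and ?T = "label_positions (labels C d) \<pi>"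
  note s = basis_step_quasi_iso[OF C step]
  have M: "labeled_matrix (labels C (d + 1)) (labels C d) (mats D d)"
    using labeled_complexD(2)[OF s(1)] by (simp add: s(3))
  note block = normalized_at_block[OF labeled_matrixD(1)[OF M] s(4)]
  show "isolated_block D d \<pi>"
    unfolding isolated_block_def s(3) using block(2) by blast
  assume "loop_guard C d \<pi>"
  then obtain i j where ij: "i \<in> ?S" "j \<in> ?T" "mats C d $$ (i, j) \<noteq> 0"
    using loop_guard_iff[OF labeled_matrixD(1)[OF labeled_complexD(2)[OF C]]] by blast
  obtain L R where L: "labeled_matrix (labels C (d + 1)) (labels C (d + 1)) L"
    and R: "labeled_matrix (labels C d) (labels C d) R" and eq: "mats C d = L * mats D d * R"
    using s(5) by blast
  have "\<exists>i\<in>?S. \<exists>j\<in>?T. mats D d $$ (i, j) \<noteq> 0"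
  proof (rule ccontr)
    assume "\<not> ?thesis"
    then have z: "mats D d $$ (x, y) = 0" if "x \<in> ?S" "y \<in> ?T" for x y using that by blast
    have "(L * mats D d) $$ (i, y) = 0" if "y \<in> ?T" for y
      by (rule labeled_matrix_mult(2)[OF L M ij(1) that]) (rule z[OF _ that])
    then have "(L * mats D d * R) $$ (i, j) = 0"
      by (intro labeled_matrix_mult(3)[OF labeled_matrix_mult(1)[OF L M] R ij(1,2)])
    then show False using ij(3) eq by simp
  qed
  then obtain x y where xy: "x \<in> ?S" "y \<in> ?T" "mats D d $$ (x, y) \<noteq> 0" by blast
  have "mats D d $$ (x, y) = 1" by (rule block(1)[OF xy])
  then show "\<exists>E. delete_step d \<pi> D E"
    unfolding delete_step_def s(3) using label_positionsD[OF xy(1)] label_positionsD[OF xy(2)] by blast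
qed

section \<open>Deleting rows and columns\<close>

text \<open>The sets to which this is applied are complements of points or everything, hence
  infinite, so \<open>pick S\<close> is cut down to indices below \<open>n\<close>.\<close>

lemma bij_betw_pick:
  "bij_betw (pick S) {..<card {i. i < n \<and> i \<in> S}} {i. i < n \<and> i \<in> S}"
proof -
  have "bij_betw (pick {i. i < n \<and> i \<in> S}) {..<card {i. i < n \<and> i \<in> S}} {i. i < n \<and> i \<in> S}"
    by (rule bij_betw_pick_card) simp
  moreover have "pick {i. i < n \<and> i \<in> S} k = pick S k" if "k \<in> {..<card {i. i < n \<and> i \<in> S}}" for k
    using pick_reduce_set[of k n S] that by simp
  ultimately show ?thesis by (rule bij_betw_cong[THEN iffD1, rotated])
qed

context
  fixes n and C D :: "('p::order, 'k::field) labeled_data" and S :: "int \<Rightarrow> nat set"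
  assumes C: "labeled_complex n C"
    and labels_D: "\<And>e. labels D e = nths (labels C e) (S e)"
    and mats_D: "\<And>e. mats D e = submatrix (mats C e) (S (e + 1)) (S e)"
    and zero: "\<And>e i j. i < length (labels C (e + 1)) \<Longrightarrow> i \<in> S (e + 1) \<Longrightarrow>
      j < length (labels C e) \<Longrightarrow> j \<notin> S e \<Longrightarrow> mats C e $$ (i, j) = 0"
begin

abbreviation (input) kept :: "int \<Rightarrow> nat set" where
  "kept e \<equiv> {i. i < length (labels C e) \<and> i \<in> S e}"

text \<open>The assumption \<open>zero\<close> says that kept rows see no deleted columns, that is,
  the deleted coordinates span a subcomplex; \<open>project\<close> is the quotient map by
  it.\<close>

definition project :: "int \<Rightarrow> (nat \<Rightarrow> 'k) \<Rightarrow> nat \<Rightarrow> 'k" where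
  "project e c = (\<lambda>k. if k < length (labels D e) then c (pick (S e) k) else 0)"

lemma length_labels_D: "length (labels D e) = card (kept e)"
  by (simp add: labels_D length_nths)

lemma pick_kept:
  assumes "k < length (labels D e)"
  shows "pick (S e) k \<in> S e" "pick (S e) k < length (labels C e)" "labels D e ! k = labels C e ! pick (S e) k"
proof -
  have k: "k < card (kept e)" using assms by (simp add: length_labels_D)
  then have "pick (S e) k \<in> kept e" using bij_betwE[OF bij_betw_pick[of "S e" "length (labels C e)"]] by blast
  then show "pick (S e) k \<in> S e" "pick (S e) k < length (labels C e)" by auto
  show "labels D e ! k = labels C e ! pick (S e) k" unfolding labels_D by (rule nth_nths[OF k])
qed

lemma pick_kept_ex:
  assumes "i < length (labels C e)" "i \<in> S e"
  obtains k where "k < length (labels D e)" "pick (S e) k = i"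
proof -
  have "i \<in> pick (S e) ` {..<card (kept e)}"
    unfolding bij_betw_imp_surj_on[OF bij_betw_pick] using assms by simp
  then show thesis using that unfolding length_labels_D by blast
qed

lemma pick_kept_inject:
  "k < length (labels D e) \<Longrightarrow> l < length (labels D e) \<Longrightarrow> pick (S e) k = pick (S e) l \<longleftrightarrow> k = l"
  using inj_on_eq_iff[OF bij_betw_imp_inj_on[OF bij_betw_pick[of "S e" "length (labels C e)"]], of k l]
  unfolding length_labels_D by simp

lemma mats_D_entry:
  assumes "k < length (labels D (e + 1))" "l < length (labels D e)"
  shows "mats D e $$ (k, l) = mats C e $$ (pick (S (e + 1)) k, pick (S e) l)"
proof -
  have M: "mats C e \<in> carrier_mat (length (labels C (e + 1))) (length (labels C e))"
    using labeled_matrixD(1)[OF labeled_complexD(2)[OF C]] .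
  show ?thesis
    using M assms unfolding mats_D by (intro submatrix_index) (simp_all add: length_labels_D)
qed

lemma mats_D_carrier: "mats D e \<in> carrier_mat (length (labels D (e + 1))) (length (labels D e))"
proof -
  have "mats C e \<in> carrier_mat (length (labels C (e + 1))) (length (labels C e))"
    using labeled_matrixD(1)[OF labeled_complexD(2)[OF C]] .
  then show ?thesis
    unfolding mats_D by (intro carrier_matI) (simp_all add: dim_submatrix length_labels_D)
qed

lemma lin_map_project: "lin_map (project e)"
  by (rule lin_mapI) (auto simp: project_def fun_eq_iff)

text \<open>The two sums differ by the deleted columns only, and on kept rows their entries are zero
  by \<open>zero\<close>.\<close>

lemma app_project: "app (mats D e) (project e c) = project (e + 1) (app (mats C e) c)"
proof
  fix k
  let ?M = "mats C e"
  have M: "?M \<in> carrier_mat (length (labels C (e + 1))) (length (labels C e))"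
    using labeled_matrixD(1)[OF labeled_complexD(2)[OF C]] .
  show "app (mats D e) (project e c) k = project (e + 1) (app ?M c) k"
  proof (cases "k < length (labels D (e + 1))")
    case True
    let ?i = "pick (S (e + 1)) k"
    note i = pick_kept(1,2)[OF True]
    have "app (mats D e) (project e c) k = (\<Sum>l<card (kept e). ?M $$ (?i, pick (S e) l) * c (pick (S e) l))"
      using True mats_D_carrier[of e]
      by (auto simp: app_def project_def mats_D_entry length_labels_D[symmetric] intro!: sum.cong)
    also have "\<dots> = (\<Sum>j\<in>kept e. ?M $$ (?i, j) * c j)"
      by (rule sum.reindex_bij_betw[OF bij_betw_pick])
    also have "\<dots> = (\<Sum>j<length (labels C e). ?M $$ (?i, j) * c j)"
      by (rule sum.mono_neutral_left) (use zero[OF i(2,1)] in auto)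
    also have "\<dots> = project (e + 1) (app ?M c) k"
      using True i M by (simp add: project_def app_def)
    finally show ?thesis .
  next
    case False
    then show ?thesis using mats_D_carrier[of e] by (simp add: app_def project_def)
  qed
qed

lemma project_surj:
  assumes "z \<in> stalk (pos_sheaf (labels D e)) \<sigma>"
  shows "\<exists>u\<in>stalk (pos_sheaf (labels C e)) \<sigma>. project e u = z"
proof -
  define u where "u i = (if i \<in> kept e then z (the_inv_into {..<length (labels D e)} (pick (S e)) i) else 0)" for i
  have u: "u (pick (S e) k) = z k" if "k < length (labels D e)" for k
  proof -
    have "inj_on (pick (S e)) {..<length (labels D e)}"
      by (rule inj_onI) (simp add: pick_kept_inject)
    then show ?thesis using that pick_kept(1,2)[OF that] by (simp add: u_def the_inv_into_f_f)
  qed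
  have "u i = 0" if "i \<notin> pos_support (labels C e) \<sigma>" for i
  proof (cases "i \<in> kept e")
    case True
    then have "i < length (labels C e)" "i \<in> S e" by simp_all
    then obtain k where k: "k < length (labels D e)" "pick (S e) k = i" by (rule pick_kept_ex)
    then have "k \<notin> pos_support (labels D e) \<sigma>"
      using that True pick_kept(3)[OF k(1)] by (auto simp: pos_support_def)
    then show ?thesis using assms u[OF k(1)] k(2) by (simp add: stalk_pos_sheaf)
  qed (auto simp: u_def)
  then have "u \<in> stalk (pos_sheaf (labels C e)) \<sigma>" by (simp add: stalk_pos_sheaf)
  moreover have "project e u = z"
  proof
    show "project e u k = z k" for k
      using u[of k] assms by (cases "k < length (labels D e)") (simp_all add: project_def stalk_pos_sheaf pos_support_def)
  qed
  ultimately show ?thesis by blast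
qed

lemma project_mask:
  "project e (mask_fun (pos_support (labels C e) \<sigma>) c) = mask_fun (pos_support (labels D e) \<sigma>) (project e c)"
proof
  show "project e (mask_fun (pos_support (labels C e) \<sigma>) c) k =
      mask_fun (pos_support (labels D e) \<sigma>) (project e c) k" for k
    using pick_kept(2,3)[of k e] by (cases "k < length (labels D e)") (simp_all add: project_def pos_support_def)
qed

lemma project_natural: "v_natural (pos_sheaf (labels C e)) (pos_sheaf (labels D e)) (\<lambda>\<sigma>. project e)"
  unfolding v_natural_def
proof (intro conjI allI impI)
  fix \<sigma> and c :: "nat \<Rightarrow> 'k" assume "c \<in> stalk (pos_sheaf (labels C e)) \<sigma>"
  then show "project e c \<in> stalk (pos_sheaf (labels D e)) \<sigma>"
    using project_mask[of e \<sigma> c] mask_ident[of c "labels C e" \<sigma>] mask_stalk[of "labels D e" \<sigma> "project e c"] by simp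
qed (simp_all add: lin_map_project rho_pos_sheaf project_mask)

lemma labeled_complex_delete: "labeled_complex n D"
  unfolding labeled_complex_def
proof (intro conjI allI impI)
  fix e
  show "labels D e = []" if "e < 0 \<or> int n + 1 < e"
    unfolding labels_D labeled_complexD(1)[OF C that] by simp
  show "labeled_matrix (labels D (e + 1)) (labels D e) (mats D e)"
    unfolding labeled_matrix_def
    using labeled_matrixD(2)[OF labeled_complexD(2)[OF C, of e]]
    by (auto simp: mats_D_carrier mats_D_entry pick_kept)
  have c2: "mats D (e + 1) \<in> carrier_mat (length (labels D (e + 2))) (length (labels D (e + 1)))"
    using mats_D_carrier[of "e + 1"] by (simp add: add.assoc)
  have c3: "mats C (e + 1) \<in> carrier_mat (length (labels C (e + 2))) (length (labels C (e + 1)))"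
    using labeled_matrixD(1)[OF labeled_complexD(2)[OF C, of "e + 1"]] by (simp add: add.assoc)
  show "mats D (e + 1) * mats D e = 0\<^sub>m (length (labels D (e + 2))) (length (labels D e))"
  proof (rule app_eqI[OF mult_carrier_mat[OF c2 mats_D_carrier] zero_carrier_mat])
    fix v :: "nat \<Rightarrow> 'k" assume v: "v \<in> fin_space (length (labels D e))"
    \<comment> \<open>Extension of \<open>v\<close> by zero to the deleted coordinates, so that the
      product can be evaluated in \<open>C\<close>.\<close>
    define u where "u i = (if i \<in> kept e then v (the_inv_into {..<length (labels D e)} (pick (S e)) i) else 0)" for i
    have inj: "inj_on (pick (S e)) {..<length (labels D e)}"
      by (rule inj_onI) (simp add: pick_kept_inject)
    have u: "project e u = v"
    proof
      show "project e u k = v k" for k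
        using v pick_kept(1,2)[of k e] the_inv_into_f_f[OF inj, of k]
        by (cases "k < length (labels D e)") (simp_all add: project_def u_def fin_space_def)
    qed
    have "app (mats D (e + 1) * mats D e) v = project (e + 1 + 1) (app (mats C (e + 1)) (app (mats C e) u))"
      unfolding app_mult[OF c2 mats_D_carrier] u[symmetric] app_project ..
    also have "app (mats C (e + 1)) (app (mats C e) u) = 0"
      unfolding app_mult[OF c3 labeled_matrixD(1)[OF labeled_complexD(2)[OF C, of e]], symmetric]
        labeled_complexD(3)[OF C] by (rule app_zero)
    finally show "app (mats D (e + 1) * mats D e) v = app (0\<^sub>m (length (labels D (e + 2))) (length (labels D e))) v"
      unfolding app_zero lin_map_zero[OF lin_map_project] .
  qed
qed

text \<open>The kernel of \<open>project\<close> is the subcomplex of deleted coordinates, and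
  \<open>acyc\<close> states that it is acyclic.\<close>

lemma project_quasi_iso:
  assumes acyc: "\<And>e \<sigma> u. u \<in> stalk (pos_sheaf (labels C e)) \<sigma> \<Longrightarrow> (\<And>i. i \<in> kept e \<Longrightarrow> u i = 0) \<Longrightarrow>
      pos_map (labels C (e + 1)) (mats C e) \<sigma> u = 0 \<Longrightarrow>
      \<exists>x\<in>stalk (pos_sheaf (labels C (e - 1))) \<sigma>. (\<forall>i\<in>kept (e - 1). x i = 0) \<and>
        pos_map (labels C e) (mats C (e - 1)) \<sigma> x = u"
  shows "v_quasi_iso (pos_complex C) (pos_complex D) (\<lambda>e \<sigma>. project e)"
proof (rule v_quasi_iso_surjI[OF is_vcomplex_pos[OF C] is_vcomplex_pos[OF labeled_complex_delete]])
  show "v_chain (pos_complex C) (pos_complex D) (\<lambda>e \<sigma>. project e)"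
    unfolding v_chain_def pos_complex_simps
    by (simp add: project_natural pos_map_def project_mask app_project)
  fix e \<sigma>
  show "\<exists>u\<in>cstalk (pos_complex C) e \<sigma>. project e u = z" if "z \<in> cstalk (pos_complex D) e \<sigma>" for z
    using project_surj that by simp
  fix u assume u: "u \<in> cstalk (pos_complex C) e \<sigma>" "project e u = 0" "vdif (pos_complex C) e \<sigma> u = 0"
  have "u i = 0" if i: "i \<in> kept e" for i
  proof -
    have "i < length (labels C e)" "i \<in> S e" using i by simp_all
    then obtain k where k: "k < length (labels D e)" "pick (S e) k = i" by (rule pick_kept_ex)
    have "project e u k = 0" unfolding u(2) by simp
    then show ?thesis using k by (simp add: project_def)
  qed
  then obtain x where x: "x \<in> stalk (pos_sheaf (labels C (e - 1))) \<sigma>" "\<forall>i\<in>kept (e - 1). x i = 0"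
    "pos_map (labels C e) (mats C (e - 1)) \<sigma> x = u"
    using acyc[of u e \<sigma>] u(1,3) by auto
  have "project (e - 1) x = 0"
  proof
    show "project (e - 1) x k = 0 k" for k
      using x(2) pick_kept(1,2)[of k "e - 1"] by (simp add: project_def)
  qed
  then show "\<exists>x\<in>cstalk (pos_complex C) (e - 1) \<sigma>. project (e - 1) x = 0 \<and> vdif (pos_complex C) (e - 1) \<sigma> x = u"
    using x by auto
qed

end

lemma submatrix_UNIV: "submatrix M UNIV UNIV = M"
  by (rule eq_matI) (auto simp: dim_submatrix submatrix_index pick_UNIV)

lemma nths_UNIV: "nths xs UNIV = xs"
  by (rule nths_all) simp

text \<open>Isolation is what makes plain deletion correct, without correction terms in the
  neighboring matrices: the differential sends unit vector \<open>j\<close> exactly to unit vector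
  \<open>i\<close>, so these two span a subcomplex, and it is acyclic because both positions carry
  the label \<pi>.\<close>

lemma delete_step_quasi_iso:
  fixes C D :: "('p::order, 'k::field) labeled_data"
  assumes C: "labeled_complex n C" and step: "delete_step d \<pi> C D" and block: "isolated_block C d \<pi>"
  shows "labeled_complex n D" "\<exists>f. v_quasi_iso (pos_complex C) (pos_complex D) f" "isolated_block D d \<pi>"
    "\<And>e. length (labels D e) \<le> length (labels C e)" "length (labels D d) < length (labels C d)"
proof -
  obtain i j where i: "i < length (labels C (d + 1))" and j: "j < length (labels C d)"
    and li: "labels C (d + 1) ! i = \<pi>" and lj: "labels C d ! j = \<pi>" and one: "mats C d $$ (i, j) = 1"
    and D: "D = \<lparr> labels = (labels C)
                (d + 1 := nths (labels C (d + 1)) (- {i}),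
                 d := nths (labels C d) (- {j})),
              mats = (mats C)
                (d := submatrix (mats C d) (- {i}) (- {j}),
                 d - 1 := submatrix (mats C (d - 1)) (- {j}) UNIV,
                 d + 1 := submatrix (mats C (d + 1)) UNIV (- {i})) \<rparr>"
    using step unfolding delete_step_def by (elim exE conjE) (rule that)
  \<comment> \<open>With \<open>UNIV\<close> in untouched degrees, changed and unchanged matrices
    get one uniform description as submatrices.\<close>
  define S where "S e = (if e = d then - {j} else if e = d + 1 then - {i} else UNIV)" for e
  have labels_D: "labels D e = nths (labels C e) (S e)" for e
    by (simp add: D S_def nths_UNIV)
  have mats_D: "mats D e = submatrix (mats C e) (S (e + 1)) (S e)" for e
  proof -
    consider "e = d" | "e = d - 1" | "e = d + 1" | "e \<noteq> d" "e \<noteq> d - 1" "e \<noteq> d + 1" by blast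
    then show ?thesis by cases (auto simp: D S_def submatrix_UNIV)
  qed
  note M = labeled_complexD(2)[OF C] note Mc = labeled_matrixD(1)[OF M]
  have iso: "isolated_entry (mats C d) i j"
    using block i j li lj one by (auto simp: isolated_block_def label_positions_def)
  have col: "app (mats C d) (unit_fun j) = unit_fun i"
    using iso i j one Mc[of d] by (auto simp: app_unit unit_fun_apply isolated_entry_def fun_eq_iff)
  have zero: "mats C e $$ (a, b) = 0"
    if ab: "a < length (labels C (e + 1))" "a \<in> S (e + 1)" "b < length (labels C e)" "b \<notin> S e" for e a b
  proof -
    consider "e = d" "b = j" "a \<noteq> i" | "e = d + 1" "b = i"
      using ab by (auto simp: S_def split: if_splits)
    then show ?thesis
    proof cases
      case 1
      then show ?thesis using iso ab(1) Mc[of d] by (simp add: isolated_entry_def)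
    next
      case 2
      have c2: "mats C (d + 1) \<in> carrier_mat (length (labels C (d + 2))) (length (labels C (d + 1)))"
        using Mc[of "d + 1"] by (simp add: add.assoc)
      \<comment> \<open>Unit vector \<open>i\<close> is a boundary, so column \<open>i\<close> of
        the next matrix is already zero.\<close>
      have "app (mats C (d + 1)) (unit_fun i) = 0"
        unfolding col[symmetric] app_mult[OF c2 Mc, symmetric] labeled_complexD(3)[OF C] by (rule app_zero)
      then have "app (mats C (d + 1)) (unit_fun i) a = 0" by (metis zero_fun_apply)
      then show ?thesis using 2 ab(1) i Mc[of "d + 1"] by (simp add: app_unit)
    qed
  qed
  show D': "labeled_complex n D"
    by (rule labeled_complex_delete[OF C labels_D mats_D zero])
  have "v_quasi_iso (pos_complex C) (pos_complex D) (\<lambda>e \<sigma>. project D S e)"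
  proof (rule project_quasi_iso[OF C labels_D mats_D zero])
    fix e \<sigma> and u :: "nat \<Rightarrow> 'k"
    assume u: "u \<in> stalk (pos_sheaf (labels C e)) \<sigma>"
      and ker: "\<And>a. a \<in> {i. i < length (labels C e) \<and> i \<in> S e} \<Longrightarrow> u a = 0"
      and du: "pos_map (labels C (e + 1)) (mats C e) \<sigma> u = 0"
    have out: "u a = 0" if "a \<in> S e" for a
      using ker[of a] u that by (auto simp: stalk_pos_sheaf pos_support_def)
    have 0: "0 \<in> stalk (pos_sheaf ls) \<sigma>" for ls by (simp add: stalk_pos_sheaf)
    have z: "\<exists>x\<in>stalk (pos_sheaf (labels C (e - 1))) \<sigma>.
        (\<forall>i\<in>{i. i < length (labels C (e - 1)) \<and> i \<in> S (e - 1)}. x i = 0) \<and>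
        pos_map (labels C e) (mats C (e - 1)) \<sigma> x = u" if "u = 0"
      using that 0 by (intro bexI[of _ 0]) (auto simp: pos_map_def lin_map_zero[OF lin_map_app] lin_map_zero[OF lin_map_mask])
    consider "e = d" | "e = d + 1" | "e \<noteq> d" "e \<noteq> d + 1" by blast
    then show "\<exists>x\<in>stalk (pos_sheaf (labels C (e - 1))) \<sigma>.
        (\<forall>i\<in>{i. i < length (labels C (e - 1)) \<and> i \<in> S (e - 1)}. x i = 0) \<and>
        pos_map (labels C e) (mats C (e - 1)) \<sigma> x = u"
    proof cases
      case 1
      have eq: "u = fun_scale (u j) (unit_fun j)"
        using out 1 by (auto simp: S_def unit_fun_apply fun_eq_iff)
      \<comment> \<open>In degree \<open>d\<close> the subcomplex has no nonzero cocycle: its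
        generator is sent to the generator of degree \<open>d + 1\<close>, which is present at
        \<sigma> as well because the labels agree.\<close>
      have "u j = 0"
      proof (rule ccontr)
        assume nz: "u j \<noteq> 0"
        then have "j \<in> pos_support (labels C d) \<sigma>" using u 1 by (auto simp: stalk_pos_sheaf)
        then have sup: "i \<in> pos_support (labels C (d + 1)) \<sigma>" using i li lj by (simp add: pos_support_def)
        have "app (mats C d) u = fun_scale (u j) (unit_fun i)"
          by (subst eq) (simp only: lin_map_scale[OF lin_map_app] col)
        then have "pos_map (labels C (d + 1)) (mats C d) \<sigma> u i = u j"
          using sup by (simp add: pos_map_def unit_fun_apply)
        then show False using du 1 nz by simp
      qed
      then have "u = 0" using eq fun_space.scale_zero_left by metis
      then show ?thesis by (rule z)
    next
      case 2
      have eq: "u = fun_scale (u i) (unit_fun i)"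
        using out 2 by (auto simp: S_def unit_fun_apply fun_eq_iff)
      \<comment> \<open>In degree \<open>d + 1\<close> every element of the subcomplex is the image
        of the corresponding multiple of unit vector \<open>j\<close>. Where \<sigma> is not below
        \<pi>, the coefficient \<open>u i\<close> is zero, so \<open>?x\<close> still lies in the
        stalk.\<close>
      let ?x = "fun_scale (u i) (unit_fun j)"
      have "?x \<in> stalk (pos_sheaf (labels C d)) \<sigma>"
      proof (cases "u i = 0")
        case False
        then have "i \<in> pos_support (labels C (d + 1)) \<sigma>" using u 2 by (auto simp: stalk_pos_sheaf)
        then have "j \<in> pos_support (labels C d) \<sigma>" using j li lj by (simp add: pos_support_def)
        then show ?thesis by (auto simp: stalk_pos_sheaf unit_fun_apply)
      qed (simp add: stalk_pos_sheaf)
      moreover have "pos_map (labels C (d + 1)) (mats C d) \<sigma> ?x = u"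
        unfolding pos_map_def lin_map_scale[OF lin_map_app] col eq[symmetric]
        using mask_ident[OF u] 2 by simp
      moreover have "\<forall>a\<in>{i. i < length (labels C d) \<and> i \<in> S d}. ?x a = 0"
        by (auto simp: S_def unit_fun_apply)
      ultimately show ?thesis unfolding 2 by (intro bexI[of _ ?x]) simp_all
    next
      case 3
      then have "u = 0" using out by (auto simp: S_def fun_eq_iff)
      then show ?thesis by (rule z)
    qed
  qed
  then show "\<exists>f. v_quasi_iso (pos_complex C) (pos_complex D) f" by blast
  have entry: "mats D e $$ (k, l) = mats C e $$ (pick (S (e + 1)) k, pick (S e) l)"
    if "k < length (labels D (e + 1))" "l < length (labels D e)" for e k l
    by (rule mats_D_entry[OF C labels_D mats_D zero]) (assumption | rule that)+
  have carrier: "mats D e \<in> carrier_mat (length (labels D (e + 1))) (length (labels D e))" for e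
    using labeled_matrixD(1)[OF labeled_complexD(2)[OF D']] .
  have pk: "pick (S e) k < length (labels C e)" "labels D e ! k = labels C e ! pick (S e) k"
    if "k < length (labels D e)" for e k
    by (rule pick_kept(2,3)[OF C labels_D mats_D zero]; (assumption | rule that))+
  have inj: "pick (S e) k = pick (S e) l \<longleftrightarrow> k = l"
    if "k < length (labels D e)" "l < length (labels D e)" for e k l
    by (rule pick_kept_inject[OF C labels_D mats_D zero]) (assumption | rule that)+
  show "isolated_block D d \<pi>"
    unfolding isolated_block_def
  proof (intro ballI impI)
    fix a b assume a: "a \<in> label_positions (labels D (d + 1)) \<pi>" and b: "b \<in> label_positions (labels D d) \<pi>"
      and nz: "mats D d $$ (a, b) \<noteq> 0"
    have al: "a < length (labels D (d + 1))" and bl: "b < length (labels D d)"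
      using a b by (auto simp: label_positions_def)
    have "pick (S (d + 1)) a \<in> label_positions (labels C (d + 1)) \<pi>" "pick (S d) b \<in> label_positions (labels C d) \<pi>"
      using a b pk[OF al] pk[OF bl] by (auto simp: label_positions_def)
    then have "isolated_entry (mats C d) (pick (S (d + 1)) a) (pick (S d) b)"
      using block nz entry[OF al bl] by (auto simp: isolated_block_def)
    then show "isolated_entry (mats D d) a b"
      using carrier[of d] Mc[of d] al bl
      by (auto simp: isolated_entry_def entry pk inj)
  qed
  show "length (labels D e) \<le> length (labels C e)" for e
  proof -
    have "card {i. i < length (labels C e) \<and> i \<in> S e} \<le> card {..<length (labels C e)}"
      by (rule card_mono) auto
    then show ?thesis by (simp add: labels_D length_nths)
  qed
  have "card {i. i < length (labels C d) \<and> i \<in> S d} < card {..<length (labels C d)}"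
    by (rule psubset_card_mono) (use j in \<open>auto simp: S_def\<close>)
  then show "length (labels D d) < length (labels C d)" by (simp add: labels_D length_nths)
qed

section \<open>The peeling algorithm\<close>

lemma quasi_isomorphic_trans:
  "quasi_isomorphic J K \<Longrightarrow> quasi_isomorphic K L \<Longrightarrow> quasi_isomorphic J L"
  unfolding quasi_isomorphic_def by (rule equivclp_trans)

lemma quasi_isomorphic_sym: "quasi_isomorphic J K \<Longrightarrow> quasi_isomorphic K J"
  unfolding quasi_isomorphic_def by (rule equivclp_sym)

lemma quasi_isomorphic_refl: "quasi_isomorphic K K"
  unfolding quasi_isomorphic_def by (rule equivclp_refl)

lemma quasi_isomorphicI:
  assumes "sheaf_complex K" "sheaf_complex L" "v_quasi_iso (vcomplex_of K) (vcomplex_of L) f"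
  shows "quasi_isomorphic K L"
  using quasi_iso_of_v_quasi_iso[OF assms] assms(1,2)
  unfolding quasi_isomorphic_def by (intro r_into_equivclp) blast

lemma quasi_isomorphic_complex_of:
  assumes C: "labeled_complex n C" and D: "labeled_complex n D"
    and f: "v_quasi_iso (pos_complex C) (pos_complex D) f"
  shows "quasi_isomorphic (complex_of D) (complex_of C)"
proof -
  note vC = is_vcomplex_of[OF sheaf_complex_complex_of[OF C]] and vD = is_vcomplex_of[OF sheaf_complex_complex_of[OF D]]
  note pC = is_vcomplex_pos[OF C] and pD = is_vcomplex_pos[OF D]
  note c1 = v_quasi_iso_compose[OF vC pC pD v_quasi_iso_expand[OF C] f]
  note c2 = v_quasi_iso_compose[OF vC pD vD c1 v_quasi_iso_compress[OF D]]
  from quasi_isomorphicI[OF sheaf_complex_complex_of[OF C] sheaf_complex_complex_of[OF D] c2]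
  show ?thesis by (rule quasi_isomorphic_sym)
qed

lemma represents_quasi_isomorphic:
  assumes C: "labeled_complex n C" and I: "sheaf_complex I" and rep: "represents C I"
  shows "quasi_isomorphic (complex_of C) I"
proof -
  note S = sheaf_complex_complex_of[OF C]
  obtain f g where f: "chain_map (complex_of C) I f" and g: "chain_map I (complex_of C) g"
    and inv: "\<And>d \<sigma>. g d \<sigma> * f d \<sigma> = 1\<^sub>m (stalk_dim (obj (complex_of C) d) \<sigma>)"
      "\<And>d \<sigma>. f d \<sigma> * g d \<sigma> = 1\<^sub>m (stalk_dim (obj I d) \<sigma>)"
    using rep unfolding represents_def complex_iso_def by blast
  have fc: "f d \<sigma> \<in> carrier_mat (stalk_dim (obj I d) \<sigma>) (stalk_dim (obj (complex_of C) d) \<sigma>)"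
    and gc: "g d \<sigma> \<in> carrier_mat (stalk_dim (obj (complex_of C) d) \<sigma>) (stalk_dim (obj I d) \<sigma>)" for d \<sigma>
    using f g chain_map_iff_v_chain[OF S I] chain_map_iff_v_chain[OF I S] by blast+
  have "v_quasi_iso (vcomplex_of (complex_of C)) (vcomplex_of I) (\<lambda>d \<sigma>. app (f d \<sigma>))"
  proof (rule v_quasi_iso_bijI[OF is_vcomplex_of[OF S] is_vcomplex_of[OF I], where g = "\<lambda>d \<sigma>. app (g d \<sigma>)"])
    show "v_chain (vcomplex_of (complex_of C)) (vcomplex_of I) (\<lambda>d \<sigma>. app (f d \<sigma>))"
      using f chain_map_iff_v_chain[OF S I] by blast
    fix d \<sigma> and z :: "nat \<Rightarrow> 'b"
    show "app (g d \<sigma>) z \<in> cstalk (vcomplex_of (complex_of C)) d \<sigma>"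
      using app_fin_space[OF gc] by simp
    show "app (f d \<sigma>) (app (g d \<sigma>) z) = z" if "z \<in> cstalk (vcomplex_of I) d \<sigma>"
      using that by (simp add: app_mult[OF fc gc, symmetric] inv app_one)
    show "app (g d \<sigma>) (app (f d \<sigma>) z) = z" if "z \<in> cstalk (vcomplex_of (complex_of C)) d \<sigma>"
      using that by (simp add: app_mult[OF gc fc, symmetric] inv app_one)
  qed
  then show ?thesis by (rule quasi_isomorphicI[OF S I])
qed

lemma represents_complex_of:
  assumes C: "labeled_complex n C"
  shows "represents C (complex_of C)"
proof -
  let ?K = "complex_of C"
  note S = sheaf_complex_complex_of[OF C]
  let ?id = "\<lambda>d \<sigma>. 1\<^sub>m (stalk_dim (obj ?K d) \<sigma>)"
  have "chain_map ?K ?K ?id"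
    unfolding chain_map_def natural_def
  proof (intro conjI allI impI)
    fix d and \<sigma> \<tau> :: 'a assume le: "\<sigma> \<le> \<tau>"
    note r = sheafD(1)[OF sheaf_complexD(1)[OF S] le, of d]
    show "1\<^sub>m (stalk_dim (obj ?K d) \<tau>) * res (obj ?K d) \<sigma> \<tau> = res (obj ?K d) \<sigma> \<tau> * 1\<^sub>m (stalk_dim (obj ?K d) \<sigma>)"
      by (simp only: left_mult_one_mat[OF r] right_mult_one_mat[OF r])
  next
    fix d \<sigma>
    show "1\<^sub>m (stalk_dim (obj ?K (d + 1)) \<sigma>) * dif ?K d \<sigma> = dif ?K d \<sigma> * 1\<^sub>m (stalk_dim (obj ?K d) \<sigma>)"
      by (simp only: left_mult_one_mat[OF naturalD(1)[OF sheaf_complexD(2)[OF S]]]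
          right_mult_one_mat[OF naturalD(1)[OF sheaf_complexD(2)[OF S]]])
  qed simp
  then show ?thesis
    unfolding represents_def complex_iso_def by (intro exI[of _ ?id]) simp
qed

text \<open>Both numbers of summands are lengths of label lists. \<open>J\<close> is only isomorphic
  to sums of sheaves \<open>[\<pi>]\<close> degree by degree, so it is first put into coordinates;
  the zigzag then becomes a single quasi-isomorphism to which \<open>unguarded_length_le\<close>
  applies.\<close>

lemma minimal_unguarded:
  fixes C :: "('p::{finite,order}, 'k::field) labeled_data"
  assumes C: "labeled_complex n C" and guard: "\<nexists>d \<pi>. loop_guard C d \<pi>"
  shows "minimal_injective_complex (complex_of C)"
  unfolding minimal_injective_complex_def
proof (intro conjI allI impI)
  show "injective_complex (complex_of C)" by (rule injective_complex_complex_of[OF C])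
  fix J :: "('p, 'k) complex_data" and d
  assume J: "injective_complex J \<and> quasi_isomorphic J (complex_of C)"
  then have Js: "sheaf_complex J" by (simp add: injective_complex_def)
  obtain L ls a \<alpha> where L: "is_vcomplex L" and ls: "\<And>d. vobj L d = pos_sheaf (ls d)"
    and bound: "\<And>d. d < a \<Longrightarrow> ls d = []" and \<alpha>: "v_quasi_iso (vcomplex_of J) L \<alpha>"
    and iso: "\<And>d. sheaf_iso (obj J d) (inj_sum (ls d))"
    using injective_complex_coordinates J by metis
  obtain h where h: "v_quasi_iso (vcomplex_of (complex_of C)) L h"
    using quasi_isomorphic_v_quasi_iso[OF Js L ls bound \<alpha>] J by metis
  note S = sheaf_complex_complex_of[OF C]
  have "v_quasi_iso (pos_complex C) L (\<lambda>d \<sigma> v. h d \<sigma> (compress (labels C d) \<sigma> v))"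
    by (rule v_quasi_iso_compose[OF is_vcomplex_pos[OF C] is_vcomplex_of[OF S] L v_quasi_iso_compress[OF C] h])
  then have "length (labels C d) \<le> length (ls d)"
    by (rule unguarded_length_le[OF C guard L ls])
  moreover have "num_indecomposable_summands (obj J d) = length (ls d)"
    using num_indecomposable_summands_eq[OF sheaf_complexD(1)[OF Js] iso] .
  moreover have "num_indecomposable_summands (obj (complex_of C) d) = length (labels C d)"
  proof (rule num_indecomposable_summands_eq)
    show "sheaf (obj (complex_of C) d)" by (rule sheaf_complexD(1)[OF S])
    have "v_iso F F" for F :: "('p, nat \<Rightarrow> 'k) vsheaf"
      unfolding v_iso_def by (intro exI[of _ "\<lambda>_ v. v"]) (simp add: v_natural_id)
    then show "sheaf_iso (obj (complex_of C) d) (inj_sum (labels C d))"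
      unfolding complex_of_simps(1)[OF C] by (simp add: sheaf_iso_iff_v_iso sheaf_inj_sum)
  qed
  ultimately show "num_indecomposable_summands (obj (complex_of C) d) \<le> num_indecomposable_summands (obj J d)"
    by simp
qed

section \<open>Invariant and termination of the loops\<close>

fun peel_invariant :: "nat \<Rightarrow> ('p::order, 'k::field) labeled_data \<Rightarrow> ('p, 'k) peel_state \<Rightarrow> bool" where
  "peel_invariant n C (Outer D) \<longleftrightarrow> labeled_complex n D \<and> quasi_isomorphic (complex_of D) (complex_of C)"
| "peel_invariant n C (Inner d \<pi> D) \<longleftrightarrow>
     labeled_complex n D \<and> quasi_isomorphic (complex_of D) (complex_of C) \<and> isolated_block D d \<pi>"

text \<open>The range extends to \<open>n + 1\<close> because the rows of the last matrix are
  labeled in that degree; outside it a labeled complex has no labels.\<close>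

definition label_count :: "nat \<Rightarrow> ('p, 'k) labeled_data \<Rightarrow> nat" where
  "label_count n D = (\<Sum>e\<in>{0..int n + 1}. length (labels D e))"

text \<open>An \<open>Inner\<close> state in which a deletion is still possible ranks below the \<open>Outer\<close> state it was
  entered from, and one in which none is possible ranks above the \<open>Outer\<close> state that follows it.\<close>

fun peel_measure :: "nat \<Rightarrow> ('p::order, 'k::field) peel_state \<Rightarrow> nat" where
  "peel_measure n (Outer D) = 3 * label_count n D + 1"
| "peel_measure n (Inner d \<pi> D) = 3 * label_count n D + (if \<exists>E. delete_step d \<pi> D E then 0 else 2)"

lemma peel_step_invariant:
  assumes "peel_step s s'" "peel_invariant n C s"
  shows "peel_invariant n C s' \<and> peel_measure n s' < peel_measure n s"
  using assms
proof cases
  case (enter D d \<pi> E)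
  then have D: "labeled_complex n D" and q: "quasi_isomorphic (complex_of D) (complex_of C)" using assms(2) by auto
  note b = basis_step_quasi_iso[OF D enter(4)] and bb = basis_step_block[OF D enter(4)]
  obtain f where "v_quasi_iso (pos_complex D) (pos_complex E) f" using b(2) by blast
  then have "quasi_isomorphic (complex_of E) (complex_of C)"
    using quasi_isomorphic_trans[OF quasi_isomorphic_complex_of[OF D b(1)] q] by blast
  moreover have "label_count n E = label_count n D" by (simp add: label_count_def b(3))
  \<comment> \<open>The guard makes a deletion possible in \<open>E\<close>, so with an unchanged
    number of labels the rank drops by one.\<close>
  ultimately show ?thesis using enter b(1) bb by auto
next
  case (delete d \<pi> D E)
  then have D: "labeled_complex n D" and q: "quasi_isomorphic (complex_of D) (complex_of C)"
    and block: "isolated_block D d \<pi>" using assms(2) by auto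
  note b = delete_step_quasi_iso[OF D delete(3) block]
  obtain f where "v_quasi_iso (pos_complex D) (pos_complex E) f" using b(2) by blast
  then have "quasi_isomorphic (complex_of E) (complex_of C)"
    using quasi_isomorphic_trans[OF quasi_isomorphic_complex_of[OF D b(1)] q] by blast
  moreover have "label_count n E < label_count n D"
    unfolding label_count_def
  proof (rule sum_strict_mono_ex1)
    have "labels D d \<noteq> []" using b(5) by auto
    then have "d \<in> {0..int n + 1}" using labeled_complexD(1)[OF D, of d] by force
    then show "\<exists>e\<in>{0..int n + 1}. length (labels E e) < length (labels D e)" using b(5) by blast
  qed (use b(4) in auto)
  \<comment> \<open>Each lost label counts 3, which outweighs the rise from 0 to 2 in case no
    further deletion is possible.\<close>
  ultimately show ?thesis using delete b(1,3) by auto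
next
  case (leave d \<pi> D)
  then show ?thesis using assms(2) by auto
qed

lemma peel_terminates:
  assumes "peel_invariant n C s"
  shows "termip peel_step s"
  using assms
proof (induction "peel_measure n s" arbitrary: s rule: less_induct)
  case less
  show ?case
  proof (rule accpI)
    fix s' assume "peel_step\<inverse>\<inverse> s' s"
    then have "peel_step s s'" by simp
    from peel_step_invariant[OF this less.prems] less.hyps show "termip peel_step s'" by blast
  qed
qed

lemma peel_invariant_steps:
  assumes "peel_step\<^sup>*\<^sup>* s s'" "peel_invariant n C s"
  shows "peel_invariant n C s'"
  using assms by (induction rule: rtranclp_induct) (auto dest: peel_step_invariant)

theorem proposition4p12:
  fixes I :: "('p::{finite, order}, 'k::field) complex_data"
    and C :: "('p, 'k) labeled_data"
    and n :: nat
  assumes "injective_complex I"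
    and "labeled_complex n C"
    and "represents C I"
  shows "termip peel_step (Outer C) \<and>
    (\<forall>s. peel_step\<^sup>*\<^sup>* (Outer C) s \<and> (\<nexists>s'. peel_step s s') \<longrightarrow> (\<exists>D. peel_returns s D)) \<and>
    (\<forall>s D. peel_step\<^sup>*\<^sup>* (Outer C) s \<and> peel_returns s D \<longrightarrow>
      labeled_complex n D \<and>
      (\<exists>J. represents D J \<and> minimal_injective_complex J \<and> quasi_isomorphic J I))"
proof (intro conjI allI impI)
  have start: "peel_invariant n C (Outer C)"
    using assms(2) quasi_isomorphic_refl by simp
  then show "termip peel_step (Outer C)" by (rule peel_terminates)
  fix s
  show "\<exists>D. peel_returns s D" if "peel_step\<^sup>*\<^sup>* (Outer C) s \<and> (\<nexists>s'. peel_step s s')"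
  proof (cases s)
    case (Outer D)
    have "labeled_complex n D" using peel_invariant_steps[of "Outer C" s n C] that start Outer by simp
    \<comment> \<open>If the guard held, \<open>ex_basis_step\<close> would supply a step, so a run
      stuck here has left the loop properly.\<close>
    then have "\<nexists>d \<pi>. loop_guard D d \<pi>"
      using that ex_basis_step enter unfolding Outer by metis
    then show ?thesis using Outer by (auto simp: peel_returns_def)
  next
    case (Inner d \<pi> D)
    then show ?thesis using that delete leave by metis
  qed
  fix D assume *: "peel_step\<^sup>*\<^sup>* (Outer C) s \<and> peel_returns s D"
  then have s: "s = Outer D" and guard: "\<nexists>d \<pi>. loop_guard D d \<pi>" by (auto simp: peel_returns_def)
  have D: "labeled_complex n D" and q: "quasi_isomorphic (complex_of D) (complex_of C)"
    using peel_invariant_steps[of "Outer C" s n C] * start s by auto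
  show "labeled_complex n D" by (rule D)
  have "sheaf_complex I" using assms(1) by (simp add: injective_complex_def)
  \<comment> \<open>The witness for \<open>J\<close> is \<open>complex_of D\<close> itself.\<close>
  from quasi_isomorphic_trans[OF q represents_quasi_isomorphic[OF assms(2) this assms(3)]]
  show "\<exists>J. represents D J \<and> minimal_injective_complex J \<and> quasi_isomorphic J I"
    using represents_complex_of[OF D] minimal_unguarded[OF D guard] by blast
qed



end
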